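(* Let $\mathbb{L}\subset\mathbb{Z}^N$ be a rank $2$ subgroup which is not contained in any of the standard coordinate hyperplanes of $\mathbb{Z}^N$ and is perpendicular to $(1,\ldots,1)$. Let $\mathcal{S}$ be a perfect surface for $\mathbb{L}$ (as defined in the context) with set of tiles $E$, let $\varpi:E\to\mathbb{C}\setminus\{0\}$ be a weight function, and let $\mathbb{K}^{\varpi}$ be the corresponding bi-adjacency matrix (a square matrix). Then the Newton polytope of its determinant is the secondary polygon of $\mathbb{L}\subset\mathbb{Z}^N$: $$\mathsf{Newton}(\det\mathbb{K}^{\varpi})=\Sigma(\mathbb{L}).$$ The vertices of $\mathsf{Newton}(\det\mathbb{K}^{\varpi})$ are the points $\widehat{P_C}$ given by the perfect matchings $P_C$ with $C$ a $2$-dimensional cone in the secondary fan of $\mathbb{L}$.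
   Context: Notation: $\mathbf{e}_1,\ldots,\mathbf{e}_N$ is the standard basis of $\mathbb{Z}^N$; "perpendicular to $(1,\ldots,1)$" means all elements of $\mathbb{L}$ have coordinate sum $0$. Let $B$ be a $2\times N$-matrix whose rows form a $\mathbb{Z}$-basis of $\mathbb{L}$, with columns $\mathbf{b}_1,\ldots,\mathbf{b}_N$; these are viewed as vectors in $\mathbb{L}_{\mathbb{R}}^\vee=\mathrm{Hom}(\mathbb{L},\mathbb{R})\simeq\mathbb{R}^2$. Secondary fan and polygon: the secondary fan consists of $\{0\}$, the half-lines $\mathbb{R}_{\geq 0}\mathbf{b}_i$, and the $2$-dimensional cones which are the closures of the connected components of $\mathbb{L}_{\mathbb{R}}^\vee\setminus\bigcup_{i}\mathbb{R}_{\geq 0}\mathbf{b}_i$. For a $2$-dimensional cone $C$ put $L_C=\{\{i,j\}\subset\{1,\ldots,N\}\;|\;C\subset\mathbb{R}_{\geq 0}\mathbf{b}_i+\mathbb{R}_{\geq 0}\mathbf{b}_j\}$ and $\psi_C=\sum_{\{i,j\}\in L_C}|\det(\mathbf{b}_i,\mathbf{b}_j)|(\mathbf{e}_i+\mathbf{e}_j)$. The secondary polytope (polygon) is $\Sigma(\mathbb{L})=$ convex hull of $\{\psi_C\,|\,C$ a $2$-dimensional cone of the secondary fan$\}\subset\mathbb{R}^N$. Surfaces: let $\mathbb{L}_{\mathbb{R}}\subset\mathbb{R}^N$ be the real plane spanned by $\mathbb{L}$. For $\lambda\in\mathbb{R}^N$ the grid lines in $\lambda+\mathbb{L}_{\mathbb{R}}$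 are $\mathcal{L}^\lambda_{i,k}=\{z\in\lambda+\mathbb{L}_{\mathbb{R}}\,|\,z_i=k\}$ ($1\leq i\leq N$, $k\in\mathbb{Z}$); $\lambda$ is non-resonant if no three grid lines pass through one point. Let $F(z_1,\ldots,z_N)=(\lfloor z_1\rfloor,\ldots,\lfloor z_N\rfloor)$. For non-resonant $\lambda$ put $\mathcal{S}^0=F(\lambda+\mathbb{L}_{\mathbb{R}})$ and let $\mathcal{S}$ be the union of all unit squares in $\mathbb{R}^N$ with vertices in $\mathcal{S}^0$, i.e. the squares $\mathbf{p}+\mathrm{conv}(0,\mathbf{e}_i,\mathbf{e}_j,\mathbf{e}_i+\mathbf{e}_j)$, $i\neq j$, all of whose vertices lie in $\mathcal{S}^0$ (such a square has type $(i,j)$). The group $\mathbb{L}$ acts by translations on $\mathcal{S}^0$ and $\mathcal{S}$. An elementary transformation of $\mathcal{S}$: given $\mathbf{p}_0\in\mathcal{S}^0$ with exactly three points $\mathbf{p}_1,\mathbf{p}_2,\mathbf{p}_3\in\mathcal{S}^0$ at distance $1$ and such that $\mathbf{p}_1+\mathbf{p}_2-\mathbf{p}_0$, $\mathbf{p}_1+\mathbf{p}_3-\mathbf{p}_0$, $\mathbf{p}_2+\mathbf{p}_3-\mathbf{p}_0$ also lie in $\mathcal{S}^0$, replace, for all $\ell\in\mathbb{L}$ simultaneously, $\mathbf{p}_0+\ell$ by $\mathbf{p}_1+\mathbf{p}_2+\mathbf{p}_3-2\mathbf{p}_0+\ell$; this gives a new set $\mathcal{S}'^0$, and $\mathcal{S}'$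 is the union of all unit squares with vertices in $\mathcal{S}'^0$ (three squares around $\mathbf{p}_0+\ell$ are replaced by three squares around the new point). A surface $\mathcal{S}$ obtained from some non-resonant $\lambda$ by finitely many (possibly zero) elementary transformations is perfect if $\mathbf{s}(z)=z_1+\ldots+z_N$ takes only three values on $\mathcal{S}^0$; these are consecutive integers $a-1,a,a+1$. Vertices with $\mathbf{s}=a+1$ are black, those with $\mathbf{s}=a-1$ are white, those with $\mathbf{s}=a$ are grey. Each unit square of a perfect surface has one black, one white and two grey vertices. Tiles, graph, matrix: for a perfect $\mathcal{S}$, $E$ is the set of $\mathbb{L}$-orbits of unit squares in $\mathcal{S}$, $\mathsf{B}$ (resp. $\mathsf{W}$) is the set of $\mathbb{L}$-orbits of black (resp. white) vertices. For $e\in E$, $\mathbf{b}(e)\in\mathsf{B}$ and $\mathbf{w}(e)\in\mathsf{W}$ denote the orbits of its black and white vertex, and $\{\mathbf{r}(e),\mathbf{r}'(e)\}=\{i,j\}$ if the square has type $(i,j)$. The bipartite graph $\Gamma^{\bullet\circ}$ has node set $\mathsf{B}\sqcup\mathsf{W}$ and one edge for each $e\in E$, connecting $\mathbf{b}(e)$ and $\mathbf{w}(e)$. A perfect matching is a subset $P\subset E$ such that every node is incident to exactly one edge in $P$; put $\widehat{P}=\sum_{e\in P}(\mathbf{e}_{\mathbf{r}(e)}+\mathbf{e}_{\mathbf{r}'(e)})\in\mathbb{Z}^N$. For a $2$-dimensional cone $C$ of the secondary fan, $P_C=\{e\in E\,|\,\{\mathbf{r}(e),\mathbf{r}'(e)\}\in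 L_C\}$, which is a perfect matching. The bi-adjacency matrix $\mathbb{K}^{\varpi}$ has rows indexed by $\mathsf{B}$, columns indexed by $\mathsf{W}$ (these sets have equal cardinality) and $(\mathbf{b},\mathbf{w})$-entry $\sum_{e\in E:\,\mathbf{b}(e)=\mathbf{b},\,\mathbf{w}(e)=\mathbf{w}}\varpi(e)\,u_{\mathbf{r}(e)}u_{\mathbf{r}'(e)}\in\mathbb{C}[u_1,\ldots,u_N]$. Its determinant is defined up to sign, by choosing a bijection between $\mathsf{B}$ and $\mathsf{W}$. The Newton polytope of a Laurent polynomial in $u_1,\ldots,u_N$ is the convex hull in $\mathbb{R}^N$ of the exponent vectors of the monomials with non-zero coefficient. *)

theory Defs
  imports "HOL-Analysis.Analysis" "HOL-Library.Poly_Mapping"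
begin

section \<open>The lattice and its secondary polygon\<close>

abbreviation stdvec :: "'n::finite \<Rightarrow> int ^ 'n"
  where "stdvec i \<equiv> axis i 1"

definition realvec :: "int ^ 'n::finite \<Rightarrow> real ^ 'n"
  where "realvec p = (\<chi> i. real_of_int (p $ i))"

definition coord_sum :: "int ^ 'n::finite \<Rightarrow> int"
  where "coord_sum p = (\<Sum>i\<in>UNIV. p $ i)"

text \<open>The rows of \<open>B\<close> form a \<open>\<int>\<close>-basis of \<open>L\<close>; in particular \<open>L\<close> is a subgroup of rank 2.\<close>

definition lattice_basis :: "int ^ 'n::finite ^ 2 \<Rightarrow> (int ^ 'n) set \<Rightarrow> bool"
  where "lattice_basis B L \<longleftrightarrow>
    L = {x *s row 1 B + y *s row 2 B | x y. True} \<and>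
    (\<forall>x y. x *s row 1 B + y *s row 2 B = 0 \<longrightarrow> x = 0 \<and> y = 0)"

text \<open>The basis of \<open>L\<close> given by the rows of \<open>B\<close> identifies \<open>Hom(L, \<real>)\<close> with \<open>\<real>\<^sup>2\<close>.\<close>

definition bvec :: "int ^ 'n::finite ^ 2 \<Rightarrow> 'n \<Rightarrow> real ^ 2"
  where "bvec B i = realvec (column i B)"

definition ray :: "real ^ 2 \<Rightarrow> (real ^ 2) set"
  where "ray v = {t *\<^sub>R v | t. t \<ge> 0}"

definition sector :: "real ^ 2 \<Rightarrow> real ^ 2 \<Rightarrow> (real ^ 2) set"
  where "sector v w = {s *\<^sub>R v + t *\<^sub>R w | s t. s \<ge> 0 \<and> t \<ge> 0}"

definition max_cones :: "int ^ 'n::finite ^ 2 \<Rightarrow> (real ^ 2) set set"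
  where "max_cones B = closure ` components (UNIV - (\<Union>i. ray (bvec B i)))"

definition L_of_cone :: "int ^ 'n::finite ^ 2 \<Rightarrow> (real ^ 2) set \<Rightarrow> 'n set set"
  where "L_of_cone B C = {{i, j} | i j. i \<noteq> j \<and> C \<subseteq> sector (bvec B i) (bvec B j)}"

text \<open>The value \<open>\<bar>det(b\<^sub>i, b\<^sub>j)\<bar>\<close> does not depend on the order of \<open>i\<close> and \<open>j\<close>, so it is a function of
  the unordered pair \<open>{i, j}\<close>; see \<open>pair_absdet_doubleton\<close> below.\<close>

definition pair_absdet :: "int ^ 'n::finite ^ 2 \<Rightarrow> 'n set \<Rightarrow> real"
  where "pair_absdet B T =
    the_elem {\<bar>det (vector [bvec B i, bvec B j] :: real ^ 2 ^ 2)\<bar> | i j. T = {i, j}}"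

definition psi :: "int ^ 'n::finite ^ 2 \<Rightarrow> (real ^ 2) set \<Rightarrow> real ^ 'n"
  where "psi B C = (\<Sum>T\<in>L_of_cone B C. pair_absdet B T *\<^sub>R (\<Sum>i\<in>T. axis i 1))"

definition secondary_polygon :: "int ^ 'n::finite ^ 2 \<Rightarrow> (real ^ 'n) set"
  where "secondary_polygon B = convex hull (psi B ` max_cones B)"

lemma pair_absdet_doubleton:
  "pair_absdet B {i, j} = \<bar>det (vector [bvec B i, bvec B j] :: real ^ 2 ^ 2)\<bar>"
proof -
  have "{\<bar>det (vector [bvec B k, bvec B l] :: real ^ 2 ^ 2)\<bar> | k l. {i, j} = {k, l}}
      = {\<bar>det (vector [bvec B i, bvec B j] :: real ^ 2 ^ 2)\<bar>}"
    by (auto simp: doubleton_eq_iff det_2 vector_2 abs_minus_commute mult.commute)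
  then show ?thesis
    by (simp add: pair_absdet_def)
qed


section \<open>Surfaces\<close>

text \<open>A surface is represented by its set \<open>V\<close> of vertices, which determines it as the union of all
  unit squares with vertices in \<open>V\<close>.\<close>

definition affine_plane :: "(int ^ 'n::finite) set \<Rightarrow> real ^ 'n \<Rightarrow> (real ^ 'n) set"
  where "affine_plane L lam = (\<lambda>x. lam + x) ` span (realvec ` L)"

definition grid_line :: "(int ^ 'n::finite) set \<Rightarrow> real ^ 'n \<Rightarrow> 'n \<Rightarrow> int \<Rightarrow> (real ^ 'n) set"
  where "grid_line L lam i k = {z \<in> affine_plane L lam. z $ i = real_of_int k}"

text \<open>Grid lines are counted by their labels \<open>(i, k)\<close>, so that lines with different labels which
  coincide as sets are still different grid lines.\<close>

definition nonresonant :: "(int ^ 'n::finite) set \<Rightarrow> real ^ 'n \<Rightarrow> bool"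
  where "nonresonant L lam \<longleftrightarrow> (\<forall>z. card {(i, k). z \<in> grid_line L lam i k} < 3)"

definition floor_vec :: "real ^ 'n::finite \<Rightarrow> int ^ 'n"
  where "floor_vec z = (\<chi> i. \<lfloor>z $ i\<rfloor>)"

definition orbit :: "(int ^ 'n::finite) set \<Rightarrow> int ^ 'n \<Rightarrow> (int ^ 'n) set"
  where "orbit L p = {p + l | l. l \<in> L}"

definition elementary_transformation ::
    "(int ^ 'n::finite) set \<Rightarrow> (int ^ 'n) set \<Rightarrow> (int ^ 'n) set \<Rightarrow> bool"
  where "elementary_transformation L V V' \<longleftrightarrow>
    (\<exists>p0 p1 p2 p3. p0 \<in> V \<and> distinct [p1, p2, p3] \<and>
      {q \<in> V. dist (realvec q) (realvec p0) = 1} = {p1, p2, p3} \<and>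
      p1 + p2 - p0 \<in> V \<and> p1 + p3 - p0 \<in> V \<and> p2 + p3 - p0 \<in> V \<and>
      V' = (V - orbit L p0) \<union> orbit L (p1 + p2 + p3 - 2 *s p0))"

inductive is_surface :: "(int ^ 'n::finite) set \<Rightarrow> (int ^ 'n) set \<Rightarrow> bool"
  for L :: "(int ^ 'n) set"
  where
    initial: "nonresonant L lam \<Longrightarrow> is_surface L (floor_vec ` affine_plane L lam)"
  | transform: "is_surface L V \<Longrightarrow> elementary_transformation L V V' \<Longrightarrow> is_surface L V'"

text \<open>The number \<open>a\<close> is the height of the grey vertices, and is determined by \<open>V\<close>.\<close>

definition perfect_surface :: "(int ^ 'n::finite) set \<Rightarrow> (int ^ 'n) set \<Rightarrow> int \<Rightarrow> bool"
  where "perfect_surface L V a \<longleftrightarrow> is_surface L V \<and> coord_sum ` V = {a - 1, a, a + 1}"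


section \<open>Tiles and the bipartite graph\<close>

text \<open>The unit square \<open>p + conv(0, e\<^sub>i, e\<^sub>j, e\<^sub>i + e\<^sub>j)\<close> with \<open>i \<noteq> j\<close> is encoded as \<open>(p, {i, j})\<close>.\<close>

type_synonym 'n square = "(int ^ 'n) \<times> 'n set"

definition square_vertices :: "'n::finite square \<Rightarrow> (int ^ 'n) set"
  where "square_vertices q = {fst q + (\<Sum>i\<in>A. stdvec i) | A. A \<subseteq> snd q}"

definition squares :: "(int ^ 'n::finite) set \<Rightarrow> 'n square set"
  where "squares V = {(p, {i, j}) | p i j. i \<noteq> j \<and> square_vertices (p, {i, j}) \<subseteq> V}"

definition square_orbit :: "(int ^ 'n::finite) set \<Rightarrow> 'n square \<Rightarrow> 'n square set"
  where "square_orbit L q = {(fst q + l, snd q) | l. l \<in> L}"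

definition tiles :: "(int ^ 'n::finite) set \<Rightarrow> (int ^ 'n) set \<Rightarrow> 'n square set set"
  where "tiles L V = square_orbit L ` squares V"

definition black_nodes :: "(int ^ 'n::finite) set \<Rightarrow> (int ^ 'n) set \<Rightarrow> int \<Rightarrow> (int ^ 'n) set set"
  where "black_nodes L V a = orbit L ` {v \<in> V. coord_sum v = a + 1}"

definition white_nodes :: "(int ^ 'n::finite) set \<Rightarrow> (int ^ 'n) set \<Rightarrow> int \<Rightarrow> (int ^ 'n) set set"
  where "white_nodes L V a = orbit L ` {v \<in> V. coord_sum v = a - 1}"

text \<open>The black vertices of the squares in the orbit \<open>e\<close> form a single \<open>L\<close>-orbit, and likewise the
  white ones.\<close>

definition tile_black :: "int \<Rightarrow> 'n::finite square set \<Rightarrow> (int ^ 'n) set"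
  where "tile_black a e = {v. \<exists>q\<in>e. v \<in> square_vertices q \<and> coord_sum v = a + 1}"

definition tile_white :: "int \<Rightarrow> 'n::finite square set \<Rightarrow> (int ^ 'n) set"
  where "tile_white a e = {v. \<exists>q\<in>e. v \<in> square_vertices q \<and> coord_sum v = a - 1}"

definition tile_type :: "'n::finite square set \<Rightarrow> 'n set"
  where "tile_type e = the_elem (snd ` e)"

definition perfect_matching ::
    "(int ^ 'n::finite) set \<Rightarrow> (int ^ 'n) set \<Rightarrow> int \<Rightarrow> 'n square set set \<Rightarrow> bool"
  where "perfect_matching L V a P \<longleftrightarrow> P \<subseteq> tiles L V \<and>
    (\<forall>b\<in>black_nodes L V a. \<exists>!e. e \<in> P \<and> tile_black a e = b) \<and>
    (\<forall>w\<in>white_nodes L V a. \<exists>!e. e \<in> P \<and> tile_white a e = w)"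

definition matching_hat :: "'n::finite square set set \<Rightarrow> int ^ 'n"
  where "matching_hat P = (\<Sum>e\<in>P. \<Sum>i\<in>tile_type e. stdvec i)"

definition cone_matching ::
    "int ^ 'n::finite ^ 2 \<Rightarrow> (int ^ 'n) set \<Rightarrow> (int ^ 'n) set \<Rightarrow> (real ^ 2) set \<Rightarrow> 'n square set set"
  where "cone_matching B L V C = {e \<in> tiles L V. tile_type e \<in> L_of_cone B C}"


section \<open>The bi-adjacency matrix\<close>

text \<open>Polynomials over \<open>\<complex>\<close> in variables indexed by \<open>'n\<close>: finitely supported maps from exponent
  vectors to coefficients, with the convolution product.\<close>

type_synonym 'n cpoly = "('n \<Rightarrow>\<^sub>0 nat) \<Rightarrow>\<^sub>0 complex"

definition const_poly :: "complex \<Rightarrow> 'n cpoly"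
  where "const_poly c = Poly_Mapping.single 0 c"

definition var :: "'n \<Rightarrow> 'n cpoly"
  where "var i = Poly_Mapping.single (Poly_Mapping.single i 1) 1"

definition newton_polytope :: "'n::finite cpoly \<Rightarrow> (real ^ 'n) set"
  where "newton_polytope f =
    convex hull ((\<lambda>m. \<chi> i. real (Poly_Mapping.lookup m i)) ` Poly_Mapping.keys f)"

definition biadjacency ::
    "(int ^ 'n::finite) set \<Rightarrow> (int ^ 'n) set \<Rightarrow> int \<Rightarrow> ('n square set \<Rightarrow> complex) \<Rightarrow>
     (int ^ 'n) set \<Rightarrow> (int ^ 'n) set \<Rightarrow> 'n cpoly"
  where "biadjacency L V a wt b w =
    (\<Sum>e | e \<in> tiles L V \<and> tile_black a e = b \<and> tile_white a e = w.
       const_poly (wt e) * (\<Prod>i\<in>tile_type e. var i))"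

text \<open>Determinant of a matrix with rows indexed by \<open>R\<close>, whose columns are identified with the rows
  by a bijection \<open>\<beta>\<close> defined on \<open>R\<close>.\<close>

definition det_via :: "'a set \<Rightarrow> ('a \<Rightarrow> 'b) \<Rightarrow> ('a \<Rightarrow> 'b \<Rightarrow> 'r::comm_ring_1) \<Rightarrow> 'r"
  where "det_via R \<beta> K = (\<Sum>\<pi> | \<pi> permutes R. of_int (sign \<pi>) * (\<Prod>r\<in>R. K r (\<beta> (\<pi> r))))"

end

theory Submission
  imports Defs
begin

text \<open>
  The vertices of the surface of a non-resonant \<open>lam\<close> are the cells of an arrangement of lines in the
  plane, and an elementary transformation moves one line of a triangle across the opposite crossing, so
  a surface is a periodic arrangement of pseudolines. The arguments need only the properties collected in
  \<open>pseudoplane\<close>, which survive elementary transformations; the main one says that for any two vertices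
  \<open>p\<close>, \<open>q\<close> there is a direction \<open>u\<close> in the plane such that \<open>b\<^sub>i \<bullet> u\<close> has the sign of \<open>q\<^sub>i - p\<^sub>i\<close> whenever
  the latter is non-zero. Consequently the vectors \<open>b\<^sub>i\<close> of the edges at a black or white vertex are
  arranged around the origin like the normals of a convex polygon, so exactly one of the squares at
  the vertex belongs to the cone of a given generic \<open>v\<close>: the tiles of a cone are a perfect matching.

  For any two perfect matchings the exponent vectors differ by an element of the lattice, and a boundary
  direction \<open>i\<close> of a cone maximises the \<open>i\<close>-th coordinate, because the matching of the cone uses every
  white vertex with an edge in direction \<open>i\<close>. Hence all exponents lie in the secondary polygon,
  each \<open>\<psi>\<^sub>C\<close> is a vertex of it, and it remains to see that the matching of \<open>C\<close> is the only one with its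
  exponent, so that the coefficient in the determinant cannot vanish.
\<close>

section \<open>Plane geometry\<close>

text \<open>Most contradictions have one pattern: \<open>compatible\<close>, applied to two well
  chosen vertices, yields a direction \<open>u\<close> in which some plane vectors have prescribed
  strict signs, and the linear relation between these vectors (\<open>pluecker\<close>,
  \<open>cramer\<close>) forbids the signs. The vertices are taken at ends of edges or far corners
  of squares, because one step changes a coordinate of the difference by one and so makes a weak
  inequality strict. Several \<open>b\<^sub>i\<close> may share a line or a ray, so the indices have
  no cyclic order; directions are compared inside half-planes, by signs of \<open>cross2\<close>.
  The heights of a perfect surface leave only edges \<open>+e\<^sub>i\<close> at white and
  \<open>-e\<^sub>i\<close> at black vertices, so one generic \<open>v\<close> selects tiles at both
  colours. The weights \<open>|det(b\<^sub>i, b\<^sub>j)|\<close> count crossings: two transversal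
  grid lines cross exactly once, and the lattice permutes the crossings of a type with that many
  orbits. Finally, an element of the lattice is determined by two transversal coordinates, so the
  two boundary directions of a cone control the whole exponent.\<close>

definition cross2 :: "real ^ 2 \<Rightarrow> real ^ 2 \<Rightarrow> real"
  where "cross2 x y = x $ 1 * y $ 2 - x $ 2 * y $ 1"

lemma inner_2: "(x :: real ^ 2) \<bullet> y = x $ 1 * y $ 1 + x $ 2 * y $ 2"
  by (simp add: inner_vec_def sum_2)

lemma cross2_simps [simp]:
  "cross2 x x = 0" "cross2 0 y = 0" "cross2 x 0 = 0"
  "cross2 (- x) y = - cross2 x y" "cross2 x (- y) = - cross2 x y"
  "cross2 (c *\<^sub>R x) y = c * cross2 x y" "cross2 x (c *\<^sub>R y) = c * cross2 x y"
  by (auto simp: cross2_def algebra_simps)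

lemma cross2_add:
  "cross2 (x + y) z = cross2 x z + cross2 y z" "cross2 x (y + z) = cross2 x y + cross2 x z"
  by (auto simp: cross2_def algebra_simps)

lemma cross2_swap: "cross2 y x = - cross2 x y"
  by (simp add: cross2_def)

lemma cross2_sum_right: "cross2 x (\<Sum>i\<in>A. f i) = (\<Sum>i\<in>A. cross2 x (f i))"
  by (simp add: cross2_def sum_distrib_left sum_subtractf)

text \<open>Three vectors of the plane satisfy a linear relation whose coefficients are their
  pairwise determinants; here it is paired with \<open>u\<close>, in \<open>pluecker_cross\<close>
  with a determinant.\<close>

lemma pluecker: "cross2 y z * (x \<bullet> u) + cross2 z x * (y \<bullet> u) + cross2 x y * (z \<bullet> u) = 0"
  by (simp add: cross2_def inner_2 algebra_simps)

lemma pluecker_cross: "cross2 y z * cross2 x u + cross2 z x * cross2 y u + cross2 x y * cross2 z u = 0"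
  by (simp add: cross2_def algebra_simps)

lemma cramer: "cross2 x y *\<^sub>R v = cross2 v y *\<^sub>R x + cross2 x v *\<^sub>R y"
  by (simp add: vec_eq_iff forall_2 cross2_def algebra_simps)

text \<open>The quotient \<open>x \<bullet> v / cross2 v x\<close> is the cotangent of the angle
  from \<open>v\<close> to \<open>x\<close>. It decreases on the open half-plane to the left of
  \<open>v\<close> and so orders the directions there.\<close>

lemma slope_diff:
  assumes "cross2 v x > 0" "cross2 v y > 0"
  shows "x \<bullet> v / cross2 v x - y \<bullet> v / cross2 v y = (v \<bullet> v) * cross2 x y / (cross2 v x * cross2 v y)"
proof -
  have "(x \<bullet> v) * cross2 v y - (y \<bullet> v) * cross2 v x = (v \<bullet> v) * cross2 x y"
    by (simp add: cross2_def inner_2 algebra_simps)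
  then show ?thesis using assms by (simp add: field_simps)
qed

lemma slope_le_iff:
  assumes "cross2 v x > 0" "cross2 v y > 0"
  shows "x \<bullet> v / cross2 v x \<le> y \<bullet> v / cross2 v y \<longleftrightarrow> cross2 x y \<le> 0"
proof -
  have "v \<noteq> 0" using assms by auto
  then have v: "v \<bullet> v > 0" by simp
  have "x \<bullet> v / cross2 v x \<le> y \<bullet> v / cross2 v y \<longleftrightarrow>
      (v \<bullet> v) * cross2 x y / (cross2 v x * cross2 v y) \<le> 0"
    using slope_diff[OF assms] by linarith
  also have "\<dots> \<longleftrightarrow> cross2 x y \<le> 0"
    using v mult_pos_pos[OF assms] by (smt (verit) divide_le_0_iff mult_le_0_iff)
  finally show ?thesis .
qed

text \<open>Least cotangent means farthest counterclockwise from \<open>v\<close>;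
  \<open>first_vector\<close> takes the greatest instead.\<close>

lemma last_vector:
  assumes "finite S" "S \<noteq> {}" "\<And>i. i \<in> S \<Longrightarrow> cross2 v (f i) > 0"
  obtains i where "i \<in> S" "\<And>j. j \<in> S \<Longrightarrow> cross2 (f i) (f j) \<le> 0"
proof -
  define g where "g i = f i \<bullet> v / cross2 v (f i)" for i
  obtain i where i: "i \<in> S" "\<And>j. j \<in> S \<Longrightarrow> g i \<le> g j"
    using assms(1,2) by (metis arg_min_least arg_min_if_finite(1))
  show thesis
    by (rule that[OF i(1)]) (use i assms(3) slope_le_iff in \<open>auto simp: g_def\<close>)
qed

lemma first_vector:
  assumes "finite S" "S \<noteq> {}" "\<And>i. i \<in> S \<Longrightarrow> cross2 v (f i) > 0"
  obtains i where "i \<in> S" "\<And>j. j \<in> S \<Longrightarrow> cross2 (f i) (f j) \<ge> 0"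
proof -
  define g where "g i = f i \<bullet> v / cross2 v (f i)" for i
  obtain i where i: "i \<in> S" "\<And>j. j \<in> S \<Longrightarrow> - g i \<le> - g j"
    using arg_min_least[OF assms(1,2), of _ "\<lambda>i. - g i"] arg_min_if_finite(1)[OF assms(1,2), of "\<lambda>i. - g i"] by blast
  show thesis
  proof (rule that[OF i(1)])
    fix j assume j: "j \<in> S"
    then have "g j \<le> g i" using i by auto
    then have "cross2 (f j) (f i) \<le> 0"
      using slope_le_iff[OF assms(3)[OF j] assms(3)[OF i(1)]] by (simp add: g_def)
    then show "cross2 (f i) (f j) \<ge> 0" using cross2_swap[of "f i" "f j"] by linarith
  qed
qed

section \<open>Unit steps and sign-compatible differences\<close>

definition idot :: "int ^ 'n::finite \<Rightarrow> int ^ 'n \<Rightarrow> int"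
  where "idot x y = (\<Sum>i\<in>UNIV. x $ i * y $ i)"

text \<open>Edges are traversed both ways, so both signs count as directions. The condition
  \<open>idot x d > 0\<close>, over all units \<open>d\<close>, then records the signs of all
  coordinates of \<open>x\<close>.\<close>

definition units :: "(int ^ 'n::finite) set"
  where "units = range stdvec \<union> uminus ` range stdvec"

lemma idot_simps:
  "idot (x + y) z = idot x z + idot y z" "idot z (x + y) = idot z x + idot z y"
  "idot (x - y) z = idot x z - idot y z" "idot z (x - y) = idot z x - idot z y"
  "idot (- x) z = - idot x z" "idot z (- x) = - idot z x"
  "idot 0 z = 0"
  by (auto simp: idot_def algebra_simps sum.distrib sum_subtractf sum_negf)

lemma idot_stdvec [simp]: "idot x (stdvec i) = x $ i"
proof -
  have "idot x (stdvec i) = (\<Sum>j\<in>UNIV. if j = i then x $ j else 0)"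
    unfolding idot_def by (rule sum.cong) (auto simp: axis_def)
  then show ?thesis by simp
qed

lemma units_cases:
  assumes "d \<in> units"
  obtains i where "d = stdvec i" | i where "d = - stdvec i"
  using assms by (auto simp: units_def)

lemma stdvec_units [simp, intro]: "stdvec i \<in> units" "- stdvec i \<in> units"
  by (auto simp: units_def)

lemma units_minus [simp]: "- d \<in> units \<longleftrightarrow> d \<in> units"
proof -
  have "- d \<in> units" if "d \<in> units" for d :: "int ^ 'n"
    using that by (rule units_cases) auto
  from this[of d] this[of "- d"] show ?thesis by auto
qed

lemma finite_units [simp]: "finite units"
  by (simp add: units_def)

lemma stdvec_eq_iff [simp]: "stdvec i = stdvec j \<longleftrightarrow> i = j"
  by (auto simp: axis_eq_axis)

lemma stdvec_neq_minus [simp]: "stdvec i \<noteq> - stdvec j" "- stdvec j \<noteq> stdvec i"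
proof -
  have "(stdvec i) $ i \<noteq> (- stdvec j) $ i" by (auto simp: axis_def)
  then show "stdvec i \<noteq> - stdvec j" by metis
  then show "- stdvec j \<noteq> stdvec i" by metis
qed

lemma stdvec_nth: "(stdvec i) $ j = (if i = j then 1 else 0)"
  by (auto simp: axis_def)

lemma idot_units_self: "d \<in> units \<Longrightarrow> idot d d = 1"
  by (erule units_cases) (auto simp: idot_simps stdvec_nth)

lemma idot_units_other:
  assumes "d \<in> units" "e \<in> units" "e \<noteq> d" "e \<noteq> - d"
  shows "idot e d = 0"
  using assms(1) by (rule units_cases; insert assms(2); elim units_cases;
    insert assms(3,4); auto simp: idot_simps stdvec_nth)

lemma idot_units_le:
  assumes "d \<in> units" "e \<in> units" "e \<noteq> d"
  shows "idot e d \<le> 0"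
  using idot_units_other[of d e] idot_units_self[of d] assms by (cases "e = - d") (auto simp: idot_simps)

lemma idot_units_ge:
  assumes "d \<in> units" "e \<in> units" "e \<noteq> - d"
  shows "idot e d \<ge> 0"
  using idot_units_other[of d e] idot_units_self[of d] assms by (cases "e = d") (auto simp: idot_simps)

lemma exists_unit_idot_pos:
  assumes "x \<noteq> 0"
  obtains d where "d \<in> units" "idot x d > 0"
proof -
  obtain i where i: "x $ i \<noteq> 0" using assms by (auto simp: vec_eq_iff)
  show thesis
  proof (cases "x $ i > 0")
    case True
    then show thesis using that[of "stdvec i"] by simp
  next
    case False
    then show thesis using i that[of "- stdvec i"] by (simp add: idot_simps)
  qed
qed

lemma coord_sum_simps [simp]:
  "coord_sum (x + y) = coord_sum x + coord_sum y" "coord_sum (x - y) = coord_sum x - coord_sum y"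
  "coord_sum (- x) = - coord_sum x" "coord_sum (stdvec i) = 1" "coord_sum 0 = 0"
proof -
  have "(\<Sum>j\<in>UNIV. stdvec i $ j) = (\<Sum>j\<in>UNIV. if j = i then 1 else (0::int))"
    by (rule sum.cong) (auto simp: axis_def)
  then show "coord_sum (stdvec i) = 1" by (simp add: coord_sum_def)
qed (auto simp: coord_sum_def sum.distrib sum_subtractf sum_negf)

lemma units_coord_sum: "d \<in> units \<Longrightarrow> coord_sum d = 1 \<or> coord_sum d = -1"
  by (erule units_cases) auto

lemma realvec_simps:
  "realvec (x + y) = realvec x + realvec y" "realvec (x - y) = realvec x - realvec y"
  "realvec (- x) = - realvec x" "realvec 0 = 0"
  "realvec (c *s x) = of_int c *\<^sub>R realvec x"
  by (auto simp: realvec_def vec_eq_iff)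

lemma realvec_nth [simp]: "realvec x $ i = of_int (x $ i)"
  by (simp add: realvec_def)

lemma realvec_eq_iff [simp]: "realvec x = realvec y \<longleftrightarrow> x = y"
  by (auto simp: vec_eq_iff)

lemma dist_one_iff_units: "dist (realvec q) (realvec p) = 1 \<longleftrightarrow> q - p \<in> units"
proof -
  have norm: "(norm (realvec d))\<^sup>2 = of_int (idot d d)" for d :: "int ^ 'n"
    by (simp add: power2_norm_eq_inner inner_vec_def idot_def)
  have *: "idot d d = 1 \<longleftrightarrow> d \<in> units" for d :: "int ^ 'n"
  proof
    assume one: "idot d d = 1"
    then have "d \<noteq> 0" by (auto simp: idot_simps)
    then obtain i where i: "d $ i \<noteq> 0" by (auto simp: vec_eq_iff)
    have split: "idot d d = d $ i * d $ i + (\<Sum>j\<in>UNIV - {i}. d $ j * d $ j)"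
      unfolding idot_def by (rule sum.remove) auto
    have nn: "(\<Sum>j\<in>UNIV - {i}. d $ j * d $ j) \<ge> 0" by (rule sum_nonneg) auto
    have "d $ i * d $ i > 0" using i by (metis not_real_square_gt_zero zero_less_mult_iff linorder_cases)
    then have di: "d $ i * d $ i = 1" and "(\<Sum>j\<in>UNIV - {i}. d $ j * d $ j) = 0"
      using one split nn by linarith+
    then have "\<forall>j\<in>UNIV - {i}. d $ j * d $ j = 0"
      by (subst (asm) sum_nonneg_eq_0_iff) auto
    then have z: "d $ j = 0" if "j \<noteq> i" for j using that by auto
    have "d $ i = 1 \<or> d $ i = -1" using di by (metis zmult_eq_1_iff)
    then have "d = stdvec i \<or> d = - stdvec i"
      using z by (auto simp: vec_eq_iff stdvec_nth)
    then show "d \<in> units" by auto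
  qed (rule idot_units_self)
  have "dist (realvec q) (realvec p) = 1 \<longleftrightarrow> (norm (realvec (q - p)))\<^sup>2 = 1"
    by (auto simp: dist_norm realvec_simps power2_eq_1_iff) (smt (verit) norm_ge_zero)
  then show ?thesis using norm[of "q - p"] * by simp
qed

text \<open>The linear extension of \<open>e\<^sub>i \<mapsto> b\<^sub>i\<close>, so that a backward
  step \<open>- stdvec i\<close> is assigned \<open>- b\<^sub>i\<close>.\<close>

definition beta :: "int ^ 'n::finite ^ 2 \<Rightarrow> int ^ 'n \<Rightarrow> real ^ 2"
  where "beta B x = realvec (B *v x)"

lemma beta_simps [simp]:
  "beta B (x + y) = beta B x + beta B y" "beta B (x - y) = beta B x - beta B y"
  "beta B (- x) = - beta B x" "beta B 0 = 0"
  unfolding beta_def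
  by (simp_all add: matrix_vector_right_distrib matrix_vector_mult_diff_distrib realvec_simps)
     (metis matrix_vector_mult_diff_distrib realvec_simps diff_0 matrix_vector_mult_0_right)

lemma beta_stdvec [simp]: "beta B (stdvec i) = bvec B i"
  unfolding beta_def bvec_def
  by (simp add: vec_eq_iff matrix_vector_mult_def column_def axis_def if_distrib cong: if_cong)

text \<open>In an arrangement of straight lines \<open>u\<close> is the displacement between points
  of two cells. Vanishing coordinates impose nothing: inside a common strip the displacement may go
  either way.\<close>

definition compatible :: "int ^ 'n::finite ^ 2 \<Rightarrow> int ^ 'n \<Rightarrow> bool"
  where "compatible B x \<longleftrightarrow> (\<exists>u. \<forall>d\<in>units. idot x d > 0 \<longrightarrow> beta B d \<bullet> u > 0)"

lemma compatible_uminus: "compatible B x \<Longrightarrow> compatible B (- x)"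
  unfolding compatible_def
proof (elim exE)
  fix u assume u: "\<forall>d\<in>units. 0 < idot x d \<longrightarrow> 0 < beta B d \<bullet> u"
  show "\<exists>u. \<forall>d\<in>units. 0 < idot (- x) d \<longrightarrow> 0 < beta B d \<bullet> u"
  proof (intro exI[of _ "- u"] ballI impI)
    fix d :: "int ^ 'a" assume "d \<in> units" "0 < idot (- x) d"
    then show "0 < beta B d \<bullet> - u" using u[rule_format, of "- d"] by (simp add: idot_simps)
  qed
qed

section \<open>Pseudoplanes\<close>

text \<open>The clauses express, in order: periodicity; the sign condition for pairs of cells; a
  square to the left of every directed edge, so that corners can be followed around a vertex;
  absence of isolated vertices; and a crossing for every pair of labels of transversal directions.
  Uniqueness of the crossing is a consequence of the second clause, see
  \<open>crossing_unique\<close>.\<close>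

definition pseudoplane :: "int ^ 'n::finite ^ 2 \<Rightarrow> (int ^ 'n) set \<Rightarrow> (int ^ 'n) set \<Rightarrow> bool"
  where "pseudoplane B L V \<longleftrightarrow>
    (\<forall>p\<in>V. \<forall>l\<in>L. p + l \<in> V) \<and>
    (\<forall>p\<in>V. \<forall>q\<in>V. compatible B (q - p)) \<and>
    (\<forall>p\<in>V. \<forall>d\<in>units. p + d \<in> V \<longrightarrow>
      (\<exists>d'\<in>units. cross2 (beta B d) (beta B d') > 0 \<and> p + d' \<in> V \<and> p + d + d' \<in> V)) \<and>
    (\<forall>p\<in>V. \<exists>d\<in>units. p + d \<in> V) \<and>
    (\<forall>i j k l. cross2 (bvec B i) (bvec B j) \<noteq> 0 \<longrightarrow>
      (\<exists>p\<in>V. p $ i = k \<and> p $ j = l \<and>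
        p + stdvec i \<in> V \<and> p + stdvec j \<in> V \<and> p + stdvec i + stdvec j \<in> V))"

lemma solve_inner:
  assumes "cross2 a b \<noteq> 0"
  obtains u where "a \<bullet> u = x" "b \<bullet> u = y"
proof -
  define u :: "real ^ 2" where
    "u = vector [(x * b $ 2 - y * a $ 2) / cross2 a b, (y * a $ 1 - x * b $ 1) / cross2 a b]"
  have "cross2 a b * (a \<bullet> u) = cross2 a b * x" "cross2 a b * (b \<bullet> u) = cross2 a b * y"
    using assms by (simp_all add: u_def inner_2 vector_2 field_simps)
      (simp_all add: cross2_def algebra_simps)
  then show thesis using that assms by simp
qed

lemma bvec_nth: "bvec B i $ k = of_int (B $ k $ i)"
  by (simp add: bvec_def column_def)

locale lattice_plane =
  fixes L :: "(int ^ 'n::finite) set" and B :: "int ^ 'n ^ 2"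
  assumes basis: "lattice_basis B L"
    and not_in_hyperplane: "\<forall>i. \<exists>l\<in>L. l $ i \<noteq> 0"
    and coord_sum_L: "\<forall>l\<in>L. coord_sum l = 0"
begin

abbreviation bv :: "'n \<Rightarrow> real ^ 2" where "bv \<equiv> bvec B"

lemma L_iff: "l \<in> L \<longleftrightarrow> (\<exists>x y. \<forall>i. l $ i = x * B $ 1 $ i + y * B $ 2 $ i)"
  using basis by (auto simp: lattice_basis_def vec_eq_iff row_def)

lemma zero_in_L [simp]: "0 \<in> L"
  by (subst L_iff, rule exI[of _ 0], rule exI[of _ 0]) simp

lemma add_in_L: "l \<in> L \<Longrightarrow> l' \<in> L \<Longrightarrow> l + l' \<in> L"
proof -
  assume "l \<in> L" "l' \<in> L"
  then obtain x y x' y' where "\<forall>i. l $ i = x * B $ 1 $ i + y * B $ 2 $ i"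
    "\<forall>i. l' $ i = x' * B $ 1 $ i + y' * B $ 2 $ i" by (auto simp: L_iff)
  then have "\<forall>i. (l + l') $ i = (x + x') * B $ 1 $ i + (y + y') * B $ 2 $ i"
    by (simp add: algebra_simps)
  then show ?thesis unfolding L_iff by blast
qed

lemma minus_in_L [simp]: "- l \<in> L \<longleftrightarrow> l \<in> L"
proof -
  have *: "- l \<in> L" if l: "l \<in> L" for l
  proof -
    obtain x y where "\<forall>i. l $ i = x * B $ 1 $ i + y * B $ 2 $ i" using l unfolding L_iff by blast
    then have "\<forall>i. (- l) $ i = (- x) * B $ 1 $ i + (- y) * B $ 2 $ i" by simp
    then show ?thesis unfolding L_iff by blast
  qed
  show ?thesis using *[of l] *[of "- l"] by auto
qed

lemma diff_in_L: "l \<in> L \<Longrightarrow> l' \<in> L \<Longrightarrow> l - l' \<in> L"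
  using add_in_L[of l "- l'"] by simp

lemma coord_sum_L': "l \<in> L \<Longrightarrow> coord_sum l = 0"
  using coord_sum_L by blast

lemma row_in_L: "B $ k \<in> L"
proof (cases "k = 1")
  case True
  have "\<forall>i. B $ 1 $ i = 1 * B $ 1 $ i + 0 * B $ 2 $ i" by simp
  then show ?thesis unfolding L_iff True by blast
next
  case False
  then have k: "k = 2" using exhaust_2 by blast
  have "\<forall>i. B $ 2 $ i = 0 * B $ 1 $ i + 1 * B $ 2 $ i" by simp
  then show ?thesis unfolding L_iff k by blast
qed

lemma sum_bv: "(\<Sum>i\<in>UNIV. bv i) = 0"
proof -
  have "(\<Sum>i\<in>UNIV. bv i) $ k = of_int (coord_sum (B $ k))" for k
    by (simp add: bvec_nth coord_sum_def)
  then show ?thesis using coord_sum_L'[OF row_in_L] by (simp add: vec_eq_iff)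
qed

lemma bv_nonzero [simp]: "bv i \<noteq> 0"
proof
  assume "bv i = 0"
  then have "B $ k $ i = 0" for k using bvec_nth[of B i k] by simp
  then have "l $ i = 0" if "l \<in> L" for l using that by (auto simp: L_iff)
  then show False using not_in_hyperplane by blast
qed

lemma beta_units_nonzero: "d \<in> units \<Longrightarrow> beta B d \<noteq> 0"
  by (erule units_cases) auto

lemma exists_cross: "\<exists>j. cross2 (bv i) (bv j) \<noteq> 0"
proof (rule ccontr)
  assume "\<not> ?thesis"
  then have "cross2 (bv i) (bv j) = 0" for j by blast
  then have "real_of_int (B $ 2 $ i * B $ 1 $ j + (- B $ 1 $ i) * B $ 2 $ j) = 0" for j
    by (simp add: cross2_def bvec_nth algebra_simps)
  then have "B $ 2 $ i * B $ 1 $ j + (- B $ 1 $ i) * B $ 2 $ j = 0" for j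
    unfolding of_int_eq_0_iff by blast
  then have "B $ 2 $ i *s row 1 B + (- B $ 1 $ i) *s row 2 B = 0"
    by (simp add: vec_eq_iff row_def)
  then have "B $ 2 $ i = 0 \<and> - B $ 1 $ i = 0"
    using basis unfolding lattice_basis_def by blast
  then have "bv i = 0" by (simp add: vec_eq_iff forall_2 bvec_nth)
  then show False by simp
qed

text \<open>As the \<open>b\<^sub>i\<close> add up to zero, so do their determinants with
  \<open>v\<close>. If none is positive, all vanish and all \<open>b\<^sub>i\<close> are parallel,
  against \<open>exists_cross\<close>.\<close>

lemma exists_cross_pos:
  assumes "v \<noteq> 0"
  shows "\<exists>j. cross2 v (bv j) > 0"
proof (rule ccontr)
  assume neg: "\<not> ?thesis"
  have "(\<Sum>j\<in>UNIV. - cross2 v (bv j)) = 0"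
    using cross2_sum_right[of v bv UNIV] sum_bv by (simp add: sum_negf)
  then have z: "cross2 v (bv j) = 0" for j
    using neg by (subst (asm) sum_nonneg_eq_0_iff) (auto simp: not_less)
  obtain i :: 'n where True by blast
  obtain j where "cross2 (bv i) (bv j) \<noteq> 0" using exists_cross by blast
  then show False using assms cramer[of "bv i" "bv j" v] z[of i] z[of j] cross2_swap[of v "bv i"]
    by simp
qed

lemma exists_cross_neg:
  assumes "v \<noteq> 0"
  shows "\<exists>j. cross2 (bv j) v > 0"
  using exists_cross_pos[of "- v"] assms by (auto simp: cross2_swap[of v])

text \<open>The coordinates of a lattice element are \<open>b\<^sub>m \<bullet> (x, y)\<close> for
  one fixed \<open>(x, y)\<close>, which two transversal vectors determine.\<close>

lemma eq_zero_in_L: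
  assumes "l \<in> L" "cross2 (bv i) (bv j) \<noteq> 0" "l $ i = 0" "l $ j = 0"
  shows "l = 0"
proof -
  obtain x y where l: "\<forall>m. l $ m = x * B $ 1 $ m + y * B $ 2 $ m" using assms(1) unfolding L_iff by blast
  have m: "real_of_int (l $ m) = bv m \<bullet> vector [of_int x, of_int y]" for m
    using l by (simp add: inner_2 bvec_nth vector_2)
  have "real_of_int (l $ m) = 0" for m
    using pluecker[of "bv i" "bv j" "bv m" "vector [of_int x, of_int y]"] m[of i] m[of j] m[of m] assms
    by simp
  then show ?thesis by (simp add: vec_eq_iff)
qed

lemma mem_orbit_iff: "q \<in> orbit L p \<longleftrightarrow> q - p \<in> L"
  unfolding orbit_def by (auto intro: exI[of _ "q - p"])

section \<open>Initial surfaces\<close>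

text \<open>The rows of \<open>B\<close> span the plane and \<open>u\<close> holds the coordinates
  with respect to them. This identifies the plane with \<open>\<real>\<^sup>2\<close>, where the
  grid lines of direction \<open>i\<close> are orthogonal to \<open>b\<^sub>i\<close>.\<close>

lemma affine_plane_iff:
  "z \<in> affine_plane L lam \<longleftrightarrow> (\<exists>u. \<forall>i. z $ i = lam $ i + bv i \<bullet> u)"
proof -
  have sp: "span (realvec ` L) = range (\<lambda>u::real^2. \<chi> i. bv i \<bullet> u)" (is "_ = ?R")
  proof
    have "subspace ?R"
      unfolding subspace_def
    proof (intro conjI ballI allI)
      show "0 \<in> ?R" by (rule image_eqI[of _ _ 0]) (auto simp: vec_eq_iff)
    next
      fix x y assume "x \<in> ?R" "y \<in> ?R"
      then obtain u v where "x = (\<chi> i. bv i \<bullet> u)" "y = (\<chi> i. bv i \<bullet> v)" by auto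
      then show "x + y \<in> ?R" by (intro image_eqI[of _ _ "u + v"]) (auto simp: vec_eq_iff inner_add_right)
    next
      fix x c assume "x \<in> ?R"
      then obtain u where "x = (\<chi> i. bv i \<bullet> u)" by auto
      then show "c *\<^sub>R x \<in> ?R" by (intro image_eqI[of _ _ "c *\<^sub>R u"]) (auto simp: vec_eq_iff)
    qed
    moreover have "realvec ` L \<subseteq> ?R"
    proof
      fix z assume "z \<in> realvec ` L"
      then obtain l where "z = realvec l" "l \<in> L" by blast
      moreover from this(2) obtain x y where "\<forall>m. l $ m = x * B $ 1 $ m + y * B $ 2 $ m"
        unfolding L_iff by blast
      ultimately have "z = (\<chi> i. bv i \<bullet> vector [of_int x, of_int y])"
        by (simp add: vec_eq_iff inner_2 bvec_nth vector_2)
      then show "z \<in> ?R" by blast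
    qed
    ultimately show "span (realvec ` L) \<subseteq> ?R" by (simp add: span_minimal)
  next
    show "?R \<subseteq> span (realvec ` L)"
    proof
      fix z assume "z \<in> ?R"
      then obtain u where "z = (\<chi> i. bv i \<bullet> u)" by auto
      then have "z = u $ 1 *\<^sub>R realvec (B $ 1) + u $ 2 *\<^sub>R realvec (B $ 2)"
        by (simp add: vec_eq_iff inner_2 bvec_nth)
      then show "z \<in> span (realvec ` L)"
        by (simp add: span_add span_scale span_base row_in_L)
    qed
  qed
  show ?thesis
    unfolding affine_plane_def sp by (auto simp: vec_eq_iff image_iff)
qed

definition pt :: "real ^ 'n \<Rightarrow> real ^ 2 \<Rightarrow> real ^ 'n"
  where "pt lam u = (\<chi> i. lam $ i + bv i \<bullet> u)"

lemma pt_nth [simp]: "pt lam u $ i = lam $ i + bv i \<bullet> u"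
  by (simp add: pt_def)

lemma affine_plane_eq: "affine_plane L lam = range (pt lam)"
  by (auto simp: affine_plane_iff vec_eq_iff image_iff)

lemma nonresonant_card:
  assumes "nonresonant L lam"
  shows "card {i. pt lam u $ i \<in> \<int>} \<le> 2"
proof -
  have "{(i, k). pt lam u \<in> grid_line L lam i k} = (\<lambda>i. (i, \<lfloor>pt lam u $ i\<rfloor>)) ` {i. pt lam u $ i \<in> \<int>}"
    by (auto simp: grid_line_def affine_plane_eq image_iff elim!: Ints_cases)
  then have "card {(i, k). pt lam u \<in> grid_line L lam i k} = card {i. pt lam u $ i \<in> \<int>}"
    by (simp add: card_image inj_on_def)
  then show ?thesis using assms unfolding nonresonant_def by (metis less_Suc_eq_le numeral_2_eq_2 numeral_3_eq_3)
qed

text \<open>Parallel grid lines through a common point coincide. Sliding along them by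
  \<open>w\<close> reaches a point where a transversal coordinate \<open>m\<close> is an integer
  too, so three labels meet there.\<close>

lemma nonresonant_crossing:
  assumes "nonresonant L lam" "pt lam u $ i \<in> \<int>" "pt lam u $ j \<in> \<int>" "i \<noteq> j"
  shows "cross2 (bv i) (bv j) \<noteq> 0"
proof
  assume par: "cross2 (bv i) (bv j) = 0"
  obtain m where m: "cross2 (bv i) (bv m) \<noteq> 0" using exists_cross by blast
  then obtain w where w: "bv i \<bullet> w = 0" "bv m \<bullet> w = - pt lam u $ m" using solve_inner by blast
  have "bv j \<bullet> w = 0"
    using pluecker[of "bv i" "bv j" "bv m" w] par w m cross2_swap[of "bv m" "bv i"] by simp
  then have "{i, j, m} \<subseteq> {i. pt lam (u + w) $ i \<in> \<int>}"
    using assms w by (auto simp: inner_add_right algebra_simps)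
  then have "card {i, j, m} \<le> card {i. pt lam (u + w) $ i \<in> \<int>}"
    by (intro card_mono) auto
  moreover have "m \<noteq> i" "m \<noteq> j" using par m by auto
  then have "card {i, j, m} = 3" using \<open>i \<noteq> j\<close> by simp
  ultimately show False using nonresonant_card[OF assms(1), of "u + w"] by linarith
qed

text \<open>The cells of \<open>floor_vec\<close> are half open, but by non-resonance at most two
  coordinates lie on walls, and these walls are transversal, so a small step \<open>w\<close> moves
  off both into the cell. Points shared by several closed cells can therefore be used to exhibit
  several vertices at once.\<close>

lemma closed_cell_in_surface:
  assumes nr: "nonresonant L lam"
    and cell: "\<And>m. of_int (p $ m) \<le> pt lam u $ m \<and> pt lam u $ m \<le> of_int (p $ m) + 1"
  shows "p \<in> floor_vec ` affine_plane L lam"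
proof -
  let ?X = "pt lam u"
  define H where "H = {i. ?X $ i \<in> \<int>}"
  \<comment> \<open>The inward sense at a wall: up from the lower one, down from the upper
    one.\<close>
  define s :: "'n \<Rightarrow> real" where "s i = (if ?X $ i = of_int (p $ i) then 1 else -1)" for i
  obtain i j where ij: "H \<subseteq> {i, j}" "cross2 (bv i) (bv j) \<noteq> 0"
  proof (cases "\<exists>i j. i \<in> H \<and> j \<in> H \<and> i \<noteq> j")
    case True
    then obtain i j where "i \<in> H" "j \<in> H" "i \<noteq> j" by blast
    then have "card {i, j} = 2" "{i, j} \<subseteq> H" by auto
    then have "H = {i, j}" using nonresonant_card[OF nr, of u]
      by (metis H_def card_seteq finite_class.finite_code)
    moreover have "cross2 (bv i) (bv j) \<noteq> 0"
      using nonresonant_crossing[OF nr] \<open>i \<in> H\<close> \<open>j \<in> H\<close> \<open>i \<noteq> j\<close> by (auto simp: H_def)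
    ultimately show thesis using that by blast
  next
    case False
    then obtain i where "H \<subseteq> {i}" by (cases "H = {}") auto
    then show thesis using that exists_cross[of i] by blast
  qed
  obtain w where "bv i \<bullet> w = s i" "bv j \<bullet> w = s j" using solve_inner[OF ij(2)] by blast
  then have w: "bv m \<bullet> w = s m" if "m \<in> H" for m using that ij by auto
  have ev: "\<forall>\<^sub>F e in at_right 0. \<lfloor>pt lam (u + e *\<^sub>R w) $ m\<rfloor> = p $ m" for m
  proof -
    have lim: "((\<lambda>e. ?X $ m + e * (bv m \<bullet> w)) \<longlongrightarrow> ?X $ m) (at_right 0)"
      by (auto intro!: tendsto_eq_intros)
    have pos: "\<forall>\<^sub>F e::real in at_right 0. e > 0" by (simp add: eventually_at_right_less)
    have "\<forall>\<^sub>F e in at_right 0. of_int (p $ m) \<le> ?X $ m + e * (bv m \<bullet> w) \<and> ?X $ m + e * (bv m \<bullet> w) < of_int (p $ m) + 1"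
    proof (cases "?X $ m = of_int (p $ m)")
      case True
      then have "bv m \<bullet> w = 1" using w[of m] by (auto simp: H_def s_def)
      moreover have "\<forall>\<^sub>F e in at_right 0. ?X $ m + e * (bv m \<bullet> w) < of_int (p $ m) + 1"
        using lim by (rule order_tendstoD) (use True in auto)
      ultimately have "bv m \<bullet> w = 1" "\<forall>\<^sub>F e in at_right 0. ?X $ m + e * (bv m \<bullet> w) < of_int (p $ m) + 1" by auto
      from this(2) pos show ?thesis by eventually_elim (use True \<open>bv m \<bullet> w = 1\<close> in auto)
    next
      case neq: False
      then have low: "\<forall>\<^sub>F e in at_right 0. of_int (p $ m) < ?X $ m + e * (bv m \<bullet> w)"
        using cell[of m] by (intro order_tendstoD(1)[OF lim]) auto
      show ?thesis
      proof (cases "?X $ m = of_int (p $ m) + 1")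
        case True
        then have "?X $ m = of_int (p $ m + 1)" by simp
        then have "?X $ m \<in> \<int>" using Ints_of_int by metis
        then have bw: "bv m \<bullet> w = -1" using w[of m] neq by (simp add: H_def s_def)
        show ?thesis using low pos by eventually_elim (use True bw in auto)
      next
        case False
        then have "\<forall>\<^sub>F e in at_right 0. ?X $ m + e * (bv m \<bullet> w) < of_int (p $ m) + 1"
          using cell[of m] by (intro order_tendstoD(2)[OF lim]) auto
        then show ?thesis using low by eventually_elim auto
      qed
    qed
    then show ?thesis
      by eventually_elim (simp add: inner_add_right floor_eq_iff algebra_simps)
  qed
  have "\<forall>\<^sub>F e in at_right 0. \<forall>m. \<lfloor>pt lam (u + e *\<^sub>R w) $ m\<rfloor> = p $ m"
    using ev by (simp add: eventually_all_finite)
  then obtain e where "\<forall>m. \<lfloor>pt lam (u + e *\<^sub>R w) $ m\<rfloor> = p $ m"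
    using eventually_happens'[OF trivial_limit_at_right_real] by blast
  then have "p = floor_vec (pt lam (u + e *\<^sub>R w))" by (simp add: floor_vec_def vec_eq_iff)
  then show ?thesis by (auto simp: affine_plane_eq)
qed

text \<open>Walking from \<open>u\<close> along \<open>w\<close>, the wall of direction
  \<open>m\<close> is met at time \<open>T m\<close>; the index \<open>j\<close> is that of the
  first wall met.\<close>

lemma cell_exit:
  assumes cell: "\<And>m. of_int (p $ m) \<le> pt lam u $ m \<and> pt lam u $ m \<le> of_int (p $ m) + 1"
    and "bv j0 \<bullet> w \<noteq> 0"
  obtains t j where "t \<ge> 0"
    "\<And>m. of_int (p $ m) \<le> pt lam (u + t *\<^sub>R w) $ m \<and> pt lam (u + t *\<^sub>R w) $ m \<le> of_int (p $ m) + 1"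
    "bv j \<bullet> w \<noteq> 0"
    "bv j \<bullet> w > 0 \<Longrightarrow> pt lam (u + t *\<^sub>R w) $ j = of_int (p $ j) + 1"
    "bv j \<bullet> w < 0 \<Longrightarrow> pt lam (u + t *\<^sub>R w) $ j = of_int (p $ j)"
proof -
  define T where "T m = ((if bv m \<bullet> w > 0 then of_int (p $ m) + 1 else of_int (p $ m)) - pt lam u $ m) / (bv m \<bullet> w)" for m
  define J where "J = {m. bv m \<bullet> w \<noteq> 0}"
  obtain j where j: "j \<in> J" "\<And>m. m \<in> J \<Longrightarrow> T j \<le> T m"
  proof -
    have J: "finite J" "J \<noteq> {}" using assms(2) by (auto simp: J_def)
    show thesis using that arg_min_if_finite(1)[OF J, of T] arg_min_least[OF J, of _ T] by blast
  qed
  have T0: "T m \<ge> 0" if "m \<in> J" for m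
    using cell[of m] that by (auto simp: T_def J_def zero_le_divide_iff not_less)
  show thesis
  proof (rule that[of "T j" j])
    show "T j \<ge> 0" using T0 j by blast
    show "bv j \<bullet> w \<noteq> 0" using j by (simp add: J_def)
    then show "bv j \<bullet> w > 0 \<Longrightarrow> pt lam (u + T j *\<^sub>R w) $ j = of_int (p $ j) + 1"
      "bv j \<bullet> w < 0 \<Longrightarrow> pt lam (u + T j *\<^sub>R w) $ j = of_int (p $ j)"
      by (auto simp: T_def inner_add_right)
    fix m
    have eq: "pt lam (u + T j *\<^sub>R w) $ m = pt lam u $ m + T j * (bv m \<bullet> w)"
      by (simp add: inner_add_right)
    consider "bv m \<bullet> w = 0" | "bv m \<bullet> w > 0" | "bv m \<bullet> w < 0" by linarith
    then show "of_int (p $ m) \<le> pt lam (u + T j *\<^sub>R w) $ m \<and> pt lam (u + T j *\<^sub>R w) $ m \<le> of_int (p $ m) + 1"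
    proof cases
      case 1 then show ?thesis using eq cell[of m] by simp
    next
      case 2
      then have "T j \<le> T m" using j by (simp add: J_def)
      then have "T j * (bv m \<bullet> w) \<le> of_int (p $ m) + 1 - pt lam u $ m"
        using 2 by (simp add: T_def pos_le_divide_eq)
      moreover have "0 \<le> T j * (bv m \<bullet> w)" using T0[OF j(1)] 2 by simp
      ultimately show ?thesis using eq cell[of m] by linarith
    next
      case 3
      then have "T j \<le> T m" using j by (simp add: J_def)
      then have "T j * (bv m \<bullet> w) \<ge> of_int (p $ m) - pt lam u $ m"
        using 3 by (simp add: T_def neg_le_divide_eq)
      moreover have "T j * (bv m \<bullet> w) \<le> 0" using T0[OF j(1)] 3 by (simp add: mult_nonneg_nonpos)
      ultimately show ?thesis using eq cell[of m] by linarith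
    qed
  qed
qed

end

definition rot90 :: "real ^ 2 \<Rightarrow> real ^ 2"
  where "rot90 x = vector [- x $ 2, x $ 1]"

lemma inner_rot90: "y \<bullet> rot90 x = cross2 x y"
  by (simp add: rot90_def inner_2 vector_2 cross2_def algebra_simps)

context lattice_plane
begin

lemma floor_vec_cell:
  assumes "p = floor_vec (pt lam u)"
  shows "of_int (p $ m) \<le> pt lam u $ m \<and> pt lam u $ m < of_int (p $ m) + 1"
  using assms by (simp add: floor_vec_def)

lemma initial_pseudoplane:
  assumes nr: "nonresonant L lam"
  shows "pseudoplane B L (floor_vec ` affine_plane L lam)" (is "pseudoplane B L ?V")
  unfolding pseudoplane_def
proof (intro conjI ballI impI allI)
  note closed = closed_cell_in_surface[OF nr]
  have obt: "\<exists>u. p = floor_vec (pt lam u)" if "p \<in> ?V" for p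
    using that by (auto simp: affine_plane_eq)
  {
    fix p l assume "p \<in> ?V" "l \<in> L"
    then obtain u where u: "p = floor_vec (pt lam u)" using obt by blast
    obtain x y where "\<forall>m. l $ m = x * B $ 1 $ m + y * B $ 2 $ m" using \<open>l \<in> L\<close> unfolding L_iff by blast
    then have "bv m \<bullet> vector [of_int x, of_int y] = of_int (l $ m)" for m
      by (simp add: inner_2 bvec_nth vector_2)
    then have "p + l = floor_vec (pt lam (u + vector [of_int x, of_int y]))"
      by (simp add: u floor_vec_def vec_eq_iff inner_add_right flip: add.assoc)
    then show "p + l \<in> ?V" by (auto simp: affine_plane_eq)
  next
    fix p q assume "p \<in> ?V" "q \<in> ?V"
    then obtain u u' where u: "p = floor_vec (pt lam u)" "q = floor_vec (pt lam u')" using obt by metis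
    note up = floor_vec_cell[OF u(1)] and uq = floor_vec_cell[OF u(2)]
    show "compatible B (q - p)"
      unfolding compatible_def
    proof (intro exI[of _ "u' - u"] ballI impI)
      fix d :: "int ^ 'n" assume "d \<in> units" and pos: "idot (q - p) d > 0"
      then show "beta B d \<bullet> (u' - u) > 0"
      proof (cases rule: units_cases)
        case (1 i)
        then have "p $ i + 1 \<le> q $ i" using pos by simp
        then have "real_of_int (p $ i) + 1 \<le> of_int (q $ i)" by linarith
        then have "bv i \<bullet> u < bv i \<bullet> u'"
          using up[of i] uq[of i] by simp
        then show ?thesis by (simp add: 1 inner_diff_right)
      next
        case (2 i)
        then have "q $ i + 1 \<le> p $ i" using pos by (simp add: idot_simps)
        then have "real_of_int (q $ i) + 1 \<le> of_int (p $ i)" by linarith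
        then have "bv i \<bullet> u' < bv i \<bullet> u"
          using up[of i] uq[of i] by simp
        then show ?thesis by (simp add: 2 inner_diff_right)
      qed
    qed
  next
    fix p d :: "int ^ 'n" assume "p \<in> ?V" and d: "d \<in> units" and "p + d \<in> ?V"
    obtain q i where q: "q \<in> ?V" "q + stdvec i \<in> ?V" and d_eq: "p = q \<and> d = stdvec i \<or> p = q + stdvec i \<and> d = - stdvec i"
      using d
    proof (cases rule: units_cases)
      case (1 i) then show thesis using that \<open>p \<in> ?V\<close> \<open>p + d \<in> ?V\<close> by blast
    next
      case (2 i) then show thesis using that[of "p + d" i] \<open>p \<in> ?V\<close> \<open>p + d \<in> ?V\<close> by simp
    qed
    obtain u u' where u: "q = floor_vec (pt lam u)" "q + stdvec i = floor_vec (pt lam u')"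
      using obt q by metis
    note uq = floor_vec_cell[OF u(1)] and uq' = floor_vec_cell[OF u(2)]
    let ?x = "pt lam u $ i" and ?x' = "pt lam u' $ i"
    \<comment> \<open>The segment from \<open>u\<close> to \<open>u'\<close> is cut at the wall
      between the cells \<open>q\<close> and \<open>q + stdvec i\<close>; by convexity the cut point
      lies in both closed cells.\<close>
    define t where "t = (of_int (q $ i) + 1 - ?x) / (?x' - ?x)"
    have x: "?x < of_int (q $ i) + 1" "of_int (q $ i) + 1 \<le> ?x'"
      using uq[of i] uq'[of i] by (simp_all add: stdvec_nth)
    then have t: "0 \<le> t" "t \<le> 1" "t * (?x' - ?x) = of_int (q $ i) + 1 - ?x"
      by (auto simp: t_def divide_le_eq_1)
    define u1 where "u1 = (1 - t) *\<^sub>R u + t *\<^sub>R u'"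
    have u1: "pt lam u1 $ m = (1 - t) * pt lam u $ m + t * pt lam u' $ m" for m
      by (simp add: u1_def inner_add_right algebra_simps)
    have u1i: "pt lam u1 $ i = of_int (q $ i) + 1"
      unfolding u1 using t(3) by (simp add: algebra_simps)
    have c1: "of_int (q $ m) \<le> pt lam u1 $ m \<and> pt lam u1 $ m \<le> of_int (q $ m) + 1" for m
    proof (cases "m = i")
      case False
      have b: "of_int (q $ m) \<le> pt lam u' $ m \<and> pt lam u' $ m < of_int (q $ m) + 1"
        using uq'[of m] False by (simp add: stdvec_nth)
      have "(1 - t) * of_int (q $ m) + t * of_int (q $ m) \<le> pt lam u1 $ m"
        unfolding u1 using uq[of m] b t by (intro add_mono mult_left_mono) auto
      moreover have "pt lam u1 $ m \<le> (1 - t) * (of_int (q $ m) + 1) + t * (of_int (q $ m) + 1)"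
        unfolding u1 using uq[of m] b t by (intro add_mono mult_left_mono) auto
      ultimately show ?thesis by (simp add: algebra_simps)
    qed (simp only: u1i, simp)
    \<comment> \<open>Parallel to the wall and pointing to the left of \<open>beta B d\<close>. The
      first further wall met on this way gives a point common to four closed cells.\<close>
    let ?w = "rot90 (beta B d)"
    have bw: "bv m \<bullet> ?w = cross2 (beta B d) (bv m)" for m by (simp add: inner_rot90)
    have "\<exists>j0. bv j0 \<bullet> ?w \<noteq> 0"
      unfolding bw using exists_cross_pos[OF beta_units_nonzero[OF d]] by (metis less_irrefl)
    then obtain t j where ex:
      "\<And>m. of_int (q $ m) \<le> pt lam (u1 + t *\<^sub>R ?w) $ m \<and> pt lam (u1 + t *\<^sub>R ?w) $ m \<le> of_int (q $ m) + 1"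
      "bv j \<bullet> ?w \<noteq> 0"
      "bv j \<bullet> ?w > 0 \<Longrightarrow> pt lam (u1 + t *\<^sub>R ?w) $ j = of_int (q $ j) + 1"
      "bv j \<bullet> ?w < 0 \<Longrightarrow> pt lam (u1 + t *\<^sub>R ?w) $ j = of_int (q $ j)"
      using cell_exit[OF c1] by metis
    let ?u = "u1 + t *\<^sub>R ?w"
    have bi: "bv i \<bullet> ?w = 0" unfolding bw using d_eq by auto
    then have ji: "j \<noteq> i" using ex(2) by auto
    have exi: "pt lam ?u $ i = of_int (q $ i) + 1"
      using u1i bi by (simp add: inner_add_right)
    define d' where "d' = (if bv j \<bullet> ?w > 0 then stdvec j else - stdvec j)"
    have d': "d' \<in> units" by (simp add: d'_def)
    have "cross2 (beta B d) (beta B d') > 0" using ex(2) by (auto simp: d'_def bw)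
    moreover have "q + d' \<in> ?V" "q + stdvec i + d' \<in> ?V"
      using ex exi ji by (auto intro!: closed[of _ ?u] simp del: pt_nth simp: d'_def stdvec_nth)
    then have "p + d' \<in> ?V" "p + d + d' \<in> ?V"
      using d_eq by (auto simp: algebra_simps)
    ultimately show "\<exists>d'\<in>units. 0 < cross2 (beta B d) (beta B d') \<and> p + d' \<in> ?V \<and> p + d + d' \<in> ?V"
      using d' by blast
  next
    fix p assume "p \<in> ?V"
    then obtain u where u: "p = floor_vec (pt lam u)" using obt by blast
    have c: "of_int (p $ m) \<le> pt lam u $ m \<and> pt lam u $ m \<le> of_int (p $ m) + 1" for m
      using floor_vec_cell[OF u, of m] by linarith
    obtain i :: 'n where True by blast
    have "bv i \<bullet> bv i \<noteq> 0" by simp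
    then obtain t j where ex:
      "\<And>m. of_int (p $ m) \<le> pt lam (u + t *\<^sub>R bv i) $ m \<and> pt lam (u + t *\<^sub>R bv i) $ m \<le> of_int (p $ m) + 1"
      "bv j \<bullet> bv i \<noteq> 0"
      "bv j \<bullet> bv i > 0 \<Longrightarrow> pt lam (u + t *\<^sub>R bv i) $ j = of_int (p $ j) + 1"
      "bv j \<bullet> bv i < 0 \<Longrightarrow> pt lam (u + t *\<^sub>R bv i) $ j = of_int (p $ j)"
      using cell_exit[OF c] by metis
    have "p + (if bv j \<bullet> bv i > 0 then stdvec j else - stdvec j) \<in> ?V"
      using ex by (auto intro!: closed[of _ "u + t *\<^sub>R bv i"] simp del: pt_nth simp: stdvec_nth)
    then show "\<exists>d\<in>units. p + d \<in> ?V" by (rule bexI) auto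
  next
    fix i j k l assume "cross2 (bv i) (bv j) \<noteq> 0"
    \<comment> \<open>The lines at \<open>k + 1\<close> and \<open>l + 1\<close> meet in the upper
      corner of the cell with coordinates \<open>k\<close> and \<open>l\<close>, hence the shift by
      one.\<close>
    then obtain u where u: "bv i \<bullet> u = of_int k + 1 - lam $ i" "bv j \<bullet> u = of_int l + 1 - lam $ j"
      using solve_inner by blast
    have ij: "i \<noteq> j" using \<open>cross2 (bv i) (bv j) \<noteq> 0\<close> by auto
    define p :: "int ^ 'n" where "p = (\<chi> m. if m = i then k else if m = j then l else \<lfloor>pt lam u $ m\<rfloor>)"
    have p: "p $ i = k" "p $ j = l" "\<And>m. m \<noteq> i \<Longrightarrow> m \<noteq> j \<Longrightarrow> p $ m = \<lfloor>pt lam u $ m\<rfloor>"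
      using ij by (auto simp: p_def)
    have X: "pt lam u $ i = of_int k + 1" "pt lam u $ j = of_int l + 1" using u by simp_all
    have cl: "of_int (p $ m + e) \<le> pt lam u $ m \<and> pt lam u $ m \<le> of_int (p $ m + e) + 1"
      if "m = i \<or> m = j \<or> e = 0" "e = 0 \<or> e = 1" for m e
    proof -
      consider "m = i" | "m = j" | "m \<noteq> i" "m \<noteq> j" by blast
      then show ?thesis
      proof cases
        case 1
        then show ?thesis using X(1) p(1) that(2) by (auto simp del: pt_nth)
      next
        case 2
        then show ?thesis using X(2) p(2) that(2) by (auto simp del: pt_nth)
      next
        case 3
        then show ?thesis using p(3)[of m] that(1) by (simp del: pt_nth)
      qed
    qed
    have "p + x \<in> ?V" if "x \<in> {0, stdvec i, stdvec j, stdvec i + stdvec j}" for x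
    proof (rule closed[of _ u])
      fix m
      show "of_int ((p + x) $ m) \<le> pt lam u $ m \<and> pt lam u $ m \<le> of_int ((p + x) $ m) + 1"
        using cl[of m "x $ m"] that ij by (auto simp del: pt_nth simp: stdvec_nth)
    qed
    from this[of 0] this[of "stdvec i"] this[of "stdvec j"] this[of "stdvec i + stdvec j"]
    show "\<exists>p\<in>?V. p $ i = k \<and> p $ j = l \<and>
        p + stdvec i \<in> ?V \<and> p + stdvec j \<in> ?V \<and> p + stdvec i + stdvec j \<in> ?V"
      using p(1,2) by (intro bexI[of _ p]) (auto simp: add.assoc)
  }
qed

end

section \<open>Elementary transformations\<close>

locale pseudo_surface = lattice_plane L B for L :: "(int ^ 'n::finite) set" and B :: "int ^ 'n ^ 2" +
  fixes V :: "(int ^ 'n) set"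
  assumes pseudoplane: "pseudoplane B L V"
begin

lemma translate: "p \<in> V \<Longrightarrow> l \<in> L \<Longrightarrow> p + l \<in> V"
  using pseudoplane by (simp add: pseudoplane_def)

lemma translate_iff: "l \<in> L \<Longrightarrow> p + l \<in> V \<longleftrightarrow> p \<in> V"
  using translate[of p l] translate[of "p + l" "- l"] by auto

lemma direction:
  assumes "p \<in> V" "q \<in> V"
  obtains u where "\<And>d. d \<in> units \<Longrightarrow> idot (q - p) d > 0 \<Longrightarrow> beta B d \<bullet> u > 0"
proof -
  have "compatible B (q - p)" using pseudoplane assms unfolding pseudoplane_def by blast
  then show thesis using that unfolding compatible_def by blast
qed

lemma next_corner:
  assumes "p \<in> V" "d \<in> units" "p + d \<in> V"
  obtains d' where "d' \<in> units" "cross2 (beta B d) (beta B d') > 0" "p + d' \<in> V" "p + d + d' \<in> V"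
  using pseudoplane assms unfolding pseudoplane_def by blast

lemma neighbour:
  assumes "p \<in> V"
  obtains d where "d \<in> units" "p + d \<in> V"
  using pseudoplane assms unfolding pseudoplane_def by blast

lemma crossing:
  assumes "cross2 (bv i) (bv j) \<noteq> 0"
  obtains p where "p \<in> V" "p $ i = k" "p $ j = l"
    "p + stdvec i \<in> V" "p + stdvec j \<in> V" "p + stdvec i + stdvec j \<in> V"
  using pseudoplane assms unfolding pseudoplane_def by metis

definition triangle :: "int ^ 'n \<Rightarrow> int ^ 'n \<Rightarrow> int ^ 'n \<Rightarrow> int ^ 'n \<Rightarrow> bool"
  where "triangle p a b c \<longleftrightarrow> p \<in> V \<and> {d \<in> units. p + d \<in> V} = {a, b, c} \<and>
    cross2 (beta B a) (beta B b) > 0 \<and> cross2 (beta B b) (beta B c) > 0 \<and> cross2 (beta B c) (beta B a) > 0 \<and>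
    p + a + b \<in> V \<and> p + b + c \<in> V \<and> p + c + a \<in> V"

lemma triangle_rotate: "triangle p a b c \<Longrightarrow> triangle p b c a"
  by (auto simp: triangle_def)

text \<open>\<open>next_corner\<close> sends each of the three directions to one that is a left turn
  of less than pi away. Two directions cannot be left turns of each other, so the map is a cycle of
  length three.\<close>

lemma triangle_exists:
  assumes "p \<in> V" "card {d \<in> units. p + d \<in> V} = 3"
  obtains a b c where "triangle p a b c"
proof -
  let ?D = "{d \<in> units. p + d \<in> V}"
  have nxt: "\<exists>y\<in>?D. cross2 (beta B x) (beta B y) > 0 \<and> p + x + y \<in> V" if "x \<in> ?D" for x
    using next_corner[of p x] that assms(1) by blast
  have "?D \<noteq> {}" using assms(2) by (metis card.empty zero_neq_numeral)
  then obtain a where a: "a \<in> ?D" by blast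
  obtain b where b: "b \<in> ?D" "cross2 (beta B a) (beta B b) > 0" "p + a + b \<in> V" using nxt[OF a] by blast
  have ab: "a \<noteq> b" using b by auto
  have "card (?D - {a, b}) = 1" using assms(2) a b(1) ab by (subst card_Diff_subset) auto
  then obtain c where "?D - {a, b} = {c}" by (auto simp: card_1_singleton_iff)
  then have D: "?D = {a, b, c}" using a b by auto
  have "\<not> cross2 (beta B b) (beta B a) > 0" using b(2) cross2_swap[of "beta B b" "beta B a"] by simp
  then have c: "cross2 (beta B b) (beta B c) > 0" "p + b + c \<in> V"
    using nxt[OF b(1)] unfolding D by auto
  have "\<not> cross2 (beta B c) (beta B b) > 0" using c(1) cross2_swap[of "beta B c" "beta B b"] by simp
  then have "cross2 (beta B c) (beta B a) > 0" "p + c + a \<in> V"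
    using nxt[of c] unfolding D by auto
  then have "triangle p a b c" using assms(1) b c D by (simp add: triangle_def)
  then show thesis by (rule that)
qed

end

locale flip = pseudo_surface L B V for L :: "(int ^ 'n::finite) set" and B V +
  fixes p0 a0 b0 c0 V'
  assumes tri0: "triangle p0 a0 b0 c0"
    and V'_def: "V' = (V - orbit L p0) \<union> orbit L (p0 + a0 + b0 + c0)"
begin

definition D where "D = {a0, b0, c0}"
definition p0' where "p0' = p0 + a0 + b0 + c0"
text \<open>Rotations only: any edge of the triangle may be made the first one while the
  counterclockwise order is kept.\<close>

definition cyc where "cyc a b c \<longleftrightarrow> (a = a0 \<and> b = b0 \<and> c = c0) \<or> (a = b0 \<and> b = c0 \<and> c = a0) \<or> (a = c0 \<and> b = a0 \<and> c = b0)"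

lemma cyc_obtain: assumes "a \<in> D" obtains b c where "cyc a b c"
  using assms by (auto simp: D_def cyc_def)

lemma cyc_rotate: "cyc a b c \<Longrightarrow> cyc b c a"
  by (auto simp: cyc_def)

lemma cyc_obtain2: assumes "a \<in> D" "b \<in> D" "a \<noteq> b" obtains c where "cyc a b c \<or> cyc b a c"
  using assms by (auto simp: D_def cyc_def)

lemma cycD:
  assumes "cyc a b c"
  shows "p0 \<in> V" "a \<in> units" "b \<in> units" "c \<in> units" "D = {a, b, c}"
    "cross2 (beta B a) (beta B b) > 0" "cross2 (beta B b) (beta B c) > 0" "cross2 (beta B c) (beta B a) > 0"
    "p0 + a \<in> V" "p0 + b \<in> V" "p0 + c \<in> V"
    "p0 + a + b \<in> V" "p0 + b + c \<in> V" "p0 + a + c \<in> V" "p0' = p0 + a + b + c"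
proof -
  have "triangle p0 a b c" using assms tri0 triangle_rotate unfolding cyc_def by blast
  then show "p0 \<in> V" "a \<in> units" "b \<in> units" "c \<in> units"
    "cross2 (beta B a) (beta B b) > 0" "cross2 (beta B b) (beta B c) > 0" "cross2 (beta B c) (beta B a) > 0"
    "p0 + a \<in> V" "p0 + b \<in> V" "p0 + c \<in> V"
    "p0 + a + b \<in> V" "p0 + b + c \<in> V" "p0 + a + c \<in> V"
    unfolding triangle_def by (auto simp: algebra_simps)
  show "D = {a, b, c}" "p0' = p0 + a + b + c" using assms by (auto simp: cyc_def D_def p0'_def algebra_simps)
qed

lemma D_units: "x \<in> D \<Longrightarrow> x \<in> units"
  using cyc_obtain cycD(2) by metis

lemma D_iff: "d \<in> D \<longleftrightarrow> d \<in> units \<and> p0 + d \<in> V"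
  using tri0 by (auto simp: triangle_def D_def)

lemma cyc_distinct:
  assumes "cyc a b c"
  shows "a \<noteq> b" "b \<noteq> c" "c \<noteq> a" "a \<noteq> - b" "b \<noteq> - c" "c \<noteq> - a" "b \<noteq> - a" "c \<noteq> - b" "a \<noteq> - c"
  using cycD(6-8)[OF assms] by auto

lemma cyc_idot:
  assumes "cyc a b c"
  shows "idot a b = 0" "idot b c = 0" "idot c a = 0" "idot b a = 0" "idot c b = 0" "idot a c = 0"
    "idot a a = 1" "idot b b = 1" "idot c c = 1"
  using cyc_distinct[OF assms] cycD(2-4)[OF assms]
  by (auto intro!: idot_units_other idot_units_self)

lemma minus_notin_D: "x \<in> D \<Longrightarrow> - x \<notin> D"
proof
  assume "x \<in> D" "- x \<in> D"
  then obtain b c where c: "cyc x b c" using cyc_obtain by blast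
  then have "- x = x \<or> - x = b \<or> - x = c" using \<open>- x \<in> D\<close> cycD(5)[OF c] by simp
  then show False using cyc_distinct[OF c] cyc_idot[OF c] idot_simps(5)[of x x] by fastforce
qed

text \<open>The three edge vectors satisfy a linear relation with positive coefficients, so no
  \<open>u\<close> is positive on all of them.\<close>

lemma all_crossed_impossible:
  assumes "q \<in> V" "\<And>x. x \<in> D \<Longrightarrow> idot (q - p0) x > 0"
  shows False
proof -
  have cyc: "cyc a0 b0 c0" by (simp add: cyc_def)
  note c = cycD[OF cyc]
  obtain u where u: "\<And>d. d \<in> units \<Longrightarrow> idot (q - p0) d > 0 \<Longrightarrow> beta B d \<bullet> u > 0"
    using direction[OF c(1) assms(1)] by blast
  have "beta B a0 \<bullet> u > 0" "beta B b0 \<bullet> u > 0" "beta B c0 \<bullet> u > 0"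
    using u assms(2) c(2-5) by auto
  then show False using pluecker[of "beta B b0" "beta B c0" "beta B a0" u] c(6-8)
    by (smt (verit) mult_pos_pos)
qed

text \<open>The cell at \<open>p0\<close> is a triangle: every other cell lies across one of its three edges.\<close>

lemma some_crossed:
  assumes q: "q \<in> V" "q \<noteq> p0"
  obtains x where "x \<in> D" "idot (q - p0) x > 0"
proof (rule ccontr)
  note witness = that
  assume "\<not> thesis"
  then have le: "idot (q - p0) x \<le> 0" if "x \<in> D" for x using witness[OF that] by linarith
  \<comment> \<open>Compatibility is applied from the far corner \<open>p0 + a + b\<close>, where
    the difference to \<open>q\<close> is smaller by one in the directions \<open>a\<close> and
    \<open>b\<close>: a value \<open>\<le> 0\<close> becomes \<open>< 0\<close>.\<close>
  have dir: "\<exists>u. beta B a \<bullet> u < 0 \<and> beta B b \<bullet> u < 0 \<and> (idot (q - p0) c < 0 \<longrightarrow> beta B c \<bullet> u < 0) \<and>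
      (\<forall>d\<in>units. d \<notin> D \<longrightarrow> - d \<notin> D \<longrightarrow> idot (q - p0) d > 0 \<longrightarrow> beta B d \<bullet> u > 0)"
    if "cyc a b c" for a b c
  proof -
    note c = cycD[OF that] and i = cyc_idot[OF that]
    obtain u where u: "\<And>d. d \<in> units \<Longrightarrow> idot (q - (p0 + a + b)) d > 0 \<Longrightarrow> beta B d \<bullet> u > 0"
      using direction[OF c(12) q(1)] by blast
    have "beta B (- a) \<bullet> u > 0"
      by (rule u) (use c i le[of a] in \<open>auto simp: idot_simps\<close>)
    moreover have "beta B (- b) \<bullet> u > 0"
      by (rule u) (use c i le[of b] in \<open>auto simp: idot_simps\<close>)
    moreover have "beta B (- c) \<bullet> u > 0" if "idot (q - p0) c < 0"
      by (rule u) (use c i that in \<open>auto simp: idot_simps\<close>)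
    moreover have "beta B d \<bullet> u > 0" if "d \<in> units" "d \<notin> D" "- d \<notin> D" "idot (q - p0) d > 0" for d
    proof (rule u)
      have "d \<noteq> a" "d \<noteq> b" "- d \<noteq> a" "- d \<noteq> b" using that c(5) by auto
      then have "idot a d = 0" "idot b d = 0"
        using idot_units_other[of d a] idot_units_other[of d b] that(1) c(2,3) by auto
      then show "idot (q - (p0 + a + b)) d > 0" using that(4) by (simp add: idot_simps)
    qed (use that in auto)
    ultimately show ?thesis by (intro exI[of _ u]) auto
  qed
  \<comment> \<open>With a strictly negative value at \<open>x\<close>, the corner of the other two
    edges gives a \<open>u\<close> negative on all three, against their positive relation.\<close>
  have zero: "idot (q - p0) x = 0" if x: "x \<in> D" for x
  proof (rule ccontr)
    assume "idot (q - p0) x \<noteq> 0"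
    then have neg: "idot (q - p0) x < 0" using le[OF x] by simp
    obtain a b where "cyc x a b" using cyc_obtain[OF x] by blast
    then have cyc: "cyc a b x" using cyc_rotate by blast
    obtain u where "beta B a \<bullet> u < 0" "beta B b \<bullet> u < 0" "beta B x \<bullet> u < 0"
      using dir[OF cyc] neg by blast
    then show False using pluecker[of "beta B b" "beta B x" "beta B a" u] cycD(6-8)[OF cyc]
      by (smt (verit) mult_pos_neg)
  qed
  obtain d where d: "d \<in> units" "idot (q - p0) d > 0"
    using exists_unit_idot_pos[of "q - p0"] q(2) by auto
  have dD: "d \<notin> D" "- d \<notin> D" using zero[of d] zero[of "- d"] d(2) by (auto simp: idot_simps)
  \<comment> \<open>This places \<open>d\<close> outside the closed sector of \<open>a\<close> and
    \<open>b\<close>. It cannot hold for all three pairs of consecutive edges, since their sectors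
    cover the plane.\<close>
  have no: "cross2 (beta B a) (beta B d) < 0 \<or> cross2 (beta B d) (beta B b) < 0" if cyc: "cyc a b c" for a b c
  proof (rule ccontr)
    assume "\<not> ?thesis"
    then have x: "cross2 (beta B d) (beta B a) \<le> 0" "cross2 (beta B b) (beta B d) \<le> 0"
      using cross2_swap[of "beta B d" "beta B a"] cross2_swap[of "beta B d" "beta B b"] by auto
    obtain u where u: "beta B a \<bullet> u < 0" "beta B b \<bullet> u < 0" "beta B d \<bullet> u > 0"
      using dir[OF cyc] d dD by blast
    have "cross2 (beta B b) (beta B d) * (beta B a \<bullet> u) \<ge> 0" "cross2 (beta B d) (beta B a) * (beta B b \<bullet> u) \<ge> 0"
      "cross2 (beta B a) (beta B b) * (beta B d \<bullet> u) > 0"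
      using x u cycD(6)[OF cyc] by (auto intro: mult_nonpos_nonpos)
    then show False
      using pluecker[of "beta B b" "beta B d" "beta B a" u] by linarith
  qed
  have cyc: "cyc a0 b0 c0" by (simp add: cyc_def)
  note c = cycD(6-8)[OF cyc]
  let ?a = "cross2 (beta B a0) (beta B d)" and ?b = "cross2 (beta B b0) (beta B d)" and ?c = "cross2 (beta B c0) (beta B d)"
  have "?a < 0 \<or> ?b > 0" "?b < 0 \<or> ?c > 0" "?c < 0 \<or> ?a > 0"
    using no[OF cyc] no[OF cyc_rotate[OF cyc]] no[OF cyc_rotate[OF cyc_rotate[OF cyc]]]
      cross2_swap[of "beta B d"] by auto
  then have "?a > 0 \<and> ?b > 0 \<and> ?c > 0 \<or> ?a < 0 \<and> ?b < 0 \<and> ?c < 0" by linarith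
  then have "cross2 (beta B b0) (beta B c0) * ?a + cross2 (beta B c0) (beta B a0) * ?b
      + cross2 (beta B a0) (beta B b0) * ?c \<noteq> 0"
    using c by (auto simp: add_pos_pos add_neg_neg mult_pos_neg order.strict_implies_not_eq)
      (metis add_pos_pos less_irrefl mult_pos_pos)
  then show False
    using pluecker_cross[of "beta B b0" "beta B c0" "beta B a0" "beta B d"] by blast
qed

lemma coord_sum_D: "x \<in> D \<Longrightarrow> coord_sum x = 1 \<or> coord_sum x = -1"
  using D_units units_coord_sum by blast

lemma V'_iff: "q \<in> V' \<longleftrightarrow> (q \<in> V \<and> q - p0 \<notin> L) \<or> q - p0' \<in> L"
  by (simp add: V'_def mem_orbit_iff p0'_def)

lemma V'_translate: "p \<in> V' \<Longrightarrow> l \<in> L \<Longrightarrow> p + l \<in> V'"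
proof -
  assume a: "p \<in> V'" "l \<in> L"
  have "p + l - r \<in> L \<longleftrightarrow> p - r \<in> L" for r
    using add_in_L[of "p - r" l] diff_in_L[of "p + l - r" l] a(2) by (auto simp: algebra_simps)
  then show ?thesis using a translate by (auto simp: V'_iff)
qed

lemma nbr_in_V':
  assumes "x \<in> D" "l \<in> L"
  shows "p0 + l + x \<in> V'"
proof -
  have "x \<notin> L" using coord_sum_D[OF assms(1)] coord_sum_L' by fastforce
  then have "p0 + x \<in> V'" using assms(1) by (simp add: V'_iff D_iff)
  then show ?thesis using V'_translate[of "p0 + x" l] assms(2) by (simp add: ac_simps)
qed

lemma nbr2_in_V':
  assumes "x \<in> D" "y \<in> D" "x \<noteq> y" "l \<in> L"
  shows "p0 + l + x + y \<in> V'"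
proof -
  have V: "p0 + x + y \<in> V" using cyc_obtain2[OF assms(1-3)] cycD(12)
    by (metis add.assoc add.commute)
  have "x + y \<notin> L"
  proof
    assume "x + y \<in> L"
    moreover have "p0 + x \<in> V" using assms(1) D_iff by blast
    ultimately have "p0 + x + - (x + y) \<in> V" using translate[of "p0 + x" "- (x + y)"] minus_in_L by blast
    then have "- y \<in> D" using assms(2) D_units by (auto simp: D_iff)
    then show False using minus_notin_D assms(2) by blast
  qed
  then have "p0 + x + y \<in> V'" using V by (simp add: V'_iff algebra_simps)
  then show ?thesis using V'_translate[of "p0 + x + y" l] assms(4) by (simp add: ac_simps)
qed

lemma top_in_V': "l \<in> L \<Longrightarrow> p0' + l \<in> V'"
  by (simp add: V'_iff)

text \<open>Let the edge \<open>x\<close> separate \<open>q\<close> from \<open>p0\<close>. The old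
  vertex \<open>p0 + b + c\<close> differs from \<open>p0'\<close> only by \<open>x\<close>, and
  seen from \<open>p0'\<close> the vertex \<open>q\<close> is still not on the negative side of
  \<open>x\<close>. So the direction from this old vertex to \<open>q\<close> serves
  \<open>p0'\<close> as well.\<close>

lemma flip_compatible_mixed:
  assumes q: "q \<in> V" "q \<noteq> p0"
  shows "compatible B (q - p0')"
proof -
  obtain x where x: "x \<in> D" "idot (q - p0) x > 0" using some_crossed[OF q] by blast
  obtain b c where cyc: "cyc x b c" using cyc_obtain[OF x(1)] by blast
  note c = cycD[OF cyc] and i = cyc_idot[OF cyc]
  obtain u where u: "\<And>d. d \<in> units \<Longrightarrow> idot (q - (p0 + b + c)) d > 0 \<Longrightarrow> beta B d \<bullet> u > 0"
    using direction[OF c(13) q(1)] by blast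
  show ?thesis
    unfolding compatible_def
  proof (intro exI[of _ u] ballI impI)
    fix d :: "int ^ 'n" assume d: "d \<in> units" "idot (q - p0') d > 0"
    have "idot (q - p0') x \<ge> 0" using x(2) i by (simp add: c(15) idot_simps)
    then have "d \<noteq> - x" using d(2) by (auto simp: idot_simps)
    then have "idot x d \<ge> 0" using idot_units_ge[OF d(1) c(2)] by (metis minus_minus)
    then show "beta B d \<bullet> u > 0"
      using u[OF d(1)] d(2) by (simp add: c(15) idot_simps)
  qed
qed

lemma flip_compatible:
  assumes "p \<in> V'" "q \<in> V'"
  shows "compatible B (q - p)"
proof -
  have mixed: "compatible B (q - p)" if "q \<in> V" "q - p0 \<notin> L" "p - p0' \<in> L" for p q
  proof -
    have "q + - (p - p0') \<in> V" using translate[of q "- (p - p0')"] that minus_in_L by blast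
    then have "q - (p - p0') \<in> V" by (metis diff_conv_add_uminus)
    moreover have "q - (p - p0') \<noteq> p0"
    proof
      assume "q - (p - p0') = p0"
      then have "q - p0 = p - p0'" by (simp add: algebra_simps)
      then show False using that(2,3) by simp
    qed
    ultimately have "compatible B (q - (p - p0') - p0')" by (rule flip_compatible_mixed)
    then show ?thesis by simp
  qed
  consider "q \<in> V" "p \<in> V" | "q \<in> V" "q - p0 \<notin> L" "p - p0' \<in> L" | "p \<in> V" "p - p0 \<notin> L" "q - p0' \<in> L"
    | "p - p0' \<in> L" "q - p0' \<in> L"
    using assms by (auto simp: V'_iff)
  then show ?thesis
  proof cases
    case 1
    then show ?thesis using pseudoplane unfolding pseudoplane_def by blast
  next
    case 2
    then show ?thesis by (rule mixed)
  next
    case 3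
    then show ?thesis using compatible_uminus[OF mixed[OF 3]] by simp
  next
    case 4
    have p0: "p0 \<in> V" using cycD(1) cyc_def by blast
    have "p0 + (p - p0') \<in> V" "p0 + (q - p0') \<in> V" using 4 translate[OF p0] by blast+
    then have "compatible B ((p0 + (q - p0')) - (p0 + (p - p0')))"
      using pseudoplane unfolding pseudoplane_def by blast
    then show ?thesis by simp
  qed
qed

text \<open>The flip keeps the hexagon of six vertices around \<open>p0\<close> and replaces the
  three squares inside by those around \<open>p0'\<close>. An old edge keeps its left square unless
  this contains a translate of \<open>p0\<close>; then it is a side of the hexagon and gets the new
  inner square.\<close>

lemma flip_next_corner:
  assumes p: "p \<in> V'" and d: "d \<in> units" and pd: "p + d \<in> V'"
  shows "\<exists>d'\<in>units. cross2 (beta B d) (beta B d') > 0 \<and> p + d' \<in> V' \<and> p + d + d' \<in> V'"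
proof -
  \<comment> \<open>The heights of the two ends differ by one, whereas height is constant on
    orbits.\<close>
  have notL: "p - p0' \<notin> L \<or> p + d - p0' \<notin> L"
    using units_coord_sum[OF d] coord_sum_L'[of "p - p0'"] coord_sum_L'[of "p + d - p0'"] by fastforce
  \<comment> \<open>A vertex of \<open>V\<close> next to \<open>p0'\<close> in any direction other
    than a reversed edge would lie beyond all three edges of \<open>p0\<close>.\<close>
  have step: "- d \<in> D" if "p + d \<in> V" "p \<in> orbit L p0'" "d \<in> units" for p d
  proof (rule ccontr)
    assume nD: "- d \<notin> D"
    let ?q = "p + d + (p0' - p)"
    have "p0' - p \<in> L" using that(2) minus_in_L[of "p - p0'"] by (simp add: mem_orbit_iff)
    then have "?q \<in> V" using that(1) translate by blast
    moreover have "idot (?q - p0) x > 0" if x: "x \<in> D" for x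
    proof -
      obtain b c where cyc: "cyc x b c" using cyc_obtain[OF x] by blast
      note c = cycD[OF cyc] and i = cyc_idot[OF cyc]
      have "d \<noteq> - x" using nD x by auto
      then have "idot d x \<ge> 0" using idot_units_ge[OF c(2) \<open>d \<in> units\<close>] by blast
      then show ?thesis using i by (simp add: c(15) idot_simps)
    qed
    ultimately show False by (rule all_crossed_impossible)
  qed
  consider (old) "p \<in> V" "p - p0 \<notin> L" "p + d \<in> V" "p + d - p0 \<notin> L"
    | (src) "p - p0' \<in> L" "p + d \<in> V" | (dst) "p + d - p0' \<in> L" "p \<in> V"
    using p pd notL by (auto simp: V'_iff)
  then show ?thesis
  proof cases
    case old
    obtain d' where d': "d' \<in> units" "cross2 (beta B d) (beta B d') > 0" "p + d' \<in> V" "p + d + d' \<in> V"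
      using next_corner[OF old(1) d old(3)] by blast
    consider "p + d' - p0 \<in> L" | "p + d + d' - p0 \<in> L" | "p + d' - p0 \<notin> L" "p + d + d' - p0 \<notin> L" by blast
    then show ?thesis
    proof cases
      case 1
      \<comment> \<open>Up to translation the edge runs from \<open>p0 - d'\<close> to
        \<open>p0 - d' + b\<close>; its new left square has \<open>p0'\<close> opposite to
        \<open>p\<close>.\<close>
      define l where "l = p + d' - p0"
      have l: "l \<in> L" "p = p0 + l - d'" using 1 by (auto simp: l_def)
      have "p0 - d' \<in> V" "p0 + d \<in> V"
        using translate_iff[OF l(1), of "p0 - d'"] translate_iff[OF l(1), of "p0 + d"] old(1) d'(4) l(2)
        by (simp_all add: algebra_simps)
      then have D: "- d' \<in> D" "d \<in> D" using d d' by (auto simp: D_iff)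
      obtain b c where cyc: "cyc (- d') b c" using cyc_obtain[OF D(1)] by blast
      note c = cycD[OF cyc]
      have "d = b" using D(2) d'(2) c(5,8) cross2_swap[of "beta B c" "beta B d'"] by auto
      then have e: "p + c = p0 + l + - d' + c" "p + d + c = p0' + l" using l(2) c(15) by simp_all
      have "p + c \<in> V'" "p + d + c \<in> V'"
        unfolding e using nbr2_in_V'[of "- d'" c l] top_in_V' l(1) c(5) cyc_distinct(3)[OF cyc] by blast+
      then show ?thesis using c(4,7) \<open>d = b\<close> by blast
    next
      case 2
      \<comment> \<open>Up to translation the edge runs from \<open>p0 - d' + c\<close> to
        \<open>p0 - d'\<close>, where \<open>c = - d\<close>; its new left square has
        \<open>p0'\<close> next to \<open>p\<close>.\<close>
      define l where "l = p + d + d' - p0"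
      have l: "l \<in> L" "p = p0 + l - d - d'" using 2 by (auto simp: l_def)
      have "p0 - d' \<in> V" "p0 - d \<in> V"
        using translate_iff[OF l(1), of "p0 - d'"] translate_iff[OF l(1), of "p0 - d"] old(3) d'(3) l(2)
        by (simp_all add: algebra_simps)
      then have D: "- d' \<in> D" "- d \<in> D" using d d' by (auto simp: D_iff)
      obtain b c where cyc: "cyc (- d') b c" using cyc_obtain[OF D(1)] by blast
      note c = cycD[OF cyc]
      have dc: "- d = c" using D(2) d'(2) c(5,6) cross2_swap[of "beta B b" "beta B d'"]
        by (auto simp: minus_equation_iff[of d] cross2_swap[of "beta B d" "beta B d'"])
      have e: "p + b = p0' + l" "p + d + b = p0 + l + - d' + b"
        unfolding l(2) c(15) dc[symmetric] by (simp_all add: algebra_simps)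
      have "p + b \<in> V'" "p + d + b \<in> V'"
        unfolding e using nbr2_in_V'[of "- d'" b l] top_in_V' l(1) c(5) cyc_distinct(1)[OF cyc] by blast+
      moreover have "cross2 (beta B d) (beta B b) > 0"
        using c(7) cross2_swap[of "beta B b" "beta B c"] by (simp flip: dc add: cross2_swap[of "beta B b" "beta B d"])
      ultimately show ?thesis using c(3) by blast
    next
      case 3
      then show ?thesis using d' by (auto simp: V'_iff)
    qed
  next
    case src
    then have D: "- d \<in> D" using step[of p d] d by (simp add: mem_orbit_iff)
    define l where "l = p - p0'"
    have l: "l \<in> L" "p = p0' + l" using src by (auto simp: l_def)
    obtain b c where cyc: "cyc (- d) b c" using cyc_obtain[OF D] by blast
    note c = cycD[OF cyc]
    have e: "p + - b = p0 + l + - d + c" "p + d + - b = p0 + l + c" using l(2) c(15) by simp_all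
    have "p + - b \<in> V'" "p + d + - b \<in> V'"
      unfolding e using nbr2_in_V'[of "- d" c l] nbr_in_V'[of c l] l(1) c(5) cyc_distinct(3)[OF cyc] by blast+
    moreover have "cross2 (beta B d) (beta B (- b)) > 0" using c(6) by simp
    ultimately show ?thesis using c(3) units_minus by blast
  next
    case dst
    then have D: "d \<in> D" using step[of "p + d" "- d"] d by (simp add: mem_orbit_iff)
    define l where "l = p + d - p0'"
    have l: "l \<in> L" "p = p0' + l - d" using dst by (auto simp: l_def)
    obtain b c where cyc: "cyc d b c" using cyc_obtain[OF D] by blast
    note c = cycD[OF cyc]
    have e: "p + - c = p0 + l + b" "p + d + - c = p0 + l + d + b" using l(2) c(15) by simp_all
    have "p + - c \<in> V'" "p + d + - c \<in> V'"
      unfolding e using nbr2_in_V'[of d b l] nbr_in_V'[of b l] l(1) c(5) cyc_distinct(1)[OF cyc] by blast+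
    moreover have "cross2 (beta B d) (beta B (- c)) > 0" using c(8) cross2_swap[of "beta B c" "beta B d"] by simp
    ultimately show ?thesis using c(4) units_minus by blast
  qed
qed

lemma flip_neighbour:
  assumes "p \<in> V'"
  shows "\<exists>d\<in>units. p + d \<in> V'"
proof -
  have cyc: "cyc a0 b0 c0" by (simp add: cyc_def)
  note c = cycD[OF cyc]
  consider "p \<in> V" "p - p0 \<notin> L" | "p - p0' \<in> L" using assms by (auto simp: V'_iff)
  then show ?thesis
  proof cases
    case 1
    obtain d where d: "d \<in> units" "p + d \<in> V" using neighbour[OF 1(1)] by blast
    show ?thesis
    proof (cases "p + d - p0 \<in> L")
      case True
      define l where "l = p + d - p0"
      have l: "l \<in> L" "p = p0 + l - d" using True by (auto simp: l_def)
      have "p0 - d \<in> V" using translate_iff[OF l(1), of "p0 - d"] 1(1) l(2) by (simp add: algebra_simps)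
      then have D: "- d \<in> D" using d by (auto simp: D_iff)
      obtain b c where cyc: "cyc (- d) b c" using cyc_obtain[OF D] by blast
      have "p + b \<in> V'" using nbr2_in_V'[of "- d" b l] l cycD(5)[OF cyc] cyc_distinct(1)[OF cyc] by simp
      then show ?thesis using cycD(3)[OF cyc] by blast
    qed (use d in \<open>auto simp: V'_iff\<close>)
  next
    case 2
    define l where "l = p - p0'"
    have l: "l \<in> L" "p = p0' + l" using 2 by (auto simp: l_def)
    have "p + - c0 = p0 + l + a0 + b0" using l(2) c(15) by simp
    then have "p + - c0 \<in> V'" using nbr2_in_V'[of a0 b0 l] l(1) c(5) cyc_distinct(1)[OF cyc] by simp
    then show ?thesis using c(4) units_minus by blast
  qed
qed

text \<open>A square at a translate of \<open>p0\<close> reappears on the opposite side of the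
  hexagon, shifted by the third direction \<open>z\<close>, and \<open>z\<close> has zero
  coordinates at \<open>i\<close> and \<open>j\<close>.\<close>

lemma flip_crossing:
  assumes "cross2 (bv i) (bv j) \<noteq> 0"
  shows "\<exists>p\<in>V'. p $ i = k \<and> p $ j = l \<and> p + stdvec i \<in> V' \<and> p + stdvec j \<in> V' \<and> p + stdvec i + stdvec j \<in> V'"
proof -
  obtain p where p: "p \<in> V" "p $ i = k" "p $ j = l"
    "p + stdvec i \<in> V" "p + stdvec j \<in> V" "p + stdvec i + stdvec j \<in> V"
    using crossing[OF assms] by metis
  have ij: "i \<noteq> j" using assms by auto
  show ?thesis
  proof (cases "p - p0 \<notin> L \<and> p + stdvec i - p0 \<notin> L \<and> p + stdvec j - p0 \<notin> L \<and> p + stdvec i + stdvec j - p0 \<notin> L")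
    case True
    then show ?thesis using p by (intro bexI[of _ p]) (auto simp: V'_iff)
  next
    case False
    have main: "\<exists>z. z $ i = 0 \<and> z $ j = 0 \<and> (\<forall>q\<in>{r, r + x, r + y, r + x + y}. q + z \<in> V')"
      if r: "r - p0 \<in> L" "r + x \<in> V" "r + y \<in> V" and xy: "x = stdvec i \<or> x = - stdvec i" "y = stdvec j \<or> y = - stdvec j" for r x y
    proof -
      define l where "l = r - p0"
      have l: "l \<in> L" "r = p0 + l" using r by (auto simp: l_def)
      have "p0 + x \<in> V" "p0 + y \<in> V"
        using translate_iff[OF l(1), of "p0 + x"] translate_iff[OF l(1), of "p0 + y"] r l(2) by (simp_all add: algebra_simps)
      then have D: "x \<in> D" "y \<in> D" using xy by (auto simp: D_iff)
      have "x \<noteq> y" "x \<noteq> - y" using xy ij by auto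
      then obtain z where z: "cyc x y z \<or> cyc y x z" using cyc_obtain2[OF D] by blast
      have "z \<in> D \<and> p0' = p0 + x + y + z \<and> idot z x = 0 \<and> idot z y = 0 \<and> z \<noteq> x \<and> z \<noteq> y"
        using z
      proof
        assume z: "cyc x y z"
        show ?thesis using cycD(5,15)[OF z] cyc_idot(2,3,5)[OF z] cyc_distinct(2,3)[OF z] by simp
      next
        assume z: "cyc y x z"
        show ?thesis using cycD(5,15)[OF z] cyc_idot(2,3,5)[OF z] cyc_distinct(2,3)[OF z] by (simp add: ac_simps)
      qed
      then have zD: "z \<in> D" and top: "p0' = p0 + x + y + z" and zx: "idot z x = 0" "idot z y = 0"
        and ne: "z \<noteq> x" "z \<noteq> y" by blast+
      have "z $ i = 0" "z $ j = 0" using zx xy by (auto simp: idot_simps)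
      moreover have "r + z \<in> V'" "r + x + z \<in> V'" "r + y + z \<in> V'"
        using nbr_in_V'[OF zD l(1)] nbr2_in_V'[OF D(1) zD _ l(1)] nbr2_in_V'[OF D(2) zD _ l(1)] ne l(2) by auto
      moreover have "r + x + y + z = p0' + l" using l(2) top by simp
      then have "r + x + y + z \<in> V'" using top_in_V'[OF l(1)] by simp
      ultimately show ?thesis by auto
    qed
    have "\<exists>z. z $ i = 0 \<and> z $ j = 0 \<and> (\<forall>q\<in>{p, p + stdvec i, p + stdvec j, p + stdvec i + stdvec j}. q + z \<in> V')"
    proof -
      consider "p - p0 \<in> L" | "p + stdvec i - p0 \<in> L" | "p + stdvec j - p0 \<in> L" | "p + stdvec i + stdvec j - p0 \<in> L"
        using False by blast
      then show ?thesis
      proof cases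
        case 1
        then show ?thesis using main[of p "stdvec i" "stdvec j"] p by simp
      next
        case 2
        then show ?thesis using main[of "p + stdvec i" "- stdvec i" "stdvec j"] p by (auto simp: algebra_simps)
      next
        case 3
        then show ?thesis using main[of "p + stdvec j" "stdvec i" "- stdvec j"] p by (auto simp: algebra_simps)
      next
        case 4
        then show ?thesis using main[of "p + stdvec i + stdvec j" "- stdvec i" "- stdvec j"] p by (auto simp: algebra_simps)
      qed
    qed
    then obtain z where "z $ i = 0" "z $ j = 0" "\<forall>q\<in>{p, p + stdvec i, p + stdvec j, p + stdvec i + stdvec j}. q + z \<in> V'" by blast
    then show ?thesis using p by (intro bexI[of _ "p + z"]) (auto simp: algebra_simps)
  qed
qed

lemma flip_pseudoplane: "pseudoplane B L V'"
  unfolding pseudoplane_def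
  using V'_translate flip_compatible flip_next_corner flip_neighbour flip_crossing by blast

end

context lattice_plane
begin

lemma elementary_transformation_pseudoplane:
  assumes V: "pseudoplane B L V" and et: "elementary_transformation L V V'"
  shows "pseudoplane B L V'"
proof -
  interpret pseudo_surface L B V by unfold_locales (rule V)
  obtain p0 p1 p2 p3 where p: "p0 \<in> V" "distinct [p1, p2, p3]"
    "{q \<in> V. dist (realvec q) (realvec p0) = 1} = {p1, p2, p3}"
    "V' = (V - orbit L p0) \<union> orbit L (p1 + p2 + p3 - 2 *s p0)"
    using et unfolding elementary_transformation_def by blast
  have "{d \<in> units. p0 + d \<in> V} = (\<lambda>q. q - p0) ` {q \<in> V. dist (realvec q) (realvec p0) = 1}"
    unfolding dist_one_iff_units
  proof (intro equalityI subsetI)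
    fix d assume "d \<in> {d \<in> units. p0 + d \<in> V}"
    then show "d \<in> (\<lambda>q. q - p0) ` {q \<in> V. q - p0 \<in> units}" by (intro image_eqI[of _ _ "p0 + d"]) auto
  qed auto
  then have D: "{d \<in> units. p0 + d \<in> V} = {p1 - p0, p2 - p0, p3 - p0}" unfolding p(3) by simp
  have "card {d \<in> units. p0 + d \<in> V} = 3" unfolding D using p(2) by simp
  then obtain a b c where tri: "triangle p0 a b c" using triangle_exists[OF p(1)] by blast
  then have abc: "{a, b, c} = {p1 - p0, p2 - p0, p3 - p0}" and "distinct [a, b, c]"
    using D by (auto simp: triangle_def)
  have "a + b + c = \<Sum>{a, b, c}" using \<open>distinct [a, b, c]\<close> by (simp add: add.assoc)
  also have "\<dots> = (p1 - p0) + (p2 - p0) + (p3 - p0)" unfolding abc using p(2) by (simp add: algebra_simps)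
  finally have "p0 + a + b + c = p1 + p2 + p3 - 2 *s p0"
    by (simp add: vec_eq_iff algebra_simps)
  then interpret flip L B V p0 a b c V'
    using tri p(4) by unfold_locales simp_all
  show ?thesis by (rule flip_pseudoplane)
qed

theorem surface_pseudoplane: "is_surface L V \<Longrightarrow> pseudoplane B L V"
  by (induction rule: is_surface.induct) (auto intro: initial_pseudoplane elementary_transformation_pseudoplane)

end

section \<open>Corners and crossings\<close>

lemma binet_cauchy: "(x \<bullet> u) * (y \<bullet> w) - (x \<bullet> w) * (y \<bullet> u) = cross2 x y * cross2 u w"
  by (simp add: cross2_def inner_2 algebra_simps)

text \<open>\<open>R\<close> represents \<open>\<int>\<^sup>2\<close> modulo the lattice spanned by
  \<open>(a, c)\<close> and \<open>(b, d)\<close>. Bezout coefficients of \<open>a\<close> and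
  \<open>b\<close> give a unimodular change to the triangular basis \<open>(g, h)\<close>,
  \<open>(0, e)\<close>, so a rectangle with sides \<open>g\<close> and \<open>|e|\<close>
  suffices.\<close>

lemma lattice_index:
  fixes a b c d :: int
  assumes D: "a * d - b * c \<noteq> 0"
  obtains R :: "(int \<times> int) set" where "finite R" "card R = nat \<bar>a * d - b * c\<bar>"
    "\<And>k l. \<exists>r\<in>R. \<exists>x y. k - fst r = a * x + b * y \<and> l - snd r = c * x + d * y"
    "\<And>r r' x y. r \<in> R \<Longrightarrow> r' \<in> R \<Longrightarrow> fst r - fst r' = a * x + b * y \<Longrightarrow>
      snd r - snd r' = c * x + d * y \<Longrightarrow> r = r'"
proof -
  define g where "g = gcd a b"
  have "a \<noteq> 0 \<or> b \<noteq> 0" using D by auto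
  then have g: "g > 0" by (simp add: g_def)
  obtain u w where uw: "u * a + w * b = g" using bezout_int g_def by blast
  obtain a' b' where ab: "a = g * a'" "b = g * b'" unfolding g_def by (meson dvdE gcd_dvd1 gcd_dvd2)
  have "g * (u * a' + w * b') = g * 1" using uw ab by (simp add: algebra_simps)
  then have one: "u * a' + w * b' = 1" using g by (metis less_irrefl mult_cancel_left)
  define h e where "h = c * u + d * w" and "e = d * a' - c * b'"
  have De: "a * d - b * c = g * e" by (simp add: ab e_def algebra_simps)
  then have e: "e \<noteq> 0" using D by auto
  define R where "R = {0..<g} \<times> {0..<\<bar>e\<bar>}"
  have lat: "(\<exists>x y. m = a * x + b * y \<and> n = c * x + d * y) \<longleftrightarrow> (\<exists>s t. m = g * s \<and> n = h * s + e * t)" for m n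
  proof
    assume "\<exists>x y. m = a * x + b * y \<and> n = c * x + d * y"
    then obtain x y where xy: "m = a * x + b * y" "n = c * x + d * y" by blast
    \<comment> \<open>This substitution and the one in the converse are inverse to each other, with
      determinant \<open>u * a' + w * b' = 1\<close>.\<close>
    let ?s = "a' * x + b' * y" and ?t = "u * y - w * x"
    have "m = g * ?s" by (simp add: xy ab algebra_simps)
    moreover have "h * ?s + e * ?t = (u * a' + w * b') * (c * x + d * y)"
      by (simp add: h_def e_def algebra_simps)
    then have "n = h * ?s + e * ?t" by (simp add: xy one)
    ultimately show "\<exists>s t. m = g * s \<and> n = h * s + e * t" by blast
  next
    assume "\<exists>s t. m = g * s \<and> n = h * s + e * t"
    then obtain s t where st: "m = g * s" "n = h * s + e * t" by blast
    let ?x = "u * s - b' * t" and ?y = "w * s + a' * t"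
    have "a * ?x + b * ?y = g * ((u * a' + w * b') * s)" by (simp add: ab algebra_simps)
    then have "m = a * ?x + b * ?y" by (simp add: st one)
    moreover have "n = c * ?x + d * ?y" by (simp add: st h_def e_def algebra_simps)
    ultimately show "\<exists>x y. m = a * x + b * y \<and> n = c * x + d * y" by blast
  qed
  show thesis
  proof (rule that[of R])
    show "finite R" by (simp add: R_def)
    have "nat g * nat \<bar>e\<bar> = nat \<bar>g * e\<bar>" using g by (simp add: abs_mult nat_mult_distrib)
    then show "card R = nat \<bar>a * d - b * c\<bar>" by (simp add: R_def card_cartesian_product De)
  next
    fix k l
    define s where "s = k div g"
    define r where "r = (k mod g, (l - h * s) mod \<bar>e\<bar>)"
    have "r \<in> R" using g e by (simp add: r_def R_def)
    moreover have "k - fst r = g * s" by (simp add: r_def s_def minus_mod_eq_mult_div)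
    moreover have "l - snd r = h * s + e * (sgn e * ((l - h * s) div \<bar>e\<bar>))"
    proof -
      have "l - snd r = h * s + ((l - h * s) - (l - h * s) mod \<bar>e\<bar>)" by (simp add: r_def)
      also have "(l - h * s) - (l - h * s) mod \<bar>e\<bar> = \<bar>e\<bar> * ((l - h * s) div \<bar>e\<bar>)"
        by (rule minus_mod_eq_mult_div)
      also have "\<bar>e\<bar> = e * sgn e" by (simp add: abs_sgn)
      finally show ?thesis by (simp add: mult.assoc abs_sgn)
    qed
    ultimately show "\<exists>r\<in>R. \<exists>x y. k - fst r = a * x + b * y \<and> l - snd r = c * x + d * y"
      unfolding lat by blast
  next
    fix r r' x y assume r: "r \<in> R" "r' \<in> R" and "fst r - fst r' = a * x + b * y" "snd r - snd r' = c * x + d * y"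
    then obtain s t where st: "fst r - fst r' = g * s" "snd r - snd r' = h * s + e * t" using lat by meson
    have "fst r mod g = fst r' mod g" using st(1) by (simp add: mod_eq_dvd_iff)
    then have 1: "fst r = fst r'" using r by (auto simp: R_def)
    then have "s = 0" using st(1) g by simp
    then have "e dvd snd r - snd r'" using st(2) by simp
    then have "snd r mod \<bar>e\<bar> = snd r' mod \<bar>e\<bar>" by (simp add: mod_eq_dvd_iff)
    then have "snd r = snd r'" using r by (auto simp: R_def)
    then show "r = r'" using 1 by (simp add: prod_eq_iff)
  qed
qed

section \<open>Corners around a vertex\<close>

context pseudo_surface
begin

definition corner :: "int ^ 'n \<Rightarrow> int ^ 'n \<Rightarrow> int ^ 'n \<Rightarrow> bool"
  where "corner p d d' \<longleftrightarrow> d \<in> units \<and> d' \<in> units \<and> cross2 (beta B d) (beta B d') > 0 \<and>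
    p \<in> V \<and> p + d \<in> V \<and> p + d' \<in> V \<and> p + d + d' \<in> V"

lemma cornerD:
  assumes "corner p d d'"
  shows "d \<in> units" "d' \<in> units" "cross2 (beta B d) (beta B d') > 0"
    "p \<in> V" "p + d \<in> V" "p + d' \<in> V" "p + d + d' \<in> V" "d \<noteq> d'" "d \<noteq> - d'" "idot d d' = 0" "idot d' d = 0"
proof -
  show *: "d \<in> units" "d' \<in> units" "cross2 (beta B d) (beta B d') > 0"
    "p \<in> V" "p + d \<in> V" "p + d' \<in> V" "p + d + d' \<in> V"
    using assms by (auto simp: corner_def)
  show ne: "d \<noteq> d'" "d \<noteq> - d'" using *(3) by auto
  then have "d' \<noteq> - d" by auto
  then show "idot d d' = 0" "idot d' d = 0" using *(1,2) ne by (auto intro!: idot_units_other)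
qed

lemma corner_swap: "corner p d d' \<Longrightarrow> corner (p + d + d') (- d) (- d')"
  by (simp add: corner_def)

lemma diff_direction:
  assumes "p + x \<in> V" "p + y \<in> V"
  obtains u where "\<And>d. d \<in> units \<Longrightarrow> idot (y - x) d > 0 \<Longrightarrow> beta B d \<bullet> u > 0"
  using direction[OF assms] by (metis add_diff_cancel_left)

text \<open>The direction from \<open>p + e\<close> to the far corner \<open>p + d + d'\<close> is
  positive on \<open>d\<close> and \<open>d'\<close> and negative on \<open>e\<close>, although the
  vector of \<open>e\<close> would be a positive combination of the other two.\<close>

lemma no_neighbour_inside:
  assumes c: "corner p d d'" and e: "e \<in> units" "p + e \<in> V"
    and "cross2 (beta B d) (beta B e) > 0" "cross2 (beta B e) (beta B d') > 0"
  shows False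
proof -
  note c = cornerD[OF c]
  have ne: "e \<noteq> d" "e \<noteq> d'" using assms(4,5) by auto
  have le: "idot e d \<le> 0" "idot e d' \<le> 0" "idot d e \<le> 0" "idot d' e \<le> 0" using ne c(1,2) e(1) by (auto intro!: idot_units_le)
  have "p + (d + d') \<in> V" using c(7) by (simp add: add.assoc)
  then obtain u where u: "\<And>f. f \<in> units \<Longrightarrow> idot (d + d' - e) f > 0 \<Longrightarrow> beta B f \<bullet> u > 0"
    using diff_direction[OF e(2)] by blast
  have "beta B d \<bullet> u > 0" "beta B d' \<bullet> u > 0" "beta B (- e) \<bullet> u > 0"
    by (rule u; use c(10,11) le in \<open>simp add: c(1,2) e(1) idot_simps idot_units_self\<close>)+
  then have "cross2 (beta B e) (beta B d') * (beta B d \<bullet> u) > 0" "cross2 (beta B d) (beta B e) * (beta B d' \<bullet> u) > 0"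
    "cross2 (beta B d) (beta B d') * (beta B e \<bullet> u) < 0"
    using assms(4,5) c(3) by (auto simp: mult_pos_neg)
  then show False
    using pluecker[of "beta B e" "beta B d'" "beta B d" u] cross2_swap[of "beta B d" "beta B d'"] by simp
qed

text \<open>The direction from \<open>p + e\<close> to \<open>p + d\<close> has opposite signs on
  the two vectors, while \<open>v\<close> forces parallel ones onto one ray.\<close>

lemma no_parallel_neighbour:
  assumes "d \<in> units" "e \<in> units" "p + d \<in> V" "p + e \<in> V"
    and v: "cross2 v (beta B d) > 0" "cross2 v (beta B e) > 0" "cross2 (beta B d) (beta B e) = 0"
  shows "d = e"
proof (rule ccontr)
  assume "d \<noteq> e"
  then have le: "idot e d \<le> 0" "idot d e \<le> 0" using assms by (auto intro!: idot_units_le)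
  obtain u where u: "\<And>f. f \<in> units \<Longrightarrow> idot (d - e) f > 0 \<Longrightarrow> beta B f \<bullet> u > 0"
    using diff_direction[OF assms(4,3)] by blast
  have "beta B d \<bullet> u > 0" "beta B (- e) \<bullet> u > 0"
    by (rule u; use le in \<open>simp add: assms idot_simps idot_units_self\<close>)+
  then have "cross2 v (beta B e) * (beta B d \<bullet> u) > 0" "cross2 v (beta B d) * (beta B e \<bullet> u) < 0"
    using v by (auto simp: mult_pos_neg)
  then show False
    using pluecker[of "beta B d" "beta B e" v u] v(3) cross2_swap[of v "beta B e"] by simp
qed

lemma corner_unique_next:
  assumes "corner p d e" "corner p d f"
  shows "e = f"
proof -
  note e = cornerD[OF assms(1)] and f = cornerD[OF assms(2)]
  have "\<not> cross2 (beta B e) (beta B f) > 0"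
    using no_neighbour_inside[OF assms(2) e(2,6)] e(3) by blast
  moreover have "\<not> cross2 (beta B f) (beta B e) > 0"
    using no_neighbour_inside[OF assms(1) f(2,6)] f(3) by blast
  ultimately have "cross2 (beta B e) (beta B f) = 0"
    using cross2_swap[of "beta B e" "beta B f"] by linarith
  then show ?thesis using no_parallel_neighbour[OF e(2) f(2) e(6) f(6) e(3) f(3)] by blast
qed

lemma corner_unique_prev:
  assumes "corner p e d" "corner p f d"
  shows "e = f"
proof -
  note e = cornerD[OF assms(1)] and f = cornerD[OF assms(2)]
  have "\<not> cross2 (beta B e) (beta B f) > 0"
    using no_neighbour_inside[OF assms(1) f(1,5)] f(3) by blast
  moreover have "\<not> cross2 (beta B f) (beta B e) > 0"
    using no_neighbour_inside[OF assms(2) e(1,5)] e(3) by blast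
  ultimately have "cross2 (beta B e) (beta B f) = 0"
    using cross2_swap[of "beta B e" "beta B f"] by linarith
  moreover have "cross2 (- beta B d) (beta B e) > 0" "cross2 (- beta B d) (beta B f) > 0"
    using e(3) f(3) cross2_swap[of "beta B d"] by simp_all
  ultimately show ?thesis using no_parallel_neighbour[OF e(1) f(1) e(5) f(5)] by blast
qed

text \<open>Between the two far corners the direction \<open>u\<close> is positive on
  \<open>d\<close>, \<open>d'\<close> and negative on \<open>e\<close>, \<open>e'\<close>, but
  \<open>v\<close> is a positive combination of either pair.\<close>

lemma corner_around_unique:
  assumes c: "corner p d d'" "corner p e e'"
    and v: "cross2 (beta B d) v > 0" "cross2 v (beta B d') > 0" "cross2 (beta B e) v > 0" "cross2 v (beta B e') > 0"
  shows "d = e \<and> d' = e'"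
proof (rule ccontr)
  assume ne: "\<not> ?thesis"
  have 1: "d \<noteq> e" "d' \<noteq> e'" using ne corner_unique_next corner_unique_prev c by blast+
  have 2: "d \<noteq> e'" "d' \<noteq> e" using v cross2_swap[of v "beta B e'"] cross2_swap[of v "beta B d'"] by auto
  note d = cornerD[OF c(1)] and e = cornerD[OF c(2)]
  have le: "idot d e \<le> 0" "idot e d \<le> 0" "idot d' e \<le> 0" "idot e d' \<le> 0" "idot d e' \<le> 0" "idot e' d \<le> 0"
    "idot d' e' \<le> 0" "idot e' d' \<le> 0"
    using 1 2 d(1,2) e(1,2) by (auto intro!: idot_units_le)
  have "p + (d + d') \<in> V" "p + (e + e') \<in> V" using d(7) e(7) by (simp_all add: add.assoc)
  then obtain u where u: "\<And>f. f \<in> units \<Longrightarrow> idot (d + d' - (e + e')) f > 0 \<Longrightarrow> beta B f \<bullet> u > 0"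
    using diff_direction[of p "e + e'" "d + d'"] by blast
  have "beta B d \<bullet> u > 0" "beta B d' \<bullet> u > 0" "beta B (- e) \<bullet> u > 0" "beta B (- e') \<bullet> u > 0"
    by (rule u; use le d(10,11) e(10,11) in \<open>simp add: d(1,2) e(1,2) idot_simps idot_units_self\<close>)+
  then have pos: "cross2 v (beta B d') * (beta B d \<bullet> u) > 0" "cross2 (beta B d) v * (beta B d' \<bullet> u) > 0"
    "cross2 v (beta B e') * (beta B e \<bullet> u) < 0" "cross2 (beta B e) v * (beta B e' \<bullet> u) < 0"
    using v by (auto simp: mult_pos_neg)
  have cr: "cross2 x y * (v \<bullet> u) = cross2 v y * (x \<bullet> u) + cross2 x v * (y \<bullet> u)" for x y
    using arg_cong[OF cramer[of x y v], of "\<lambda>w. w \<bullet> u"] by (simp add: inner_add_left)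
  have "cross2 (beta B d) (beta B d') * (v \<bullet> u) > 0" "cross2 (beta B e) (beta B e') * (v \<bullet> u) < 0"
    unfolding cr using pos by linarith+
  then show False using d(3) e(3) by (simp add: zero_less_mult_iff mult_less_0_iff)
qed

text \<open>The successor of the last edge to the right of \<open>v\<close> must lie to the left of
  \<open>v\<close>; the hypothesis on parallel edges excludes one pointing along \<open>v\<close>
  itself.\<close>

lemma corner_around_exists:
  assumes p: "p \<in> V" and v: "v \<noteq> 0"
    and gen: "\<And>d. d \<in> units \<Longrightarrow> p + d \<in> V \<Longrightarrow> cross2 (beta B d) v = 0 \<Longrightarrow> beta B d \<bullet> v \<le> 0"
  obtains d d' where "corner p d d'" "cross2 (beta B d) v > 0" "cross2 v (beta B d') > 0"
proof -
  let ?N = "{d \<in> units. p + d \<in> V}"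
  have nxt: "\<exists>d'. corner p d d'" if "d \<in> ?N" for d
    using next_corner[OF p, of d] that p unfolding corner_def by blast
  have ray: "\<exists>t>0. x = (- t) *\<^sub>R v" if "cross2 x v = 0" "x \<noteq> 0" "x \<bullet> v \<le> 0" for x
  proof -
    have "(v \<bullet> v) *\<^sub>R x = (x \<bullet> v) *\<^sub>R v"
      using that(1) by (simp add: vec_eq_iff forall_2 cross2_def inner_2) (auto simp: algebra_simps)
    then have x: "x = ((x \<bullet> v) / (v \<bullet> v)) *\<^sub>R v" using v
      by (metis divideR_right inner_eq_zero_iff mult.commute scaleR_scaleR vector_fraction_eq_iff)
    then have "x \<bullet> v \<noteq> 0" using that(2) by auto
    then have "- ((x \<bullet> v) / (v \<bullet> v)) > 0" using that(3) v by (simp add: divide_neg_pos)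
    then show ?thesis using x by (intro exI[of _ "- ((x \<bullet> v) / (v \<bullet> v))"]) simp
  qed
  \<comment> \<open>Otherwise all edges lie strictly to the left of \<open>v\<close>, since an edge
    along \<open>- v\<close> would have its successor on the right; but then the last one has no
    successor.\<close>
  obtain d1 where d1: "d1 \<in> ?N" "cross2 (beta B d1) v > 0"
  proof (cases "\<exists>d\<in>?N. cross2 (beta B d) v > 0")
    case False
    then have le: "cross2 v (beta B d) \<ge> 0" if "d \<in> ?N" for d
      using that cross2_swap[of v "beta B d"] by force
    obtain d0 where "d0 \<in> ?N" using neighbour[OF p] by blast
    have pos: "cross2 v (beta B d) > 0" if d: "d \<in> ?N" for d
    proof (rule ccontr)
      assume "\<not> ?thesis"
      then have "cross2 (beta B d) v = 0" using le[OF d] cross2_swap[of v "beta B d"] by linarith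
      then obtain t where t: "t > 0" "beta B d = (- t) *\<^sub>R v"
        using ray[of "beta B d"] gen[of d] beta_units_nonzero d by auto
      obtain d' where c: "corner p d d'" using nxt[OF d] by blast
      then have "d' \<in> ?N" using cornerD(2,6)[OF c] by simp
      moreover have "cross2 v (beta B d') < 0" using cornerD(3)[OF c] t by (simp add: mult_less_0_iff)
      ultimately show False using le by force
    qed
    obtain d where d: "d \<in> ?N" "\<And>e. e \<in> ?N \<Longrightarrow> cross2 (beta B d) (beta B e) \<le> 0"
    proof -
      have "finite ?N" "?N \<noteq> {}" using \<open>d0 \<in> ?N\<close> by auto
      from last_vector[OF this, of v "beta B"] pos show thesis using that by blast
    qed
    obtain d' where c: "corner p d d'" using nxt[OF d(1)] by blast
    then show thesis using d(2)[of d'] cornerD(2,3,6)[OF c] by auto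
  qed blast
  let ?S = "{d \<in> ?N. cross2 (beta B d) v > 0}"
  have "\<exists>d\<in>?S. \<forall>e\<in>?S. cross2 (beta B d) (beta B e) \<le> 0"
  proof -
    have S: "finite ?S" "?S \<noteq> {}" using d1 by auto
    have neg: "cross2 (- v) (beta B d) > 0" if "d \<in> ?S" for d
      using that cross2_swap[of v "beta B d"] by simp
    obtain d where "d \<in> ?S" "\<And>e. e \<in> ?S \<Longrightarrow> cross2 (beta B d) (beta B e) \<le> 0"
      by (rule last_vector[OF S neg]) auto
    then show ?thesis by blast
  qed
  then obtain d where d: "d \<in> ?S" "\<And>e. e \<in> ?S \<Longrightarrow> cross2 (beta B d) (beta B e) \<le> 0" by blast
  then obtain d' where c: "corner p d d'" using nxt by blast
  note c' = cornerD[OF c]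
  have "\<not> cross2 (beta B d') v > 0" using d(2)[of d'] c'(2,3,6) by auto
  moreover have "cross2 (beta B d') v \<noteq> 0"
  proof
    assume "cross2 (beta B d') v = 0"
    then obtain t where "t > 0" "beta B d' = (- t) *\<^sub>R v"
      using ray[of "beta B d'"] gen[of d'] beta_units_nonzero c'(2,6) by auto
    then show False using c'(3) d(1) by (simp add: mult_less_0_iff zero_less_mult_iff)
  qed
  ultimately have "cross2 v (beta B d') > 0" using cross2_swap[of v "beta B d'"] by linarith
  then show thesis using that c d(1) by blast
qed

section \<open>Squares at crossings and the number of tiles of each type\<close>

definition is_square :: "int ^ 'n \<Rightarrow> 'n \<Rightarrow> 'n \<Rightarrow> bool"
  where "is_square p i j \<longleftrightarrow> i \<noteq> j \<and> p \<in> V \<and> p + stdvec i \<in> V \<and> p + stdvec j \<in> V \<and> p + stdvec i + stdvec j \<in> V"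

lemma is_square_commute: "is_square p i j \<longleftrightarrow> is_square p j i"
  by (auto simp: is_square_def algebra_simps)

lemma is_square_translate: "l \<in> L \<Longrightarrow> is_square (p + l) i j \<longleftrightarrow> is_square p i j"
  using translate_iff[of l p] translate_iff[of l "p + stdvec i"] translate_iff[of l "p + stdvec j"]
    translate_iff[of l "p + stdvec i + stdvec j"]
  by (simp add: is_square_def ac_simps)

text \<open>One diagonal gives a direction with equal signs on \<open>b\<^sub>i\<close> and
  \<open>b\<^sub>j\<close>, the other a direction with opposite signs; parallel vectors do not allow
  both.\<close>

lemma square_transversal:
  assumes "is_square p i j"
  shows "cross2 (bv i) (bv j) \<noteq> 0"
proof
  assume par: "cross2 (bv i) (bv j) = 0"
  have s: "i \<noteq> j" "p + 0 \<in> V" "p + stdvec i \<in> V" "p + stdvec j \<in> V" "p + (stdvec i + stdvec j) \<in> V"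
    using assms by (auto simp: is_square_def add.assoc)
  obtain u where u: "\<And>d. d \<in> units \<Longrightarrow> idot (stdvec i + stdvec j - 0) d > 0 \<Longrightarrow> beta B d \<bullet> u > 0"
    using diff_direction[OF s(2,5)] by blast
  obtain w where w: "\<And>d. d \<in> units \<Longrightarrow> idot (stdvec i - stdvec j) d > 0 \<Longrightarrow> beta B d \<bullet> w > 0"
    using diff_direction[OF s(4,3)] by blast
  have "bv i \<bullet> u > 0" "bv j \<bullet> u > 0" "bv i \<bullet> w > 0" "bv j \<bullet> w < 0"
    using u[of "stdvec i"] u[of "stdvec j"] w[of "stdvec i"] w[of "- stdvec j"] s(1)
    by (auto simp: idot_simps stdvec_nth)
  then have "(bv i \<bullet> u) * (bv j \<bullet> w) < 0" "(bv i \<bullet> w) * (bv j \<bullet> u) > 0" by (auto simp: mult_pos_neg)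
  then show False using binet_cauchy[of "bv i" u "bv j" w] par by simp
qed

text \<open>A direction \<open>d\<close> separating \<open>p\<close> from \<open>q\<close> is also
  separated by any corner of the first square and any corner of the second. Choosing the corners
  gives every combination of signs on \<open>b\<^sub>i\<close> and \<open>b\<^sub>j\<close> together
  with a positive value on \<open>d\<close>, whose vector is a combination of these two.\<close>

lemma crossing_unique:
  assumes p: "is_square p i j" and q: "is_square q i j" and eq: "p $ i = q $ i" "p $ j = q $ j"
  shows "p = q"
proof (rule ccontr)
  assume "p \<noteq> q"
  then obtain d where d: "d \<in> units" "idot (p - q) d > 0" using exists_unit_idot_pos[of "p - q"] by auto
  have ij: "i \<noteq> j" using p by (simp add: is_square_def)
  have dn: "d \<noteq> stdvec i" "d \<noteq> - stdvec i" "d \<noteq> stdvec j" "d \<noteq> - stdvec j"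
    using d(2) eq by (auto simp: idot_simps)
  have cr: "cross2 (bv i) (bv j) \<noteq> 0" using square_transversal[OF p] .
  have quad: "\<exists>u. bv i \<bullet> u * s > 0 \<and> bv j \<bullet> u * t > 0 \<and> beta B d \<bullet> u > 0"
    if st: "s = 1 \<or> s = -1" "t = 1 \<or> t = -1" for s t :: real
  proof -
    define x y where "x = (if s = 1 then stdvec i else 0) + (if t = 1 then stdvec j else 0)"
      and "y = (if s = 1 then 0 else stdvec i) + (if t = 1 then 0 else stdvec j)"
    have "p + x \<in> V" "q + y \<in> V" using p q st by (auto simp: x_def y_def is_square_def add.assoc)
    then obtain u where u: "\<And>d. d \<in> units \<Longrightarrow> idot ((p + x) - (q + y)) d > 0 \<Longrightarrow> beta B d \<bullet> u > 0"
      using direction by metis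
    have e0: "idot (stdvec i) d = 0" "idot (stdvec j) d = 0"
      using d(1) dn by (auto intro!: idot_units_other simp: minus_equation_iff[of d])
    then have "idot x d = 0" "idot y d = 0" by (auto simp: x_def y_def idot_simps)
    then have "beta B d \<bullet> u > 0" using u[OF d(1)] d(2) by (simp add: idot_simps)
    moreover have "bv i \<bullet> u * s > 0"
      using st u[of "stdvec i"] u[of "- stdvec i"] ij eq by (auto simp: idot_simps x_def y_def stdvec_nth)
    moreover have "bv j \<bullet> u * t > 0"
      using st u[of "stdvec j"] u[of "- stdvec j"] ij eq by (auto simp: idot_simps x_def y_def stdvec_nth)
    ultimately show ?thesis by blast
  qed
  define \<alpha> \<beta> where "\<alpha> = cross2 (beta B d) (bv j) / cross2 (bv i) (bv j)"
    and "\<beta> = cross2 (bv i) (beta B d) / cross2 (bv i) (bv j)"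
  have "cross2 (bv i) (bv j) *\<^sub>R beta B d = cross2 (bv i) (bv j) *\<^sub>R (\<alpha> *\<^sub>R bv i + \<beta> *\<^sub>R bv j)"
    using cramer[of "bv i" "bv j" "beta B d"] cr by (simp add: \<alpha>_def \<beta>_def scaleR_add_right)
  then have bd: "beta B d = \<alpha> *\<^sub>R bv i + \<beta> *\<^sub>R bv j" using cr by simp
  \<comment> \<open>The signs are chosen against the coefficients of \<open>beta B d\<close>, so
    that neither summand can be positive.\<close>
  obtain u where u: "bv i \<bullet> u * (if \<alpha> > 0 then -1 else 1) > 0" "bv j \<bullet> u * (if \<beta> > 0 then -1 else 1) > 0" "beta B d \<bullet> u > 0"
  proof -
    have "\<exists>u. bv i \<bullet> u * (if \<alpha> > 0 then -1 else 1) > 0 \<and> bv j \<bullet> u * (if \<beta> > 0 then -1 else 1) > 0 \<and> beta B d \<bullet> u > 0"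
      by (rule quad) auto
    then show thesis using that by blast
  qed
  have "\<alpha> * (bv i \<bullet> u) \<le> 0" "\<beta> * (bv j \<bullet> u) \<le> 0"
    using u(1,2) by (auto simp: mult_le_0_iff not_less split: if_splits)
  then have "beta B d \<bullet> u \<le> 0" unfolding bd by (simp add: inner_add_left)
  then show False using u(3) by simp
qed

lemma square_vertices_doubleton:
  "i \<noteq> j \<Longrightarrow> square_vertices (p, {i, j}) = {p, p + stdvec i, p + stdvec j, p + stdvec i + stdvec j}"
proof -
  assume ij: "i \<noteq> j"
  have "square_vertices (p, {i, j}) = (\<lambda>A. p + (\<Sum>i\<in>A. stdvec i)) ` Pow {i, j}"
    by (auto simp: square_vertices_def)
  then show ?thesis using ij by (auto simp: Pow_insert image_Un add.assoc)
qed

lemma square_vertices_subset_iff: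
  "i \<noteq> j \<Longrightarrow> square_vertices (p, {i, j}) \<subseteq> V \<longleftrightarrow> is_square p i j"
  by (auto simp: square_vertices_doubleton is_square_def)

lemma squares_iff: "(p, T) \<in> squares V \<longleftrightarrow> (\<exists>i j. T = {i, j} \<and> is_square p i j)"
proof
  assume "(p, T) \<in> squares V"
  then show "\<exists>i j. T = {i, j} \<and> is_square p i j"
    unfolding squares_def using square_vertices_subset_iff by blast
next
  assume "\<exists>i j. T = {i, j} \<and> is_square p i j"
  then obtain i j where "T = {i, j}" "is_square p i j" by blast
  moreover from this(2) have "i \<noteq> j" by (simp add: is_square_def)
  ultimately show "(p, T) \<in> squares V"
    unfolding squares_def using square_vertices_subset_iff by blast
qed

lemma tile_type_orbit [simp]: "tile_type (square_orbit L (p, T)) = T"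
proof -
  have "square_orbit L (p, T) = (\<lambda>l. (p + l, T)) ` L" by (auto simp: square_orbit_def)
  moreover have "L \<noteq> {}" using zero_in_L by blast
  ultimately have "snd ` square_orbit L (p, T) = {T}" by (simp add: image_image image_constant_conv)
  then show ?thesis by (simp add: tile_type_def)
qed

lemma square_orbit_eq_iff:
  "square_orbit L (p, T) = square_orbit L (q, S) \<longleftrightarrow> T = S \<and> p - q \<in> L"
proof
  assume eq: "square_orbit L (p, T) = square_orbit L (q, S)"
  have "(p, T) \<in> square_orbit L (p, T)" using zero_in_L by (force simp: square_orbit_def)
  then show "T = S \<and> p - q \<in> L" unfolding eq by (auto simp: square_orbit_def)
next
  assume a: "T = S \<and> p - q \<in> L"
  have "\<exists>l'. p + l = q + l' \<and> l' \<in> L" "\<exists>l'. q + l = p + l' \<and> l' \<in> L" if "l \<in> L" for l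
    using add_in_L[OF _ that, of "p - q"] add_in_L[OF _ that, of "q - p"] a minus_in_L[of "p - q"]
    by (intro exI[of _ "p - q + l"] exI[of _ "q - p + l"]; simp)+
  then show "square_orbit L (p, T) = square_orbit L (q, S)"
    using a by (fastforce simp: square_orbit_def)
qed

text \<open>Every pair of integers \<open>(p $ i, p $ j)\<close> belongs to exactly one square of
  the type. Translations act on these pairs through the integer matrix with rows
  \<open>b\<^sub>i\<close> and \<open>b\<^sub>j\<close>, whose image has index
  \<open>|det|\<close>.\<close>

lemma tile_of_type_count:
  assumes ij: "i \<noteq> j"
  shows "finite {e \<in> tiles L V. tile_type e = {i, j}} \<and>
    real (card {e \<in> tiles L V. tile_type e = {i, j}}) = \<bar>cross2 (bv i) (bv j)\<bar>"
proof -
  let ?T = "{e \<in> tiles L V. tile_type e = {i, j}}"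
  have T: "?T = {square_orbit L (p, {i, j}) | p. is_square p i j}"
  proof (intro equalityI subsetI)
    fix e assume "e \<in> ?T"
    then obtain p S where e: "e = square_orbit L (p, S)" "(p, S) \<in> squares V" "S = {i, j}"
      by (auto simp: tiles_def)
    then have "is_square p i j" by (auto simp: squares_iff doubleton_eq_iff is_square_commute)
    then show "e \<in> {square_orbit L (p, {i, j}) | p. is_square p i j}" using e by blast
  next
    fix e assume "e \<in> {square_orbit L (p, {i, j}) | p. is_square p i j}"
    then obtain p where p: "e = square_orbit L (p, {i, j})" "is_square p i j" by blast
    then have "(p, {i, j}) \<in> squares V" by (auto simp: squares_iff)
    then show "e \<in> ?T" using p(1) by (auto simp: tiles_def)
  qed
  show ?thesis
  proof (cases "cross2 (bv i) (bv j) = 0")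
    case True
    then have "?T = {}" unfolding T using square_transversal by blast
    then show ?thesis using True by (metis abs_zero card.empty finite.emptyI of_nat_0)
  next
    case False
    let ?D = "B $ 1 $ i * B $ 2 $ j - B $ 2 $ i * B $ 1 $ j"
    have cr: "cross2 (bv i) (bv j) = of_int ?D" by (simp add: cross2_def bvec_nth)
    then have "?D \<noteq> 0" using False by (metis of_int_0)
    then obtain R where R: "finite R" "card R = nat \<bar>?D\<bar>"
      "\<And>k l. \<exists>r\<in>R. \<exists>x y. k - fst r = B $ 1 $ i * x + B $ 2 $ i * y \<and> l - snd r = B $ 1 $ j * x + B $ 2 $ j * y"
      "\<And>r r' x y. r \<in> R \<Longrightarrow> r' \<in> R \<Longrightarrow> fst r - fst r' = B $ 1 $ i * x + B $ 2 $ i * y \<Longrightarrow>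
        snd r - snd r' = B $ 1 $ j * x + B $ 2 $ j * y \<Longrightarrow> r = r'"
      using lattice_index[of "B $ 1 $ i" "B $ 2 $ j" "B $ 2 $ i" "B $ 1 $ j"] by blast
    have "\<exists>p. is_square p i j \<and> p $ i = fst r \<and> p $ j = snd r" for r :: "int \<times> int"
      using crossing[OF False, of "fst r" "snd r"] ij unfolding is_square_def by metis
    then obtain f where f: "\<And>r. is_square (f r) i j" "\<And>r. f r $ i = fst r" "\<And>r. f r $ j = snd r" by metis
    have "bij_betw (\<lambda>r. square_orbit L (f r, {i, j})) R ?T"
      unfolding bij_betw_def
    proof (intro conjI inj_onI equalityI subsetI)
      fix r r' assume r: "r \<in> R" "r' \<in> R" "square_orbit L (f r, {i, j}) = square_orbit L (f r', {i, j})"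
      then have "f r - f r' \<in> L" by (simp add: square_orbit_eq_iff)
      then obtain x y where "\<forall>m. (f r - f r') $ m = x * B $ 1 $ m + y * B $ 2 $ m" unfolding L_iff by blast
      then have xy: "(f r - f r') $ m = B $ 1 $ m * x + B $ 2 $ m * y" for m by (simp add: algebra_simps)
      show "r = r'" using R(4)[OF r(1,2), of x y] xy[of i] xy[of j] f by simp
    next
      fix e assume "e \<in> (\<lambda>r. square_orbit L (f r, {i, j})) ` R"
      then show "e \<in> ?T" unfolding T using f(1) by blast
    next
      fix e assume "e \<in> ?T"
      then obtain p where p: "e = square_orbit L (p, {i, j})" "is_square p i j" unfolding T by blast
      obtain r x y where r: "r \<in> R" "p $ i - fst r = B $ 1 $ i * x + B $ 2 $ i * y" "p $ j - snd r = B $ 1 $ j * x + B $ 2 $ j * y"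
        using R(3)[of "p $ i" "p $ j"] by blast
      define l :: "int ^ 'n" where "l = (\<chi> m. x * B $ 1 $ m + y * B $ 2 $ m)"
      have l: "l \<in> L" unfolding L_iff l_def by auto
      have "is_square (p + - l) i j" using is_square_translate[of "- l"] l p(2) by simp
      moreover have "(p + - l) $ i = f r $ i" "(p + - l) $ j = f r $ j" using r(2,3) f by (simp_all add: l_def algebra_simps)
      ultimately have "p + - l = f r" using crossing_unique f(1) by blast
      then have "p - f r = l" by (simp add: algebra_simps)
      then have "e = square_orbit L (f r, {i, j})" using p(1) l by (simp add: square_orbit_eq_iff)
      then show "e \<in> (\<lambda>r. square_orbit L (f r, {i, j})) ` R" using r(1) by blast
    qed
    then have "finite ?T" "card ?T = card R" using R(1) bij_betw_finite[of _ R ?T] bij_betw_same_card[of _ R ?T] by auto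
    then show ?thesis using R(2) cr by simp
  qed
qed

lemma finite_tiles: "finite (tiles L V)"
proof -
  have "tiles L V \<subseteq> (\<Union>(i, j)\<in>{(i, j). i \<noteq> j}. {e \<in> tiles L V. tile_type e = {i, j}})"
  proof
    fix e assume e: "e \<in> tiles L V"
    then obtain p i j where "e = square_orbit L (p, {i, j})" "is_square p i j"
      by (auto simp: tiles_def squares_iff)
    then have "i \<noteq> j" "tile_type e = {i, j}" by (auto simp: is_square_def)
    then show "e \<in> (\<Union>(i, j)\<in>{(i, j). i \<noteq> j}. {e \<in> tiles L V. tile_type e = {i, j}})" using e by blast
  qed
  moreover have "finite (\<Union>(i, j)\<in>{(i, j). i \<noteq> j}. {e \<in> tiles L V. tile_type e = {i, j}})"
    using tile_of_type_count by (intro finite_UN_I) auto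
  ultimately show ?thesis by (rule finite_subset)
qed

end

section \<open>The secondary fan\<close>

lemma parallel_same_side:
  assumes "cross2 x y = 0" "cross2 w x > 0" "cross2 w y > 0"
  obtains t where "t > 0" "x = t *\<^sub>R y"
proof -
  have "cross2 w y *\<^sub>R x = cross2 w x *\<^sub>R y"
    using assms(1) by (simp add: vec_eq_iff forall_2 cross2_def) (auto simp: algebra_simps)
  then have "x = (cross2 w x / cross2 w y) *\<^sub>R y"
    using assms(3) by (metis divideR_right less_irrefl mult.commute scaleR_scaleR vector_fraction_eq_iff)
  then show thesis using that[of "cross2 w x / cross2 w y"] assms by simp
qed

lemma in_ray_iff: "v \<in> ray x \<longleftrightarrow> (\<exists>t\<ge>0. v = t *\<^sub>R x)"
  by (auto simp: ray_def)

lemma sector_commute: "sector x y = sector y x"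
  unfolding sector_def by (auto intro: exI) (metis add.commute)+

lemma sector_iff:
  assumes "cross2 x y > 0"
  shows "z \<in> sector x y \<longleftrightarrow> cross2 x z \<ge> 0 \<and> cross2 z y \<ge> 0"
proof
  assume "z \<in> sector x y"
  then show "cross2 x z \<ge> 0 \<and> cross2 z y \<ge> 0"
    using assms by (auto simp: sector_def cross2_add)
next
  assume z: "cross2 x z \<ge> 0 \<and> cross2 z y \<ge> 0"
  have "cross2 x y *\<^sub>R z = cross2 x y *\<^sub>R ((cross2 z y / cross2 x y) *\<^sub>R x + (cross2 x z / cross2 x y) *\<^sub>R y)"
    using assms cramer[of x y z] by (simp add: scaleR_add_right)
  then have "z = (cross2 z y / cross2 x y) *\<^sub>R x + (cross2 x z / cross2 x y) *\<^sub>R y"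
    using assms by simp
  then show "z \<in> sector x y" unfolding sector_def using z assms by force
qed

context lattice_plane
begin

definition off_rays :: "real ^ 2 \<Rightarrow> bool"
  where "off_rays v \<longleftrightarrow> (\<forall>i. v \<notin> ray (bv i))"

text \<open>The third condition keeps the angle from \<open>b\<^sub>i\<close> to
  \<open>b\<^sub>j\<close> below pi, so that \<open>v\<close> is interior to their sector.\<close>

definition between :: "'n \<Rightarrow> real ^ 2 \<Rightarrow> 'n \<Rightarrow> bool"
  where "between i v j \<longleftrightarrow> cross2 (bv i) v > 0 \<and> cross2 v (bv j) > 0 \<and> cross2 (bv i) (bv j) > 0"

text \<open>Only the open sector has to be free of vectors; several indices may share a boundary
  ray.\<close>

definition adjacent :: "'n \<Rightarrow> 'n \<Rightarrow> bool"
  where "adjacent i j \<longleftrightarrow> cross2 (bv i) (bv j) > 0 \<and>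
    (\<forall>m. \<not> (cross2 (bv i) (bv m) > 0 \<and> cross2 (bv m) (bv j) > 0))"

lemma off_raysD: "off_rays v \<Longrightarrow> t \<ge> 0 \<Longrightarrow> v \<noteq> t *\<^sub>R bv i"
  unfolding off_rays_def in_ray_iff by blast

lemma off_rays_nonzero: "off_rays v \<Longrightarrow> v \<noteq> 0"
  by (auto simp: off_rays_def in_ray_iff)

lemma off_rays_not_parallel:
  assumes "off_rays v" "cross2 w v > 0" "cross2 w (bv i) > 0"
  shows "cross2 v (bv i) \<noteq> 0"
proof
  assume "cross2 v (bv i) = 0"
  then obtain t where "t > 0" "v = t *\<^sub>R bv i" using parallel_same_side assms(2,3) by blast
  then show False using off_raysD[OF assms(1), of t i] by simp
qed

text \<open>Off the rays both coefficients of \<open>v\<close> are non-zero. For parallel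
  \<open>b\<^sub>i\<close> and \<open>b\<^sub>j\<close> a combination with nonnegative coefficients
  would lie on one of their two rays.\<close>

lemma in_sector_off_rays:
  assumes v: "off_rays v"
  shows "v \<in> sector (bv i) (bv j) \<longleftrightarrow> between i v j \<or> between j v i"
proof
  assume "v \<in> sector (bv i) (bv j)"
  then obtain s t where st: "s \<ge> 0" "t \<ge> 0" "v = s *\<^sub>R bv i + t *\<^sub>R bv j" by (auto simp: sector_def)
  have "s \<noteq> 0" "t \<noteq> 0" using st off_raysD[OF v, of t j] off_raysD[OF v, of s i] by auto
  then have pos: "s > 0" "t > 0" using st by auto
  have "cross2 (bv i) (bv j) \<noteq> 0"
  proof
    assume par: "cross2 (bv i) (bv j) = 0"
    obtain w where w: "cross2 (bv i) w \<noteq> 0" using exists_cross by blast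
    have ij: "cross2 (bv i) w *\<^sub>R bv j = cross2 (bv j) w *\<^sub>R bv i"
      using par by (simp add: vec_eq_iff forall_2 cross2_def) (auto simp: algebra_simps)
    define c where "c = cross2 (bv j) w / cross2 (bv i) w"
    have j: "bv j = c *\<^sub>R bv i"
      using ij w unfolding c_def
      by (metis divideR_right mult.commute scaleR_scaleR vector_fraction_eq_iff)
    then have c0: "c \<noteq> 0" using bv_nonzero[of j] by auto
    have vi: "v = (s + t * c) *\<^sub>R bv i" using st(3) j by (simp add: scaleR_add_left)
    then have lt: "s + t * c < 0" using off_raysD[OF v, of "s + t * c" i] by force
    then have "t * c < 0" using pos by linarith
    then have "c < 0" using pos by (simp add: mult_less_0_iff)
    then have "(s + t * c) / c \<ge> 0" using lt by (simp add: divide_nonpos_neg)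
    moreover have "v = ((s + t * c) / c) *\<^sub>R bv j" using vi j c0 by simp
    ultimately show False using off_raysD[OF v] by blast
  qed
  then show "between i v j \<or> between j v i"
    using pos st(3) cross2_swap[of "bv j" "bv i"] by (auto simp: between_def cross2_add zero_less_mult_iff mult_less_0_iff neq_iff)
next
  assume "between i v j \<or> between j v i"
  then show "v \<in> sector (bv i) (bv j)"
  proof
    assume "between i v j"
    then show ?thesis by (simp add: between_def sector_iff)
  next
    assume "between j v i"
    then show ?thesis unfolding sector_commute[of "bv i" "bv j"] by (simp add: between_def sector_iff)
  qed
qed

text \<open>No point of \<open>K\<close> lies on the boundary of the sector, so the connected set
  \<open>K\<close> is inside the open sector or outside the closed one. A single point therefore
  decides, and cones can be replaced by sample points \<open>v\<close>.\<close>

lemma component_in_sector_iff: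
  assumes K: "K \<in> components (UNIV - (\<Union>i. ray (bv i)))" and v: "v \<in> K"
  shows "closure K \<subseteq> sector (bv i) (bv j) \<longleftrightarrow> v \<in> sector (bv i) (bv j)"
proof
  assume "closure K \<subseteq> sector (bv i) (bv j)"
  then show "v \<in> sector (bv i) (bv j)" using v closure_subset by blast
next
  assume "v \<in> sector (bv i) (bv j)"
  have off: "off_rays z" if "z \<in> K" for z
    using in_components_subset[OF K] that by (auto simp: off_rays_def)
  have main: "closure K \<subseteq> sector (bv i) (bv j)" if b: "between i v j" for i j
  proof -
    define A where "A = {z. cross2 (bv i) z > 0} \<inter> {z. cross2 z (bv j) > 0}"
    define S where "S = {z. cross2 (bv i) z \<ge> 0} \<inter> {z. cross2 z (bv j) \<ge> 0}"
    have pos: "cross2 (bv i) (bv j) > 0" using b by (simp add: between_def)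
    have S: "S = sector (bv i) (bv j)" using sector_iff[OF pos] by (auto simp: S_def)
    have "open A" unfolding A_def cross2_def
      by (intro open_Int open_Collect_less continuous_intros)
    moreover have closed: "closed S" unfolding S_def cross2_def
      by (intro closed_Int closed_Collect_le continuous_intros)
    moreover have "K \<subseteq> A \<union> (- S)"
    proof
      fix z assume z: "z \<in> K"
      have "between i z j \<or> between j z i" if "z \<in> S"
        using in_sector_off_rays[OF off[OF z], of i j] that S by blast
      moreover have "\<not> between j z i" using pos cross2_swap[of "bv i" "bv j"] by (simp add: between_def)
      ultimately show "z \<in> A \<union> (- S)" by (auto simp: A_def between_def)
    qed
    moreover have "A \<inter> (- S) \<inter> K = {}" by (auto simp: A_def S_def)
    moreover have "connected K" using in_components_connected[OF K] .
    ultimately have "A \<inter> K = {} \<or> (- S) \<inter> K = {}" by (intro connectedD) auto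
    moreover have "v \<in> A \<inter> K" using b v by (simp add: A_def between_def)
    ultimately have "K \<subseteq> S" by blast
    then show ?thesis using closure_minimal closed S by blast
  qed
  show "closure K \<subseteq> sector (bv i) (bv j)"
    using in_sector_off_rays[OF off[OF v], of i j] \<open>v \<in> sector (bv i) (bv j)\<close> main[of i j] main[of j i]
      sector_commute[of "bv i" "bv j"] by blast
qed

lemma L_of_component:
  assumes K: "K \<in> components (UNIV - (\<Union>i. ray (bv i)))" and v: "v \<in> K"
  shows "off_rays v" "L_of_cone B (closure K) = {{i, j} | i j. between i v j}"
proof -
  show off: "off_rays v"
    using in_components_subset[OF K] v by (auto simp: off_rays_def)
  show "L_of_cone B (closure K) = {{i, j} | i j. between i v j}"
  proof (intro equalityI subsetI)
    fix T assume "T \<in> L_of_cone B (closure K)"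
    then obtain i j where "T = {i, j}" "v \<in> sector (bv i) (bv j)"
      unfolding L_of_cone_def component_in_sector_iff[OF K v] by blast
    then show "T \<in> {{i, j} | i j. between i v j}"
      using in_sector_off_rays[OF off, of i j] insert_commute[of i j "{}"] by blast
  next
    fix T assume "T \<in> {{i, j} | i j. between i v j}"
    then obtain i j where T: "T = {i, j}" "between i v j" by blast
    then have "i \<noteq> j" "v \<in> sector (bv i) (bv j)"
      using in_sector_off_rays[OF off, of i j] by (auto simp: between_def)
    then show "T \<in> L_of_cone B (closure K)"
      unfolding L_of_cone_def component_in_sector_iff[OF K v] using T(1) by blast
  qed
qed

lemma max_cone_obtain:
  assumes "C \<in> max_cones B"
  obtains v where "off_rays v" "L_of_cone B C = {{i, j} | i j. between i v j}"
proof -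
  obtain K where K: "K \<in> components (UNIV - (\<Union>i. ray (bv i)))" "C = closure K"
    using assms by (auto simp: max_cones_def)
  then obtain v where "v \<in> K" using in_components_nonempty by blast
  then show thesis using that L_of_component K by blast
qed

lemma max_cone_exists:
  assumes v: "off_rays v"
  obtains C where "C \<in> max_cones B" "L_of_cone B C = {{i, j} | i j. between i v j}"
proof -
  let ?U = "UNIV - (\<Union>i. ray (bv i))"
  have "v \<in> ?U" using v by (auto simp: off_rays_def)
  then have "connected_component_set ?U v \<in> components ?U" "v \<in> connected_component_set ?U v"
    by (auto simp: components_def connected_component_refl)
  then show thesis using that[of "closure (connected_component_set ?U v)"] L_of_component(2)
    unfolding max_cones_def by blast
qed

text \<open>Take the last \<open>b\<^sub>i\<close> to the right of \<open>v\<close>, then the first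
  \<open>b\<^sub>j\<close> to the left of \<open>b\<^sub>i\<close>. One inequality is weak because
  \<open>v\<close> may lie on a ray.\<close>

lemma adjacent_cover:
  assumes v: "v \<noteq> 0"
  obtains i j where "adjacent i j" "cross2 (bv i) v > 0" "cross2 v (bv j) \<ge> 0"
proof -
  let ?S = "{m. cross2 (bv m) v > 0}"
  have "?S \<noteq> {}" using exists_cross_neg[OF v] by blast
  moreover have "cross2 (- v) (bv m) > 0" if "m \<in> ?S" for m
    using that cross2_swap[of v "bv m"] by simp
  ultimately obtain i where i: "i \<in> ?S" "\<And>m. m \<in> ?S \<Longrightarrow> cross2 (bv i) (bv m) \<le> 0"
    using last_vector[of ?S "- v" bv] by (metis finite_class.finite_code)
  let ?T = "{m. cross2 (bv i) (bv m) > 0}"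
  have "?T \<noteq> {}" using exists_cross_pos[OF bv_nonzero] by blast
  then obtain j where j: "j \<in> ?T" "\<And>m. m \<in> ?T \<Longrightarrow> cross2 (bv j) (bv m) \<ge> 0"
    using first_vector[of ?T "bv i" bv] by (metis finite_class.finite_code mem_Collect_eq)
  have "adjacent i j"
    unfolding adjacent_def using j cross2_swap[of "bv j"] by force
  moreover have "cross2 v (bv j) \<ge> 0"
    using i(2)[of j] j(1) cross2_swap[of v "bv j"] by force
  ultimately show thesis using that i(1) by blast
qed

lemma off_rays_adjacent:
  assumes "off_rays v"
  obtains i j where "adjacent i j" "between i v j"
proof -
  obtain i j where ij: "adjacent i j" "cross2 (bv i) v > 0" "cross2 v (bv j) \<ge> 0"
    using adjacent_cover[OF off_rays_nonzero[OF assms]] by blast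
  moreover have "cross2 v (bv j) \<noteq> 0"
    using off_rays_not_parallel[OF assms ij(2)] ij(1) by (simp add: adjacent_def)
  ultimately show thesis using that by (simp add: between_def adjacent_def)
qed

text \<open>A sample point of the cone between adjacent vectors: a \<open>b\<^sub>m\<close> on its
  ray would lie strictly inside the sector.\<close>

lemma adjacent_off_rays:
  assumes "adjacent i j"
  shows "off_rays (bv i + bv j)" "between i (bv i + bv j) j"
proof -
  have ij: "cross2 (bv i) (bv j) > 0" using assms by (simp add: adjacent_def)
  show "off_rays (bv i + bv j)"
    unfolding off_rays_def in_ray_iff
  proof (intro allI notI, elim exE conjE)
    fix m t assume t: "t \<ge> 0" "bv i + bv j = t *\<^sub>R bv m"
    have "t * cross2 (bv i) (bv m) = cross2 (bv i) (bv j)" "t * cross2 (bv m) (bv j) = cross2 (bv i) (bv j)"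
      using arg_cong[OF t(2), of "cross2 (bv i)"] arg_cong[OF t(2), of "\<lambda>x. cross2 x (bv j)"]
      by (simp_all only: cross2_add cross2_simps)
    then have "t * cross2 (bv i) (bv m) > 0" "t * cross2 (bv m) (bv j) > 0" using ij by simp_all
    then have "cross2 (bv i) (bv m) > 0" "cross2 (bv m) (bv j) > 0"
      using t(1) by (simp_all add: zero_less_mult_iff)
    then show False using assms unfolding adjacent_def by blast
  qed
  show "between i (bv i + bv j) j" using ij by (simp add: between_def cross2_add)
qed

lemma adjacent_extreme:
  assumes "adjacent i j" "between i v j"
  shows "\<not> (cross2 (bv i) (bv m) > 0 \<and> cross2 (bv m) v > 0)"
    "\<not> (cross2 v (bv m) > 0 \<and> cross2 (bv m) (bv j) > 0)"
proof -
  have b: "cross2 (bv i) v > 0" "cross2 v (bv j) > 0" "cross2 (bv i) (bv j) > 0"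
    using assms(2) by (auto simp: between_def)
  have c: "cross2 (bv i) (bv j) * cross2 (bv m) v = cross2 v (bv j) * cross2 (bv m) (bv i) + cross2 (bv i) v * cross2 (bv m) (bv j)"
    using arg_cong[OF cramer[of "bv i" "bv j" v], of "cross2 (bv m)"] by (simp add: cross2_add)
  have no: "\<not> (cross2 (bv i) (bv m) > 0 \<and> cross2 (bv m) (bv j) > 0)"
    using assms(1) by (auto simp: adjacent_def)
  show "\<not> (cross2 (bv i) (bv m) > 0 \<and> cross2 (bv m) v > 0)"
  proof
    assume a: "cross2 (bv i) (bv m) > 0 \<and> cross2 (bv m) v > 0"
    then have "cross2 v (bv j) * cross2 (bv m) (bv i) < 0" "cross2 (bv i) (bv j) * cross2 (bv m) v > 0"
      using b cross2_swap[of "bv i" "bv m"] by (simp_all add: mult_pos_neg)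
    then have "cross2 (bv i) v * cross2 (bv m) (bv j) > 0" using c by linarith
    then show False using a no b by (simp add: zero_less_mult_iff)
  qed
  show "\<not> (cross2 v (bv m) > 0 \<and> cross2 (bv m) (bv j) > 0)"
  proof
    assume a: "cross2 v (bv m) > 0 \<and> cross2 (bv m) (bv j) > 0"
    then have "cross2 (bv i) v * cross2 (bv m) (bv j) > 0" "cross2 (bv i) (bv j) * cross2 (bv m) v < 0"
      using b cross2_swap[of "bv m" v] by (simp_all add: mult_pos_neg)
    then have "cross2 v (bv j) * cross2 (bv m) (bv i) < 0" using c by linarith
    then have "cross2 (bv i) (bv m) > 0" using b cross2_swap[of "bv i" "bv m"] by (simp add: mult_less_0_iff)
    then show False using a no by blast
  qed
qed

end

section \<open>Perfect surfaces and their matchings\<close>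

definition stdsum :: "'n::finite set \<Rightarrow> int ^ 'n"
  where "stdsum T = (\<Sum>i\<in>T. stdvec i)"

lemma stdsum_doubleton: "i \<noteq> j \<Longrightarrow> stdsum {i, j} = stdvec i + stdvec j"
  by (simp add: stdsum_def)

lemma stdsum_nth: "stdsum T $ m = (if m \<in> T then 1 else 0)"
  by (simp add: stdsum_def sum_component stdvec_nth)

lemma ex1_image_iff:
  assumes "\<And>x y. g x = g y \<Longrightarrow> x = y"
  shows "(\<exists>!e. \<exists>x. e = g x \<and> g x \<in> P) \<longleftrightarrow> (\<exists>!x. g x \<in> P)"
  using assms by blast

context lattice_plane
begin

lemma orbit_eq_iff: "orbit L p = orbit L q \<longleftrightarrow> p - q \<in> L"
proof
  assume "orbit L p = orbit L q"
  moreover have "p \<in> orbit L p" by (simp add: mem_orbit_iff)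
  ultimately show "p - q \<in> L" by (simp add: mem_orbit_iff)
next
  assume pq: "p - q \<in> L"
  have "r - p \<in> L \<longleftrightarrow> r - q \<in> L" for r
    using add_in_L[of "r - p" "p - q"] diff_in_L[of "r - q" "p - q"] pq by auto
  then show "orbit L p = orbit L q" by (auto simp: mem_orbit_iff)
qed

text \<open>Supplies the hypothesis of \<open>corner_around_exists\<close> on edges parallel to
  \<open>v\<close>: off the rays, such a vector can only point away from \<open>v\<close>.\<close>

lemma off_rays_inner:
  assumes v: "off_rays v" and "cross2 (bv i) v = 0"
  shows "bv i \<bullet> v \<le> 0"
proof (rule ccontr)
  assume pos: "\<not> ?thesis"
  have "(bv i \<bullet> bv i) *\<^sub>R v = (bv i \<bullet> v) *\<^sub>R bv i"
    using assms(2) by (simp add: vec_eq_iff forall_2 cross2_def inner_2) (auto simp: algebra_simps)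
  then have "(1 / (bv i \<bullet> bv i)) *\<^sub>R ((bv i \<bullet> bv i) *\<^sub>R v) = (1 / (bv i \<bullet> bv i)) *\<^sub>R ((bv i \<bullet> v) *\<^sub>R bv i)"
    by simp
  then have "v = ((bv i \<bullet> v) / (bv i \<bullet> bv i)) *\<^sub>R bv i" by simp
  moreover have "(bv i \<bullet> v) / (bv i \<bullet> bv i) \<ge> 0" using pos by simp
  ultimately show False using off_raysD[OF v] by blast
qed

lemma sum_in_L: "(\<And>x. x \<in> A \<Longrightarrow> f x \<in> L) \<Longrightarrow> sum f A \<in> L"
  by (induction A rule: infinite_finite_induct) (auto intro: add_in_L)

end

context pseudo_surface
begin

lemma corner_prev_exists:
  assumes "p \<in> V" "d \<in> units" "p + d \<in> V"
  obtains d' where "corner p d' d"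
proof -
  obtain d' where d': "d' \<in> units" "cross2 (beta B (- d)) (beta B d') > 0" "p + d + d' \<in> V" "p + d' \<in> V"
    using next_corner[of "p + d" "- d"] assms by auto
  then have "corner p d' d" using assms cross2_swap[of "beta B d'" "beta B d"]
    by (simp add: corner_def ac_simps)
  then show thesis by (rule that)
qed

lemma corner_next_exists:
  assumes "p \<in> V" "d \<in> units" "p + d \<in> V"
  obtains d' where "corner p d d'"
  using next_corner[OF assms] assms unfolding corner_def by metis

text \<open>An edge between \<open>v\<close> and \<open>d'\<close> would lie inside the corner, and
  one on the ray of \<open>d'\<close> equals \<open>d'\<close>.\<close>

lemma neighbour_beyond_corner:
  assumes c: "corner p d d'" and v: "cross2 (beta B d) v > 0" "cross2 v (beta B d') > 0"
    and e: "e \<in> units" "p + e \<in> V" "cross2 v (beta B e) > 0"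
  shows "e = d' \<or> cross2 (beta B d') (beta B e) > 0"
proof (rule ccontr)
  assume neg: "\<not> ?thesis"
  note c' = cornerD[OF c]
  have "cross2 (beta B d') (beta B e) \<noteq> 0"
    using neg no_parallel_neighbour[OF c'(2) e(1) c'(6) e(2) v(2) e(3)] by metis
  then have ed: "cross2 (beta B e) (beta B d') > 0"
    using neg cross2_swap[of "beta B e" "beta B d'"] by linarith
  have "cross2 v (beta B d') * cross2 (beta B d) (beta B e) =
      cross2 (beta B e) (beta B d') * cross2 (beta B d) v + cross2 v (beta B e) * cross2 (beta B d) (beta B d')"
    using arg_cong[OF cramer[of v "beta B d'" "beta B e"], of "cross2 (beta B d)"]
    by (simp add: cross2_add)
  also have "\<dots> > 0" using ed v e(3) c'(3) by (simp add: add_pos_pos)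
  finally have "cross2 (beta B d) (beta B e) > 0" using v(2) by (simp add: zero_less_mult_iff)
  then show False using no_neighbour_inside[OF c e(1,2)] ed by blast
qed

end

section \<open>Tiles at white and black vertices\<close>

locale perfect = pseudo_surface L B V for L :: "(int ^ 'n::finite) set" and B V +
  fixes a :: int
  assumes heights: "coord_sum ` V = {a - 1, a, a + 1}"
begin

lemma height: "p \<in> V \<Longrightarrow> coord_sum p = a - 1 \<or> coord_sum p = a \<or> coord_sum p = a + 1"
  using heights by blast

definition white :: "int ^ 'n \<Rightarrow> bool" where "white w \<longleftrightarrow> w \<in> V \<and> coord_sum w = a - 1"
definition black :: "int ^ 'n \<Rightarrow> bool" where "black b \<longleftrightarrow> b \<in> V \<and> coord_sum b = a + 1"

text \<open>White is the lowest height, so every edge leads up; dually, every edge at a black vertex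
  leads down.\<close>

lemma white_neighbour:
  assumes "white w" "d \<in> units" "w + d \<in> V"
  obtains i where "d = stdvec i"
  using assms(2) height[OF assms(3)] assms(1) by (cases rule: units_cases) (auto simp: white_def)

lemma black_neighbour:
  assumes "black b" "d \<in> units" "b + d \<in> V"
  obtains i where "d = - stdvec i"
  using assms(2) height[OF assms(3)] assms(1) by (cases rule: units_cases) (auto simp: black_def)

lemma is_square_colours:
  assumes "is_square p i j"
  shows "white p" "black (p + stdvec i + stdvec j)" "coord_sum (p + stdvec i) = a" "coord_sum (p + stdvec j) = a"
  using assms height[of p] height[of "p + stdvec i + stdvec j"] by (auto simp: white_def black_def is_square_def)

lemma is_square_corner:
  assumes "is_square p i j" "cross2 (bv i) (bv j) > 0"
  shows "corner p (stdvec i) (stdvec j)" "corner (p + stdvec i + stdvec j) (- stdvec i) (- stdvec j)"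
proof -
  show "corner p (stdvec i) (stdvec j)" using assms by (auto simp: is_square_def corner_def)
  then show "corner (p + stdvec i + stdvec j) (- stdvec i) (- stdvec j)" by (rule corner_swap)
qed

lemma corner_is_square:
  assumes "corner p (stdvec i) (stdvec j)" shows "is_square p i j"
  using cornerD[OF assms] by (auto simp: is_square_def)

lemma corner_is_square':
  assumes "corner b (- stdvec i) (- stdvec j)" shows "is_square (b - stdvec i - stdvec j) i j"
  using cornerD[OF assms] by (auto simp: is_square_def algebra_simps)

lemma white_tile_exists:
  assumes "white w" and v: "off_rays v"
  obtains i j where "is_square w i j" "between i v j"
proof -
  have w: "w \<in> V" using assms(1) by (simp add: white_def)
  have gen: "beta B d \<bullet> v \<le> 0" if d: "d \<in> units" "w + d \<in> V" "cross2 (beta B d) v = 0" for d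
  proof -
    obtain i where i: "d = stdvec i" using white_neighbour[OF assms(1) d(1,2)] .
    show ?thesis using off_rays_inner[OF v, of i] d(3) by (simp add: i)
  qed
  obtain d d' where c: "corner w d d'" "cross2 (beta B d) v > 0" "cross2 v (beta B d') > 0"
    using corner_around_exists[OF w off_rays_nonzero[OF v] gen] by blast
  obtain i j where ij: "d = stdvec i" "d' = stdvec j"
    using white_neighbour[OF assms(1)] cornerD[OF c(1)] by metis
  then show thesis using that[of i j] c corner_is_square cornerD(3)[OF c(1)] by (simp add: between_def)
qed

text \<open>The edge vectors at a black vertex are \<open>- b\<^sub>i\<close>, hence the corner
  around \<open>- v\<close>. Reversing all signs keeps the determinants, so its tile is again one
  around \<open>v\<close>.\<close>

lemma black_tile_exists:
  assumes "black b" and v: "off_rays v"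
  obtains i j where "is_square (b - stdvec i - stdvec j) i j" "between i v j"
proof -
  have b: "b \<in> V" using assms(1) by (simp add: black_def)
  have gen: "beta B d \<bullet> (- v) \<le> 0" if d: "d \<in> units" "b + d \<in> V" "cross2 (beta B d) (- v) = 0" for d
  proof -
    obtain i where i: "d = - stdvec i" using black_neighbour[OF assms(1) d(1,2)] .
    show ?thesis using off_rays_inner[OF v, of i] d(3) by (simp add: i)
  qed
  have nz: "- v \<noteq> 0" using off_rays_nonzero[OF v] by simp
  obtain d d' where c: "corner b d d'" "cross2 (beta B d) (- v) > 0" "cross2 (- v) (beta B d') > 0"
    using corner_around_exists[OF b nz gen] by blast
  obtain i j where ij: "d = - stdvec i" "d' = - stdvec j"
    using black_neighbour[OF assms(1)] cornerD[OF c(1)] by metis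
  then show thesis using that[of i j] c corner_is_square' cornerD(3)[OF c(1)] by (simp add: between_def)
qed

lemma white_tile_unique:
  assumes "is_square w i j" "between i v j" "is_square w k l" "between k v l"
  shows "i = k \<and> j = l"
  using corner_around_unique[of w "stdvec i" "stdvec j" "stdvec k" "stdvec l" v] is_square_corner assms
  by (auto simp: between_def)

lemma black_tile_unique:
  assumes "is_square (b - stdvec i - stdvec j) i j" "between i v j" "is_square (b - stdvec k - stdvec l) k l" "between k v l"
  shows "i = k \<and> j = l"
  using corner_around_unique[of b "- stdvec i" "- stdvec j" "- stdvec k" "- stdvec l" "- v"]
    is_square_corner(2)[OF assms(1)] is_square_corner(2)[OF assms(3)] assms(2,4)
  by (auto simp: between_def algebra_simps)

lemma square_orbit_image: "square_orbit L (w, T) = (\<lambda>l. (w + l, T)) ` L"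
  by (auto simp: square_orbit_def)

lemma white_vertex:
  assumes "is_square p i j"
  shows "v \<in> square_vertices (p, {i, j}) \<and> coord_sum v = a - 1 \<longleftrightarrow> v = p"
proof -
  have ij: "i \<noteq> j" using assms by (simp add: is_square_def)
  have h: "coord_sum p = a - 1" using is_square_colours(1)[OF assms] by (simp add: white_def)
  have "v = p" if "v \<in> {p, p + stdvec i, p + stdvec j, p + stdvec i + stdvec j}" "coord_sum v = a - 1"
    using that(1) by (elim insertE emptyE; use that(2) h in simp)
  then show ?thesis using h unfolding square_vertices_doubleton[OF ij] by blast
qed

lemma black_vertex:
  assumes "is_square p i j"
  shows "v \<in> square_vertices (p, {i, j}) \<and> coord_sum v = a + 1 \<longleftrightarrow> v = p + stdvec i + stdvec j"
proof -
  have ij: "i \<noteq> j" using assms by (simp add: is_square_def)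
  have h: "coord_sum p = a - 1" using is_square_colours(1)[OF assms] by (simp add: white_def)
  have "v = p + stdvec i + stdvec j"
    if "v \<in> {p, p + stdvec i, p + stdvec j, p + stdvec i + stdvec j}" "coord_sum v = a + 1"
    using that(1) by (elim insertE emptyE; use that(2) h in simp)
  moreover have "coord_sum (p + stdvec i + stdvec j) = a + 1" using h by simp
  ultimately show ?thesis unfolding square_vertices_doubleton[OF ij] by blast
qed

lemma tile_white_eq:
  assumes "(w, T) \<in> squares V"
  shows "tile_white a (square_orbit L (w, T)) = orbit L w"
proof -
  obtain i j where T: "T = {i, j}" "is_square w i j" using assms by (auto simp: squares_iff)
  have "tile_white a (square_orbit L (w, T)) =
      {v. \<exists>l\<in>L. v \<in> square_vertices (w + l, {i, j}) \<and> coord_sum v = a - 1}"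
    by (simp add: tile_white_def square_orbit_image T(1))
  also have "\<dots> = {v. \<exists>l\<in>L. v = w + l}"
    by (intro Collect_cong bex_cong refl white_vertex) (simp add: is_square_translate T(2))
  finally show ?thesis by (simp add: orbit_def Bex_def conj_commute)
qed

lemma tile_black_eq:
  assumes "(w, T) \<in> squares V"
  shows "tile_black a (square_orbit L (w, T)) = orbit L (w + stdsum T)"
proof -
  obtain i j where T: "T = {i, j}" "is_square w i j" using assms by (auto simp: squares_iff)
  then have s: "stdsum T = stdvec i + stdvec j" by (simp add: is_square_def stdsum_doubleton)
  have "tile_black a (square_orbit L (w, T)) =
      {v. \<exists>l\<in>L. v \<in> square_vertices (w + l, {i, j}) \<and> coord_sum v = a + 1}"
    by (simp add: tile_black_def square_orbit_image T(1))
  also have "\<dots> = {v. \<exists>l\<in>L. v = w + l + stdvec i + stdvec j}"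
    by (intro Collect_cong bex_cong refl black_vertex) (simp add: is_square_translate T(2))
  also have "\<dots> = {v. \<exists>l\<in>L. v = w + stdsum T + l}" by (simp add: s ac_simps)
  finally show ?thesis by (simp add: orbit_def Bex_def conj_commute)
qed

lemma square_obtain:
  assumes "(w, T) \<in> squares V"
  obtains i j where "T = {i, j}" "is_square w i j" "white w" "black (w + stdsum T)" "stdsum T = stdvec i + stdvec j"
proof -
  obtain i j where T: "T = {i, j}" "is_square w i j" using assms by (auto simp: squares_iff)
  then have "i \<noteq> j" by (simp add: is_square_def)
  then show thesis using that[OF T] T is_square_colours[OF T(2)] by (simp add: stdsum_doubleton add.assoc)
qed

lemma tile_obtain:
  assumes "e \<in> tiles L V"
  obtains w T where "e = square_orbit L (w, T)" "(w, T) \<in> squares V"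
  using assms by (auto simp: tiles_def)

lemma tile_iff: "square_orbit L (w, T) \<in> tiles L V \<longleftrightarrow> (w, T) \<in> squares V"
proof
  assume "square_orbit L (w, T) \<in> tiles L V"
  then obtain p S where p: "square_orbit L (w, T) = square_orbit L (p, S)" "(p, S) \<in> squares V"
    using tile_obtain by metis
  then have "T = S" and l: "w - p \<in> L" by (auto simp: square_orbit_eq_iff)
  then show "(w, T) \<in> squares V" using p(2) is_square_translate[OF l, of p] by (auto simp: squares_iff)
qed (auto simp: tiles_def)

lemma white_nodes_eq: "white_nodes L V a = orbit L ` {w. white w}"
  by (simp add: white_nodes_def white_def)

lemma black_nodes_eq: "black_nodes L V a = orbit L ` {b. black b}"
  by (simp add: black_nodes_def black_def)

lemma tile_at_white:
  assumes "e \<in> tiles L V" "tile_white a e = orbit L w"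
  obtains T where "e = square_orbit L (w, T)"
proof -
  obtain p T where e: "e = square_orbit L (p, T)" "(p, T) \<in> squares V" using tile_obtain[OF assms(1)] .
  then have "p - w \<in> L" using assms(2) by (simp add: tile_white_eq orbit_eq_iff)
  then show thesis using that[of T] e(1) by (simp add: square_orbit_eq_iff)
qed

lemma tile_at_black:
  assumes "e \<in> tiles L V" "tile_black a e = orbit L b"
  obtains T where "e = square_orbit L (b - stdsum T, T)"
proof -
  obtain p T where e: "e = square_orbit L (p, T)" "(p, T) \<in> squares V" using tile_obtain[OF assms(1)] .
  then have "p - (b - stdsum T) \<in> L" using assms(2) by (simp add: tile_black_eq orbit_eq_iff algebra_simps)
  then show thesis using that[of T] e(1) by (simp add: square_orbit_eq_iff)
qed

text \<open>Passes from orbits to single vertices. Seen from a black vertex \<open>b\<close>, the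
  white vertex of a tile of type \<open>T\<close> is \<open>b - stdsum T\<close>.\<close>

lemma perfect_matching_iff:
  "perfect_matching L V a P \<longleftrightarrow> P \<subseteq> tiles L V \<and>
    (\<forall>w. white w \<longrightarrow> (\<exists>!T. square_orbit L (w, T) \<in> P)) \<and>
    (\<forall>b. black b \<longrightarrow> (\<exists>!T. square_orbit L (b - stdsum T, T) \<in> P))"
proof -
  have W: "(\<exists>!e. e \<in> P \<and> tile_white a e = orbit L w) \<longleftrightarrow> (\<exists>!T. square_orbit L (w, T) \<in> P)"
    if P: "P \<subseteq> tiles L V" for w
  proof -
    have *: "e \<in> P \<and> tile_white a e = orbit L w \<longleftrightarrow> (\<exists>T. e = square_orbit L (w, T) \<and> square_orbit L (w, T) \<in> P)" for e
      using tile_at_white[of e w] P tile_white_eq tile_iff by blast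
    show ?thesis unfolding * by (rule ex1_image_iff) (simp add: square_orbit_eq_iff)
  qed
  have Bl: "(\<exists>!e. e \<in> P \<and> tile_black a e = orbit L b) \<longleftrightarrow> (\<exists>!T. square_orbit L (b - stdsum T, T) \<in> P)"
    if P: "P \<subseteq> tiles L V" for b
  proof -
    have "tile_black a (square_orbit L (b - stdsum T, T)) = orbit L b" if "square_orbit L (b - stdsum T, T) \<in> P" for T
      using that P tile_iff tile_black_eq[of "b - stdsum T" T] by auto
    then have *: "e \<in> P \<and> tile_black a e = orbit L b \<longleftrightarrow>
        (\<exists>T. e = square_orbit L (b - stdsum T, T) \<and> square_orbit L (b - stdsum T, T) \<in> P)" for e
      using tile_at_black[of e b] P by blast
    show ?thesis unfolding * by (rule ex1_image_iff) (simp add: square_orbit_eq_iff)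
  qed
  show ?thesis
  proof (cases "P \<subseteq> tiles L V")
    case True
    then show ?thesis
      unfolding perfect_matching_def white_nodes_eq black_nodes_eq by (auto simp: W[OF True] Bl[OF True] True)
  qed (simp add: perfect_matching_def)
qed

definition cone_tiles :: "real ^ 2 \<Rightarrow> 'n square set set"
  where "cone_tiles v = {e \<in> tiles L V. \<exists>i j. tile_type e = {i, j} \<and> between i v j}"

lemma cone_matching_eq:
  assumes "L_of_cone B C = {{i, j} | i j. between i v j}"
  shows "cone_matching B L V C = cone_tiles v"
  unfolding cone_matching_def cone_tiles_def assms by blast

lemma in_cone_tiles_iff:
  "square_orbit L (w, T) \<in> cone_tiles v \<longleftrightarrow> (\<exists>i j. T = {i, j} \<and> is_square w i j \<and> between i v j)"
proof
  assume "square_orbit L (w, T) \<in> cone_tiles v"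
  then have "(w, T) \<in> squares V" "\<exists>i j. T = {i, j} \<and> between i v j"
    by (auto simp: cone_tiles_def tile_iff)
  then obtain i j k l where "T = {i, j}" "between i v j" "T = {k, l}" "is_square w k l"
    by (auto simp: squares_iff)
  then show "\<exists>i j. T = {i, j} \<and> is_square w i j \<and> between i v j"
    using is_square_commute[of w k l] by (auto simp: doubleton_eq_iff)
next
  assume "\<exists>i j. T = {i, j} \<and> is_square w i j \<and> between i v j"
  then have "(w, T) \<in> squares V" "\<exists>i j. T = {i, j} \<and> between i v j" by (auto simp: squares_iff)
  then show "square_orbit L (w, T) \<in> cone_tiles v" by (auto simp: cone_tiles_def tile_iff)
qed

lemma cone_tiles_perfect:
  assumes v: "off_rays v"
  shows "perfect_matching L V a (cone_tiles v)"
  unfolding perfect_matching_iff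
proof (intro conjI allI impI)
  show "cone_tiles v \<subseteq> tiles L V" by (auto simp: cone_tiles_def)
next
  fix w assume "white w"
  then obtain i j where ij: "is_square w i j" "between i v j" using white_tile_exists[OF _ v] by blast
  show "\<exists>!T. square_orbit L (w, T) \<in> cone_tiles v"
  proof (rule ex1I[of _ "{i, j}"])
    show "square_orbit L (w, {i, j}) \<in> cone_tiles v" using ij by (auto simp: in_cone_tiles_iff)
    fix T assume "square_orbit L (w, T) \<in> cone_tiles v"
    then show "T = {i, j}" using white_tile_unique ij by (auto simp: in_cone_tiles_iff)
  qed
next
  fix b assume "black b"
  then obtain i j where ij: "is_square (b - stdvec i - stdvec j) i j" "between i v j"
    using black_tile_exists[OF _ v] by blast
  have s: "stdsum {k, l} = stdvec k + stdvec l" if "is_square p k l" for p k l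
    using that by (intro stdsum_doubleton) (simp add: is_square_def)
  show "\<exists>!T. square_orbit L (b - stdsum T, T) \<in> cone_tiles v"
  proof (rule ex1I[of _ "{i, j}"])
    show "square_orbit L (b - stdsum {i, j}, {i, j}) \<in> cone_tiles v"
      using ij s[OF ij(1)] by (auto simp: in_cone_tiles_iff algebra_simps)
    fix T assume "square_orbit L (b - stdsum T, T) \<in> cone_tiles v"
    then obtain k l where "T = {k, l}" "is_square (b - stdsum {k, l}) k l" "between k v l"
      by (auto simp: in_cone_tiles_iff)
    moreover from this(2) have "is_square (b - stdvec k - stdvec l) k l" using s by (metis diff_diff_eq)
    ultimately show "T = {i, j}" using black_tile_unique[OF ij] by blast
  qed
qed

end

lemma (in lattice_plane) between_right_left:
  assumes "between i v j"
  shows "cross2 v (bv j) > 0" "cross2 v (bv i) < 0" "i \<noteq> j"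
  using assms cross2_swap[of v "bv i"] by (auto simp: between_def)

section \<open>Matchings, their counts in each direction, and uniqueness of the cone
  matching\<close>

context perfect
begin

lemma matching_white:
  assumes "perfect_matching L V a P" "white w"
  obtains T where "square_orbit L (w, T) \<in> P" "(w, T) \<in> squares V"
  using assms unfolding perfect_matching_iff by (metis subsetD tile_iff)

lemma matching_white_unique:
  assumes "perfect_matching L V a P" "square_orbit L (w, T) \<in> P" "square_orbit L (w, S) \<in> P"
  shows "T = S"
proof -
  have "(w, T) \<in> squares V" using assms unfolding perfect_matching_iff by (metis subsetD tile_iff)
  then have "white w" using square_obtain by metis
  then show ?thesis using assms unfolding perfect_matching_iff by blast
qed

lemma matching_black_unique:
  assumes "perfect_matching L V a P" "square_orbit L (w, T) \<in> P" "square_orbit L (w', S) \<in> P"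
    and "w + stdsum T = w' + stdsum S"
  shows "T = S"
proof -
  have "(w, T) \<in> squares V" using assms unfolding perfect_matching_iff by (metis subsetD tile_iff)
  then have b: "black (w + stdsum T)" using square_obtain by metis
  have e: "w + stdsum T - stdsum T = w" "w + stdsum T - stdsum S = w'" by (simp, simp add: assms(4))
  have "square_orbit L (w + stdsum T - stdsum T, T) \<in> P" "square_orbit L (w + stdsum T - stdsum S, S) \<in> P"
    unfolding e by (fact assms)+
  then show ?thesis using assms(1) b unfolding perfect_matching_iff by blast
qed

lemma matching_tiles: "perfect_matching L V a P \<Longrightarrow> P \<subseteq> tiles L V"
  by (simp add: perfect_matching_def)

lemma finite_matching: "perfect_matching L V a P \<Longrightarrow> finite P"
  using matching_tiles finite_tiles finite_subset by blast

lemma matching_tile_obtain: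
  assumes "perfect_matching L V a P" "e \<in> P"
  obtains w T where "e = square_orbit L (w, T)" "(w, T) \<in> squares V" "white w"
proof -
  obtain w T where wT: "e = square_orbit L (w, T)" "(w, T) \<in> squares V"
    using tile_obtain matching_tiles assms by (metis subsetD)
  moreover have "white w" using wT(2) square_obtain by metis
  ultimately show thesis by (rule that)
qed

lemma matching_bij_white:
  assumes "perfect_matching L V a P"
  shows "bij_betw (tile_white a) P (white_nodes L V a)"
proof (rule bij_betwI')
  fix e e' assume e: "e \<in> P" "e' \<in> P"
  show "tile_white a e = tile_white a e' \<longleftrightarrow> e = e'"
  proof
    assume eq: "tile_white a e = tile_white a e'"
    obtain w T where w: "e = square_orbit L (w, T)" "(w, T) \<in> squares V" "white w"
      using matching_tile_obtain[OF assms e(1)] .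
    then have "tile_white a e' = orbit L w" using eq by (simp add: tile_white_eq)
    then obtain S where "e' = square_orbit L (w, S)"
      using tile_at_white e(2) matching_tiles[OF assms] by blast
    then show "e = e'" using matching_white_unique[OF assms] w(1) e by metis
  qed simp
next
  fix e assume e: "e \<in> P"
  obtain w T where "e = square_orbit L (w, T)" "(w, T) \<in> squares V" "white w"
    using matching_tile_obtain[OF assms e] .
  then show "tile_white a e \<in> white_nodes L V a" by (simp add: tile_white_eq white_nodes_eq)
next
  fix W assume "W \<in> white_nodes L V a"
  then obtain w where w: "white w" "W = orbit L w" by (auto simp: white_nodes_eq)
  obtain T where T: "square_orbit L (w, T) \<in> P" "(w, T) \<in> squares V"
    using matching_white[OF assms w(1)] .
  have "W = tile_white a (square_orbit L (w, T))" using tile_white_eq[OF T(2)] w(2) by simp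
  then show "\<exists>e\<in>P. W = tile_white a e" using T(1) by blast
qed

lemma matching_bij_black:
  assumes "perfect_matching L V a P"
  shows "bij_betw (tile_black a) P (black_nodes L V a)"
proof (rule bij_betwI')
  fix e e' assume e: "e \<in> P" "e' \<in> P"
  show "tile_black a e = tile_black a e' \<longleftrightarrow> e = e'"
  proof
    assume eq: "tile_black a e = tile_black a e'"
    obtain w T where w: "e = square_orbit L (w, T)" "(w, T) \<in> squares V" "white w"
      using matching_tile_obtain[OF assms e(1)] .
    then have "tile_black a e' = orbit L (w + stdsum T)" using eq by (simp add: tile_black_eq)
    then obtain S where S: "e' = square_orbit L (w + stdsum T - stdsum S, S)"
      using tile_at_black e(2) matching_tiles[OF assms] by blast
    have "T = S" by (rule matching_black_unique[OF assms]) (use e w S in auto)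
    then show "e = e'" using S w(1) by simp
  qed simp
next
  fix e assume e: "e \<in> P"
  obtain w T where w: "e = square_orbit L (w, T)" "(w, T) \<in> squares V" "white w"
    using matching_tile_obtain[OF assms e] .
  moreover have "black (w + stdsum T)" using w(2) square_obtain by metis
  ultimately show "tile_black a e \<in> black_nodes L V a" by (simp add: tile_black_eq black_nodes_eq)
next
  fix W assume "W \<in> black_nodes L V a"
  then obtain b where b: "black b" "W = orbit L b" by (auto simp: black_nodes_eq)
  have "\<exists>!T. square_orbit L (b - stdsum T, T) \<in> P"
    using assms b(1) unfolding perfect_matching_iff by simp
  then obtain T where T: "square_orbit L (b - stdsum T, T) \<in> P" using ex1_implies_ex by metis
  then have "(b - stdsum T, T) \<in> squares V" using matching_tiles[OF assms] tile_iff by blast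
  then have "W = tile_black a (square_orbit L (b - stdsum T, T))" using tile_black_eq b(2) by simp
  then show "\<exists>e\<in>P. W = tile_black a e" using T by blast
qed

lemma matching_subset_eq:
  assumes P: "perfect_matching L V a P" and Q: "perfect_matching L V a Q" and "P \<subseteq> Q"
  shows "P = Q"
proof -
  have "card P = card Q"
    using bij_betw_same_card[OF matching_bij_white[OF P]] bij_betw_same_card[OF matching_bij_white[OF Q]] by simp
  then show ?thesis using card_subset_eq finite_matching[OF Q] assms(3) by blast
qed

lemma matching_exists:
  obtains P where "perfect_matching L V a P"
proof -
  obtain i :: 'n where True by blast
  obtain i j where "adjacent i j" using adjacent_cover[OF bv_nonzero[of i]] by blast
  then show thesis using that cone_tiles_perfect adjacent_off_rays(1) by blast
qed

lemma finite_white_nodes: "finite (white_nodes L V a)"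
  by (rule matching_exists) (metis matching_bij_white finite_matching bij_betw_finite)

lemma finite_black_nodes: "finite (black_nodes L V a)"
  by (rule matching_exists) (metis matching_bij_black finite_matching bij_betw_finite)

text \<open>The cardinality is the \<open>m\<close>-th coordinate of the exponent, see
  \<open>matching_hat_nth\<close>.\<close>

definition hits :: "'n square set set \<Rightarrow> 'n \<Rightarrow> 'n square set set"
  where "hits P m = {e \<in> P. m \<in> tile_type e}"

text \<open>Tiles of a matching correspond to their white nodes, so \<open>sub\<close> is an
  inclusion between finite sets of white nodes, and equal cardinalities make the sets equal.\<close>

lemma hits_mono:
  assumes P: "perfect_matching L V a P" and Q: "perfect_matching L V a Q"
    and sub: "\<And>w T S. square_orbit L (w, T) \<in> P \<Longrightarrow> square_orbit L (w, S) \<in> Q \<Longrightarrow> m \<in> T \<Longrightarrow> m \<in> S"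
  shows "card (hits P m) \<le> card (hits Q m)"
    and "card (hits P m) = card (hits Q m) \<Longrightarrow> square_orbit L (w, T) \<in> P \<Longrightarrow> square_orbit L (w, S) \<in> Q \<Longrightarrow> m \<in> S \<Longrightarrow> m \<in> T"
proof -
  have inj: "card (tile_white a ` hits R m) = card (hits R m)" if "perfect_matching L V a R" for R
    using matching_bij_white[OF that] by (intro card_image) (auto simp: hits_def bij_betw_def inj_on_def)
  have fin: "finite (tile_white a ` hits Q m)" using finite_matching[OF Q] by (simp add: hits_def)
  have subset: "tile_white a ` hits P m \<subseteq> tile_white a ` hits Q m"
  proof
    fix W assume "W \<in> tile_white a ` hits P m"
    then obtain e where e: "e \<in> P" "m \<in> tile_type e" "W = tile_white a e" by (auto simp: hits_def)
    obtain w T where w: "e = square_orbit L (w, T)" "(w, T) \<in> squares V" "white w"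
      using matching_tile_obtain[OF P e(1)] .
    obtain S where S: "square_orbit L (w, S) \<in> Q" "(w, S) \<in> squares V" using matching_white[OF Q w(3)] .
    have "m \<in> S" using sub[of w T S] e w S by simp
    then have "square_orbit L (w, S) \<in> hits Q m" using S by (simp add: hits_def)
    moreover have "W = tile_white a (square_orbit L (w, S))" using e w S by (simp add: tile_white_eq)
    ultimately show "W \<in> tile_white a ` hits Q m" by blast
  qed
  show "card (hits P m) \<le> card (hits Q m)"
    using card_mono[OF fin subset] inj[OF P] inj[OF Q] by simp
  assume "card (hits P m) = card (hits Q m)"
    and T: "square_orbit L (w, T) \<in> P" and S: "square_orbit L (w, S) \<in> Q" "m \<in> S"
  then have eq: "tile_white a ` hits P m = tile_white a ` hits Q m"
    using card_subset_eq[OF fin subset] inj[OF P] inj[OF Q] by simp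
  have sq: "(w, S) \<in> squares V" "(w, T) \<in> squares V"
    using S(1) T matching_tiles[OF Q] matching_tiles[OF P] tile_iff by blast+
  have "square_orbit L (w, S) \<in> hits Q m" using S by (simp add: hits_def)
  then have "orbit L w \<in> tile_white a ` hits Q m" using tile_white_eq[OF sq(1)] by (metis imageI)
  then obtain e where e: "e \<in> P" "m \<in> tile_type e" "tile_white a e = orbit L w"
    unfolding eq[symmetric] by (auto simp: hits_def)
  then obtain T' where T': "e = square_orbit L (w, T')" using tile_at_white matching_tiles[OF P] by blast
  then have "T' = T" using matching_white_unique[OF P] e(1) T by metis
  then show "m \<in> T" using e(2) T' by simp
qed

lemma square_mem_neighbour:
  assumes "(w, T) \<in> squares V" "m \<in> T"
  obtains k where "T = {m, k}" "is_square w m k"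
proof -
  obtain i j where ij: "T = {i, j}" "is_square w i j" using square_obtain[OF assms(1)] .
  then show thesis using that[of i] that[of j] assms(2) is_square_commute[of w i j] by (auto simp: insert_commute)
qed

text \<open>As no vector lies strictly between \<open>b\<^sub>i\<close> and \<open>v\<close>, the
  corner that follows an edge \<open>i\<close> must reach beyond \<open>v\<close>; it is thus the
  corner of the cone tile. Symmetrically for the corner preceding an edge \<open>j\<close>.\<close>

lemma hits_extreme:
  assumes adj: "adjacent i j" "between i v j" and v: "off_rays v"
    and T: "(w, T) \<in> squares V" and S: "square_orbit L (w, S) \<in> cone_tiles v" and m: "m \<in> T" "m = i \<or> m = j"
  shows "m \<in> S"
proof -
  obtain k l where kl: "S = {k, l}" "is_square w k l" "between k v l" using S by (auto simp: in_cone_tiles_iff)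
  have w: "white w" using square_obtain[OF T] by metis
  then have wV: "w \<in> V" by (simp add: white_def)
  have b: "cross2 (bv i) v > 0" "cross2 v (bv j) > 0" using adj(2) by (auto simp: between_def)
  have wm: "w + stdvec m \<in> V" using square_mem_neighbour[OF T m(1)] by (metis is_square_def)
  from m(2) show ?thesis
  proof
    assume mi: "m = i"
    obtain d where c: "corner w (stdvec i) d" using corner_next_exists[OF wV _ wm] mi by auto
    obtain n where n: "d = stdvec n" using white_neighbour[OF w] cornerD(2,6)[OF c] by metis
    have c': "corner w (stdvec i) (stdvec n)" using c n by simp
    have pos: "cross2 (bv i) (bv n) > 0" using cornerD(3)[OF c'] by simp
    have "\<not> cross2 (bv n) v > 0" using adjacent_extreme(1)[OF adj, of n] pos by blast
    then have "cross2 v (bv n) > 0"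
      using off_rays_not_parallel[OF v b(1) pos] cross2_swap[of v "bv n"] by linarith
    then have "between i v n" using pos b(1) by (simp add: between_def)
    then have "i = k" using white_tile_unique[OF corner_is_square[OF c'] _ kl(2,3)] by blast
    then show ?thesis using kl mi by simp
  next
    assume mj: "m = j"
    obtain d where c: "corner w d (stdvec j)" using corner_prev_exists[OF wV _ wm] mj by auto
    obtain n where n: "d = stdvec n" using white_neighbour[OF w] cornerD(1,5)[OF c] by metis
    have c': "corner w (stdvec n) (stdvec j)" using c n by simp
    have pos: "cross2 (bv n) (bv j) > 0" using cornerD(3)[OF c'] by simp
    have no: "\<not> cross2 v (bv n) > 0" using adjacent_extreme(2)[OF adj, of n] pos by blast
    have "cross2 v (bv n) \<noteq> 0"
    proof
      assume z: "cross2 v (bv n) = 0"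
      have "cross2 (- bv j) v > 0" "cross2 (- bv j) (bv n) > 0"
        using b(2) pos cross2_swap[of v "bv j"] cross2_swap[of "bv n" "bv j"] by simp_all
      then show False using off_rays_not_parallel[OF v] z by blast
    qed
    then have "cross2 (bv n) v > 0" using no cross2_swap[of v "bv n"] by linarith
    then have "between n v j" using pos b(2) by (simp add: between_def)
    then have "j = l" using white_tile_unique[OF corner_is_square[OF c'] _ kl(2,3)] by blast
    then show ?thesis using kl mj by simp
  qed
qed

lemma matching_hits_le:
  assumes P: "perfect_matching L V a P" and adj: "adjacent i j" "between i v j" and v: "off_rays v"
    and m: "m = i \<or> m = j"
  shows "card (hits P m) \<le> card (hits (cone_tiles v) m)"
    and "card (hits P m) = card (hits (cone_tiles v) m) \<Longrightarrow> square_orbit L (w, T) \<in> P \<Longrightarrow>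
      square_orbit L (w, S) \<in> cone_tiles v \<Longrightarrow> m \<in> S \<Longrightarrow> m \<in> T"
proof -
  have sub: "m \<in> S" if "square_orbit L (w, T) \<in> P" "square_orbit L (w, S) \<in> cone_tiles v" "m \<in> T" for w T S
    using hits_extreme[OF adj v _ that(2,3) m] that(1) matching_tiles[OF P] tile_iff by blast
  show "card (hits P m) \<le> card (hits (cone_tiles v) m)"
    by (rule hits_mono(1)[OF P cone_tiles_perfect[OF v]]) (rule sub)
  show "card (hits P m) = card (hits (cone_tiles v) m) \<Longrightarrow> square_orbit L (w, T) \<in> P \<Longrightarrow>
      square_orbit L (w, S) \<in> cone_tiles v \<Longrightarrow> m \<in> S \<Longrightarrow> m \<in> T"
    by (rule hits_mono(2)[OF P cone_tiles_perfect[OF v]]) (use sub in blast)+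
qed

text \<open>Suppose the matchings differ somewhere, and among the white vertices where they differ choose one
  whose tile in the cone matching has its leg to the left of \<open>v\<close> as close to \<open>v\<close> as possible, in
  direction \<open>m\<close>. Counting the tiles with an \<open>m\<close>-edge shows that \<open>P\<close> switches all tiles along the
  strip through this vertex in direction \<open>m\<close>. The strip is an infinite periodic path, hence it crosses
  the strips of every direction that is not parallel to \<open>m\<close>, but a switched strip cannot cross those
  of a direction on the boundary of the cone.\<close>

lemma cone_matching_unique:
  assumes P: "perfect_matching L V a P" and v: "off_rays v"
    and hits: "\<And>m. card (hits P m) = card (hits (cone_tiles v) m)"
  shows "P = cone_tiles v"
proof (rule ccontr)
  assume neq: "P \<noteq> cone_tiles v"
  let ?Q = "cone_tiles v"
  have Q: "perfect_matching L V a ?Q" by (rule cone_tiles_perfect[OF v])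
  obtain i0 j0 where adj: "adjacent i0 j0" "between i0 v j0" using off_rays_adjacent[OF v] .
  have "\<forall>w. \<exists>r n. white w \<longrightarrow> is_square w r n \<and> between r v n" using white_tile_exists[OF _ v] by metis
  \<comment> \<open>The right and the left leg, with respect to \<open>v\<close>, of the cone tile
    at a white vertex.\<close>
  then obtain rl ll where leg: "\<And>w. white w \<Longrightarrow> is_square w (rl w) (ll w)" "\<And>w. white w \<Longrightarrow> between (rl w) v (ll w)"
    by metis
  have legQ: "square_orbit L (w, {rl w, ll w}) \<in> ?Q" if "white w" for w
    using leg[OF that] by (auto simp: in_cone_tiles_iff)
  define bad where "bad w \<longleftrightarrow> white w \<and> square_orbit L (w, {rl w, ll w}) \<notin> P" for w
  have sqP: "(w, T) \<in> squares V" "white w" if "square_orbit L (w, T) \<in> P" for w T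
  proof -
    show "(w, T) \<in> squares V" using that matching_tiles[OF P] tile_iff by blast
    then show "white w" using square_obtain by metis
  qed
  have "\<exists>w. bad w"
  proof (rule ccontr)
    assume no: "\<nexists>w. bad w"
    have "?Q \<subseteq> P"
    proof
      fix e assume e: "e \<in> ?Q"
      obtain w T where w: "e = square_orbit L (w, T)" "white w" using matching_tile_obtain[OF Q e] by metis
      then have "T = {rl w, ll w}" using matching_white_unique[OF Q] e legQ[OF w(2)] by metis
      then show "e \<in> P" using no w by (auto simp: bad_def)
    qed
    then show False using matching_subset_eq[OF Q P] neq by blast
  qed
  then have "{ll w | w. bad w} \<noteq> {}" by blast
  moreover have left: "cross2 v (bv n) > 0" if "n \<in> {ll w | w. bad w}" for n
    using that leg(2) by (auto simp: bad_def between_def)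
  ultimately obtain m where m: "m \<in> {ll w | w. bad w}" "\<And>n. n \<in> {ll w | w. bad w} \<Longrightarrow> cross2 (bv m) (bv n) \<ge> 0"
    using first_vector[of "{ll w | w. bad w}" v bv] by (metis (no_types, lifting) finite_class.finite_code)
  then obtain w0 where w0: "bad w0" "ll w0 = m" by blast
  have vm: "cross2 v (bv m) > 0" using left[OF m(1)] .
  have good: "\<not> bad w" if "cross2 (bv (ll w)) (bv m) > 0" for w
    using m(2)[of "ll w"] that cross2_swap[of "bv m" "bv (ll w)"] by fastforce
  \<comment> \<open>An \<open>m\<close>-edge at \<open>w\<close> is the left leg or lies beyond it.
    In the second case the left leg is closer to \<open>v\<close> than \<open>m\<close>, so
    \<open>w\<close> is not bad and \<open>P\<close> uses the cone tile there, which does not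
    contain \<open>m\<close>.\<close>
  have mleg: "ll w = m" if "square_orbit L (w, T) \<in> P" "m \<in> T" for w T
  proof -
    note w = sqP[OF that(1)]
    have "w + stdvec m \<in> V" using square_mem_neighbour[OF w(1) that(2)] by (metis is_square_def)
    moreover have c: "corner w (stdvec (rl w)) (stdvec (ll w))"
      using is_square_corner(1) leg[OF w(2)] by (auto simp: between_def)
    ultimately have "stdvec m = stdvec (ll w) \<or> cross2 (bv (ll w)) (bv m) > 0"
      using neighbour_beyond_corner[OF c, of v "stdvec m"] leg(2)[OF w(2)] vm by (auto simp: between_def)
    moreover have "\<not> cross2 (bv (ll w)) (bv m) > 0"
    proof
      assume pos: "cross2 (bv (ll w)) (bv m) > 0"
      then have "square_orbit L (w, {rl w, ll w}) \<in> P" using good[OF pos] w(2) by (simp add: bad_def)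
      then have "T = {rl w, ll w}" using matching_white_unique[OF P] that(1) by blast
      then show False using that(2) pos vm between_right_left[OF leg(2)[OF w(2)]] by auto
    qed
    ultimately show ?thesis by simp
  qed
  \<comment> \<open>The converse implication comes from the equal counts in direction
    \<open>m\<close>.\<close>
  have mleg': "m \<in> T" if "square_orbit L (w, T) \<in> P" "ll w = m" for w T
  proof (rule hits_mono(2)[OF P Q _ hits])
    show "square_orbit L (w, T) \<in> P" using that(1) .
    show "square_orbit L (w, {rl w, ll w}) \<in> ?Q" using legQ sqP[OF that(1)] by blast
    show "m \<in> {rl w, ll w}" using that(2) by simp
    show "m \<in> S" if "square_orbit L (w, T) \<in> P" "square_orbit L (w, S) \<in> ?Q" "m \<in> T" for w T S
      using mleg[OF that(1,3)] legQ[OF sqP(2)[OF that(1)]] matching_white_unique[OF Q that(2)] by blast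
  qed
  \<comment> \<open>A boundary direction transversal to \<open>m\<close>: \<open>j0\<close> fails
    only if \<open>b\<^sub>m\<close> lies on its ray, and then \<open>i0\<close> works.\<close>
  define jj where "jj = (if cross2 (bv j0) (bv m) > 0 then j0 else i0)"
  have b0: "cross2 (bv i0) v > 0" "cross2 v (bv j0) > 0" "cross2 (bv i0) (bv j0) > 0"
    using adj(2) by (auto simp: between_def)
  have jjm: "cross2 (bv jj) (bv m) > 0"
  proof (cases "cross2 (bv j0) (bv m) > 0")
    case False
    have "\<not> cross2 (bv m) (bv j0) > 0" using adjacent_extreme(2)[OF adj, of m] vm by blast
    then have "cross2 (bv m) (bv j0) = 0" using False cross2_swap[of "bv m" "bv j0"] by linarith
    then obtain t where "t > 0" "bv m = t *\<^sub>R bv j0" using parallel_same_side[OF _ vm b0(2)] by blast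
    then show ?thesis using False b0(3) by (simp add: jj_def)
  qed (simp add: jj_def)
  \<comment> \<open>One step along the strip: up from \<open>w\<close> across the tile of
    \<open>P\<close>, then down from its black vertex across the cone tile. Both tiles contain
    \<open>m\<close>, so only the other legs \<open>k\<close> and \<open>r\<close> remain.\<close>
  have step: "\<exists>w'. (bad w' \<and> ll w' = m) \<and> (\<exists>k r. w' = w + stdvec k - stdvec r \<and>
      cross2 (bv m) (bv k) > 0 \<and> cross2 (bv r) (bv m) > 0 \<and> k \<noteq> jj \<and> r \<noteq> jj)"
    if bw: "bad w" "ll w = m" for w
  proof -
    have w: "white w" using bw by (simp add: bad_def)
    obtain T where T: "square_orbit L (w, T) \<in> P" "(w, T) \<in> squares V" using matching_white[OF P w] .
    obtain k where k: "T = {m, k}" "is_square w m k" using square_mem_neighbour[OF T(2) mleg'[OF T(1) bw(2)]] .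
    \<comment> \<open>To the right of \<open>m\<close>, the leg \<open>k\<close> would be the
      predecessor of \<open>m\<close> at \<open>w\<close>, which is the right leg of the cone
      tile.\<close>
    have mk: "cross2 (bv m) (bv k) > 0"
    proof (rule ccontr)
      assume "\<not> ?thesis"
      then have "cross2 (bv k) (bv m) > 0"
        using square_transversal[OF k(2)] cross2_swap[of "bv m" "bv k"] by linarith
      then have "corner w (stdvec k) (stdvec m)" using is_square_corner(1) k(2) is_square_commute by blast
      moreover have "corner w (stdvec (rl w)) (stdvec m)"
        using is_square_corner(1) leg[OF w] bw(2) by (auto simp: between_def)
      ultimately have "stdvec k = stdvec (rl w)" using corner_unique_prev by blast
      then have "T = {rl w, ll w}" using k(1) bw(2) by auto
      then show False using T(1) bw(1) by (simp add: bad_def)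
    qed
    define b where "b = w + stdvec m + stdvec k"
    have bT: "b = w + stdsum T" using k by (simp add: b_def is_square_def stdsum_doubleton add.assoc)
    have "black b" using is_square_colours(2)[OF k(2)] by (simp add: b_def)
    then obtain r n where rn: "is_square (b - stdvec r - stdvec n) r n" "between r v n"
      using black_tile_exists[OF _ v] by blast
    define w' where "w' = b - stdvec r - stdvec n"
    have w': "white w'" using is_square_colours(1)[OF rn(1)] by (simp add: w'_def)
    have rl: "rl w' = r" "ll w' = n"
      using white_tile_unique[OF leg(1)[OF w'] leg(2)[OF w'] _ rn(2)] rn(1) by (auto simp: w'_def)
    have rne: "r \<noteq> n" using rn(1) by (simp add: is_square_def)
    have b': "w' + stdsum {r, n} = b" using rne by (simp add: w'_def stdsum_doubleton)
    have notP: "square_orbit L (w', {r, n}) \<notin> P" if "{r, n} \<noteq> T"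
      using matching_black_unique[OF P _ T(1)] b' bT that by metis
    have c: "corner b (- stdvec r) (- stdvec n)"
      using is_square_corner(2)[OF rn(1)] rn(2) by (simp add: between_def)
    have "b + - stdvec m \<in> V" using k(2) by (simp add: b_def is_square_def algebra_simps)
    \<comment> \<open>The argument of \<open>mleg\<close>, carried out at the black vertex with
      \<open>- v\<close>.\<close>
    then have "- stdvec m = - stdvec n \<or> cross2 (bv n) (bv m) > 0"
      using neighbour_beyond_corner[OF c, of "- v" "- stdvec m"] rn(2) vm by (auto simp: between_def)
    moreover have "\<not> cross2 (bv n) (bv m) > 0"
    proof
      assume pos: "cross2 (bv n) (bv m) > 0"
      then have "\<not> bad w'" using good rl by simp
      then have "square_orbit L (w', {r, n}) \<in> P" using w' rl by (simp add: bad_def)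
      then have "m \<in> {r, n}" using notP k(1) by auto
      then show False using pos vm between_right_left[OF rn(2)] by auto
    qed
    ultimately have nm: "n = m" by simp
    have rm: "cross2 (bv r) (bv m) > 0" using rn(2) nm by (simp add: between_def)
    have rk: "r \<noteq> k" using rm mk cross2_swap[of "bv m" "bv k"] by auto
    have "{r, n} \<noteq> T" using rk nm rne k(1) by (auto simp: doubleton_eq_iff)
    then have bad: "bad w'" using notP w' rl by (simp add: bad_def)
    have "w' = w + stdvec k - stdvec r" by (simp add: w'_def b_def nm)
    moreover have "k \<noteq> jj" using mk jjm cross2_swap[of "bv m" "bv k"] by auto
    \<comment> \<open>The index \<open>j0\<close> is on the wrong side of \<open>v\<close>. For
      \<open>i0\<close>, equal counts in this boundary direction put \<open>i0\<close> besides
      \<open>m\<close> into the tile of \<open>P\<close> at \<open>w'\<close>, making it the cone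
      tile although \<open>w'\<close> is bad.\<close>
    moreover have "r \<noteq> jj"
    proof
      assume r: "r = jj"
      show False
      proof (cases "cross2 (bv j0) (bv m) > 0")
        case True
        then have "r = j0" using r by (simp add: jj_def)
        then show False using b0(2) between_right_left(2)[OF rn(2)] by simp
      next
        case False
        then have ri: "r = i0" using r by (simp add: jj_def)
        obtain T' where T': "square_orbit L (w', T') \<in> P" "(w', T') \<in> squares V" using matching_white[OF P w'] .
        have "i0 \<in> T'"
          by (rule matching_hits_le(2)[OF P adj v _ hits T'(1) legQ[OF w']]) (use rl ri in auto)
        moreover have "m \<in> T'" using mleg'[OF T'(1)] rl nm by simp
        moreover obtain x y where "T' = {x, y}" using square_obtain[OF T'(2)] by metis
        ultimately have "T' = {rl w', ll w'}" using rl ri nm rne by auto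
        then show False using T'(1) bad by (simp add: bad_def)
      qed
    qed
    ultimately show ?thesis using bad rl nm mk rm by blast
  qed
  obtain f where f: "\<And>n. bad (f n) \<and> ll (f n) = m"
    "\<And>n. \<exists>k r. f (Suc n) = f n + stdvec k - stdvec r \<and>
      cross2 (bv m) (bv k) > 0 \<and> cross2 (bv r) (bv m) > 0 \<and> k \<noteq> jj \<and> r \<noteq> jj"
    using dependent_nat_choice[of "\<lambda>_ w. bad w \<and> ll w = m" "\<lambda>_ w w'. \<exists>k r. w' = w + stdvec k - stdvec r \<and>
      cross2 (bv m) (bv k) > 0 \<and> cross2 (bv r) (bv m) > 0 \<and> k \<noteq> jj \<and> r \<noteq> jj"] w0 step by metis
  have "range (\<lambda>n. orbit L (f n)) \<subseteq> white_nodes L V a"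
    using f(1) by (auto simp: white_nodes_eq bad_def)
  then have "finite (range (\<lambda>n. orbit L (f n)))" using finite_white_nodes finite_subset by blast
  then have "\<not> inj (\<lambda>n. orbit L (f n))" using finite_imageD infinite_UNIV_nat by blast
  then obtain s t where st: "s < t" "orbit L (f s) = orbit L (f t)"
    unfolding inj_def by (metis linorder_neqE_nat)
  \<comment> \<open>With two transversal coordinates constant, points of the strip in the same orbit
    coincide by \<open>eq_zero_in_L\<close>.\<close>
  have const: "f n $ jj = f 0 $ jj \<and> f n $ m = f 0 $ m" for n
  proof (induction n)
    case (Suc n)
    obtain k r where "f (Suc n) = f n + stdvec k - stdvec r" "cross2 (bv m) (bv k) > 0" "cross2 (bv r) (bv m) > 0"
      "k \<noteq> jj" "r \<noteq> jj" using f(2) by blast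
    moreover from this have "k \<noteq> m" "r \<noteq> m" by auto
    ultimately show ?case using Suc by (simp add: stdvec_nth)
  qed simp
  have "f s - f t \<in> L" using st(2) by (simp add: orbit_eq_iff)
  then have "f s - f t = 0"
    by (rule eq_zero_in_L[of _ jj m]) (use jjm const[of s] const[of t] in auto)
  then have eq: "f s = f t" by simp
  obtain k r where kr: "f (Suc s) = f s + stdvec k - stdvec r" "cross2 (bv m) (bv k) > 0" "cross2 (bv r) (bv m) > 0"
    using f(2) by blast
  have kr': "k \<noteq> r" using kr(2,3) cross2_swap[of "bv m" "bv k"] by auto
  \<comment> \<open>Only directions to the right of \<open>m\<close> are subtracted, so the
    coordinate \<open>k\<close>, to the left of \<open>m\<close>, never decreases after its
    increase; the path cannot return.\<close>
  have "f (Suc s) $ k \<le> f (Suc s + n) $ k" for n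
  proof (induction n)
    case (Suc n)
    obtain k' r' where *: "f (Suc (Suc s + n)) = f (Suc s + n) + stdvec k' - stdvec r'" "cross2 (bv r') (bv m) > 0"
      using f(2) by blast
    then have "r' \<noteq> k" using kr(2) cross2_swap[of "bv m" "bv k"] by auto
    then show ?case using Suc *(1) by (simp add: stdvec_nth)
  qed simp
  from this[of "t - Suc s"] have "f (Suc s) $ k \<le> f t $ k" using st(1) by simp
  then show False using eq kr(1) kr' by (simp add: stdvec_nth)
qed

end

section \<open>The secondary polygon\<close>

context perfect
begin

lemma matching_hat_eq: "matching_hat P = (\<Sum>e\<in>P. stdsum (tile_type e))"
  by (simp add: matching_hat_def stdsum_def)

lemma matching_hat_nth:
  assumes "finite P"
  shows "matching_hat P $ m = int (card (hits P m))"
proof -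
  have "matching_hat P $ m = (\<Sum>e\<in>P. if m \<in> tile_type e then 1 else 0)"
    by (simp add: matching_hat_eq sum_component stdsum_nth)
  also have "\<dots> = int (card (hits P m))"
    using assms by (simp add: hits_def sum.If_cases Int_def)
  finally show ?thesis .
qed

text \<open>The type of a tile is its black vertex minus its white vertex. Modulo the lattice every
  exponent is thus the sum of the black nodes minus the sum of the white nodes.\<close>

lemma matching_hat_diff:
  assumes P: "perfect_matching L V a P" and Q: "perfect_matching L V a Q"
  shows "matching_hat P - matching_hat Q \<in> L"
proof -
  define rep :: "(int ^ 'n) set \<Rightarrow> int ^ 'n" where "rep = (\<lambda>S. SOME p. p \<in> S)"
  have rep: "rep (orbit L p) - p \<in> L" for p
  proof -
    have "p \<in> orbit L p" by (simp add: mem_orbit_iff)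
    then have "rep (orbit L p) \<in> orbit L p" unfolding rep_def by (rule someI)
    then show ?thesis by (simp add: mem_orbit_iff)
  qed
  let ?c = "(\<Sum>b\<in>black_nodes L V a. rep b) - (\<Sum>w\<in>white_nodes L V a. rep w)"
  have main: "matching_hat R - ?c \<in> L" if R: "perfect_matching L V a R" for R
  proof -
    have "stdsum (tile_type e) - (rep (tile_black a e) - rep (tile_white a e)) \<in> L" if e: "e \<in> R" for e
    proof -
      obtain w T where w: "e = square_orbit L (w, T)" "(w, T) \<in> squares V"
        using matching_tile_obtain[OF R e] by metis
      have "(rep (orbit L w) - w) - (rep (orbit L (w + stdsum T)) - (w + stdsum T)) \<in> L"
        using rep diff_in_L by blast
      then show ?thesis using w by (simp add: tile_white_eq tile_black_eq algebra_simps)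
    qed
    then have "(\<Sum>e\<in>R. stdsum (tile_type e) - (rep (tile_black a e) - rep (tile_white a e))) \<in> L"
      by (rule sum_in_L)
    moreover have "(\<Sum>e\<in>R. rep (tile_black a e)) = (\<Sum>b\<in>black_nodes L V a. rep b)"
      using sum.reindex_bij_betw[OF matching_bij_black[OF R]] .
    moreover have "(\<Sum>e\<in>R. rep (tile_white a e)) = (\<Sum>w\<in>white_nodes L V a. rep w)"
      using sum.reindex_bij_betw[OF matching_bij_white[OF R]] .
    ultimately show ?thesis by (simp add: matching_hat_eq sum_subtractf)
  qed
  show ?thesis using diff_in_L[OF main[OF P] main[OF Q]] by simp
qed

lemma realvec_sum: "realvec (sum f A) = (\<Sum>x\<in>A. realvec (f x))"
  by (simp add: vec_eq_iff sum_component)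

lemma realvec_stdsum: "realvec (stdsum T) = (\<Sum>i\<in>T. axis i 1)"
  by (simp add: vec_eq_iff sum_component stdsum_nth) (simp add: axis_def)

text \<open>Group the tiles by type: by \<open>tile_of_type_count\<close> each type of the cone
  occurs as often as its coefficient in \<open>psi\<close> says.\<close>

lemma psi_eq:
  assumes C: "L_of_cone B C = {{i, j} | i j. between i v j}"
  shows "psi B C = realvec (matching_hat (cone_tiles v))"
proof -
  let ?LC = "L_of_cone B C"
  have tile_types: "tile_type ` cone_tiles v \<subseteq> ?LC" unfolding C cone_tiles_def by blast
  have fin: "finite (cone_tiles v)" using finite_tiles by (simp add: cone_tiles_def)
  have "realvec (matching_hat (cone_tiles v)) = (\<Sum>e\<in>cone_tiles v. realvec (stdsum (tile_type e)))"
    by (simp add: matching_hat_eq realvec_sum)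
  also have "\<dots> = (\<Sum>T\<in>?LC. \<Sum>e | e \<in> cone_tiles v \<and> tile_type e = T. realvec (stdsum (tile_type e)))"
    by (rule sum.group[symmetric, OF fin _ tile_types]) simp
  also have "\<dots> = (\<Sum>T\<in>?LC. pair_absdet B T *\<^sub>R (\<Sum>i\<in>T. axis i 1))"
  proof (rule sum.cong)
    fix T assume T: "T \<in> ?LC"
    then obtain i j where ij: "T = {i, j}" "between i v j" unfolding C by blast
    then have ne: "i \<noteq> j" by (auto simp: between_def)
    have "{e. e \<in> cone_tiles v \<and> tile_type e = T} = {e \<in> tiles L V. tile_type e = {i, j}}"
      using ij by (auto simp: cone_tiles_def)
    moreover have "det (vector [bv i, bv j] :: real ^ 2 ^ 2) = cross2 (bv i) (bv j)"
      by (simp add: det_2 vector_2 cross2_def)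
    ultimately have c: "real (card {e. e \<in> cone_tiles v \<and> tile_type e = T}) = pair_absdet B T"
      using tile_of_type_count[OF ne] by (simp add: ij(1) pair_absdet_doubleton)
    have "(\<Sum>e | e \<in> cone_tiles v \<and> tile_type e = T. realvec (stdsum (tile_type e))) =
        (\<Sum>e | e \<in> cone_tiles v \<and> tile_type e = T. realvec (stdsum T))"
      by (rule sum.cong) auto
    then show "(\<Sum>e | e \<in> cone_tiles v \<and> tile_type e = T. realvec (stdsum (tile_type e))) =
        pair_absdet B T *\<^sub>R (\<Sum>i\<in>T. axis i 1)"
      by (simp only: sum_constant_scaleR c realvec_stdsum)
  qed simp
  finally show ?thesis by (simp add: psi_def)
qed

lemma psi_cone_matching:
  assumes "C \<in> max_cones B"
  shows "psi B C = realvec (matching_hat (cone_matching B L V C))"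
    "perfect_matching L V a (cone_matching B L V C)"
proof -
  obtain v where v: "off_rays v" "L_of_cone B C = {{i, j} | i j. between i v j}"
    using max_cone_obtain[OF assms] .
  show "psi B C = realvec (matching_hat (cone_matching B L V C))"
    using psi_eq[OF v(2)] cone_matching_eq[OF v(2)] by simp
  show "perfect_matching L V a (cone_matching B L V C)"
    using cone_tiles_perfect[OF v(1)] cone_matching_eq[OF v(2)] by simp
qed

lemma finite_psi_image: "finite (psi B ` max_cones B)"
proof (rule finite_subset)
  show "psi B ` max_cones B \<subseteq> (\<lambda>P. realvec (matching_hat P)) ` Pow (tiles L V)"
    using psi_cone_matching(1) by (auto simp: cone_matching_def)
qed (simp add: finite_tiles)

lemma adjacent_max_cone:
  assumes "adjacent i j"
  obtains C where "C \<in> max_cones B"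
    "\<And>P m. perfect_matching L V a P \<Longrightarrow> m = i \<or> m = j \<Longrightarrow> realvec (matching_hat P) $ m \<le> psi B C $ m"
proof -
  let ?v = "bv i + bv j"
  note v = adjacent_off_rays[OF assms]
  obtain C where C: "C \<in> max_cones B" "L_of_cone B C = {{i, j} | i j. between i ?v j}"
    using max_cone_exists[OF v(1)] .
  have "realvec (matching_hat P) $ m \<le> psi B C $ m" if P: "perfect_matching L V a P" and m: "m = i \<or> m = j" for P m
    using matching_hits_le(1)[OF P assms v(2,1) m] finite_matching[OF P]
      finite_matching[OF cone_tiles_perfect[OF v(1)]] by (simp add: psi_eq[OF C(2)] matching_hat_nth)
  then show thesis using that C(1) by blast
qed

lemma matching_in_secondary_polygon:
  assumes P: "perfect_matching L V a P"
  shows "realvec (matching_hat P) \<in> secondary_polygon B"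
proof (rule ccontr)
  let ?z = "realvec (matching_hat P)"
  assume "?z \<notin> secondary_polygon B"
  moreover have "convex (secondary_polygon B)" "closed (secondary_polygon B)"
    unfolding secondary_polygon_def using finite_psi_image
    by (auto intro: compact_imp_closed compact_convex_hull finite_imp_compact)
  ultimately obtain c \<beta> where sep: "c \<bullet> ?z < \<beta>" "\<forall>x\<in>secondary_polygon B. \<beta> < c \<bullet> x"
    using separating_hyperplane_closed_point by blast
  have lt: "c \<bullet> ?z < c \<bullet> psi B C" if "C \<in> max_cones B" for C
    using sep that by (force simp: secondary_polygon_def intro: hull_inc)
  \<comment> \<open>On the lattice plane \<open>c\<close> is the functional
    \<open>u \<mapsto> - (v \<bullet> u)\<close>. If \<open>v\<close> lies in the sector of adjacent
    \<open>b\<^sub>i\<close>, \<open>b\<^sub>j\<close>, then \<open>c\<close> is minimal at the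
    point of their cone, because that point maximises the coordinates \<open>i\<close> and
    \<open>j\<close>.\<close>
  define v where "v = - (\<Sum>m\<in>UNIV. c $ m *\<^sub>R bv m)"
  obtain i j where adj: "adjacent i j" "cross2 (bv i) v \<ge> 0" "cross2 v (bv j) \<ge> 0"
  proof (cases "v = 0")
    case True
    obtain i :: 'n where True by blast
    show thesis using adjacent_cover[OF bv_nonzero[of i]] that True by auto
  next
    case False
    then show thesis using adjacent_cover that by (metis less_imp_le)
  qed
  obtain C where C: "C \<in> max_cones B"
    "\<And>P m. perfect_matching L V a P \<Longrightarrow> m = i \<or> m = j \<Longrightarrow> realvec (matching_hat P) $ m \<le> psi B C $ m"
    using adjacent_max_cone[OF adj(1)] by metis
  note psi = psi_cone_matching[OF C(1)]
  define l where "l = matching_hat P - matching_hat (cone_matching B L V C)"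
  have "l \<in> L" unfolding l_def by (rule matching_hat_diff[OF P psi(2)])
  then obtain x y where "\<forall>m. l $ m = x * B $ 1 $ m + y * B $ 2 $ m" unfolding L_iff by blast
  then obtain u where u: "\<And>m. real_of_int (l $ m) = bv m \<bullet> u"
    by (intro that[of "vector [of_int x, of_int y]"]) (simp add: inner_2 bvec_nth vector_2)
  have zl: "?z - psi B C = realvec l" by (simp add: psi(1) l_def realvec_simps)
  have le: "bv i \<bullet> u \<le> 0" "bv j \<bullet> u \<le> 0"
    using C(2)[OF P, of i] C(2)[OF P, of j] arg_cong[OF zl, of "\<lambda>x. x $ i"] arg_cong[OF zl, of "\<lambda>x. x $ j"] u
    by simp_all
  have "c \<bullet> (?z - psi B C) = (\<Sum>m\<in>UNIV. c $ m * (bv m \<bullet> u))"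
    unfolding zl inner_vec_def[of c] by (simp add: u)
  also have "\<dots> = - (v \<bullet> u)" by (simp add: v_def inner_sum_left)
  finally have cz: "c \<bullet> (?z - psi B C) = - (v \<bullet> u)" .
  have "cross2 (bv i) (bv j) * (v \<bullet> u) = cross2 v (bv j) * (bv i \<bullet> u) + cross2 (bv i) v * (bv j \<bullet> u)"
    using arg_cong[OF cramer[of "bv i" "bv j" v], of "\<lambda>w. w \<bullet> u"] by (simp add: inner_add_left)
  also have "\<dots> \<le> 0" using adj le by (simp add: add_nonpos_nonpos mult_nonneg_nonpos)
  finally have "v \<bullet> u \<le> 0" using adj(1) by (simp add: adjacent_def mult_le_0_iff)
  then show False using cz lt[OF C(1)] by (simp add: inner_diff_right)
qed

text \<open>Both boundary coordinates are maximal at \<open>psi B C\<close>, and a point attaining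
  both maxima differs from it by a lattice element with two transversal zeros. So the sum of the two
  coordinates has a strict maximum there.\<close>

lemma psi_extreme_point:
  assumes "C \<in> max_cones B"
  shows "psi B C extreme_point_of secondary_polygon B"
proof -
  obtain v where v: "off_rays v" "L_of_cone B C = {{i, j} | i j. between i v j}"
    using max_cone_obtain[OF assms] .
  obtain i j where adj: "adjacent i j" "between i v j" using off_rays_adjacent[OF v(1)] .
  have ij: "cross2 (bv i) (bv j) \<noteq> 0" using adj(1) by (simp add: adjacent_def)
  define c :: "real ^ 'n" where "c = axis i 1 + axis j 1"
  have c: "c \<bullet> x = x $ i + x $ j" for x by (simp add: c_def inner_add_left inner_axis')
  have lt: "c \<bullet> x < c \<bullet> psi B C" if x: "x \<in> psi B ` max_cones B - {psi B C}" for x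
  proof -
    obtain C' where C': "C' \<in> max_cones B" "x = psi B C'" using x by blast
    let ?P = "cone_matching B L V C'" and ?Q = "cone_tiles v"
    note P = psi_cone_matching[OF C'(1)]
    have Q: "perfect_matching L V a ?Q" by (rule cone_tiles_perfect[OF v(1)])
    have le: "card (hits ?P m) \<le> card (hits ?Q m)" if "m = i \<or> m = j" for m
      using matching_hits_le(1)[OF P(2) adj v(1) that] .
    have eq: "x $ m = real (card (hits ?P m))" "psi B C $ m = real (card (hits ?Q m))" for m
      using finite_matching[OF P(2)] finite_matching[OF Q] by (simp_all add: C'(2) P(1) psi_eq[OF v(2)] matching_hat_nth)
    have "\<not> (card (hits ?P i) = card (hits ?Q i) \<and> card (hits ?P j) = card (hits ?Q j))"
    proof
      assume "card (hits ?P i) = card (hits ?Q i) \<and> card (hits ?P j) = card (hits ?Q j)"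
      then have "matching_hat ?P - matching_hat ?Q = 0"
        using finite_matching[OF P(2)] finite_matching[OF Q]
        by (intro eq_zero_in_L[OF matching_hat_diff[OF P(2) Q] ij]) (simp_all add: matching_hat_nth)
      then show False using x P(1) C'(2) psi_eq[OF v(2)] by simp
    qed
    then show ?thesis unfolding c eq using le[OF disjI1[OF refl]] le[OF disjI2[OF refl]] by linarith
  qed
  have "convex hull (psi B ` max_cones B - {psi B C}) \<subseteq> {x. c \<bullet> x < c \<bullet> psi B C}"
    using lt by (intro hull_minimal) (auto simp: convex_halfspace_lt)
  then have "psi B C \<notin> convex hull (psi B ` max_cones B - {psi B C})" by blast
  then have "psi B C extreme_point_of convex hull (insert (psi B C) (psi B ` max_cones B - {psi B C}))"
    using finite_psi_image by (intro extreme_point_of_convex_hull_insert) auto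
  then show ?thesis using assms by (simp add: secondary_polygon_def insert_absorb)
qed

section \<open>The determinant of the bi-adjacency matrix\<close>

lemma prod_single:
  "finite A \<Longrightarrow> (\<Prod>x\<in>A. Poly_Mapping.single (f x) (g x)) = Poly_Mapping.single (\<Sum>x\<in>A. f x) (\<Prod>x\<in>A. (g x :: complex))"
  by (induction A rule: finite_induct) (auto simp: mult_single simp flip: single_one)

definition monomial :: "'n square set \<Rightarrow> 'n \<Rightarrow>\<^sub>0 nat"
  where "monomial e = (\<Sum>i\<in>tile_type e. Poly_Mapping.single i 1)"

lemma lookup_monomial: "Poly_Mapping.lookup (monomial e) i = (if i \<in> tile_type e then 1 else 0)"
  by (simp add: monomial_def lookup_sum lookup_single when_def)

lemma tile_weight:
  "const_poly c * (\<Prod>i\<in>tile_type e. var i) = Poly_Mapping.single (monomial e) c"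
  by (simp add: const_poly_def var_def prod_single mult_single monomial_def)

lemma lookup_sign_mult:
  "Poly_Mapping.lookup (of_int (sign \<pi>) * p) m = of_int (sign \<pi>) * (Poly_Mapping.lookup p m :: complex)"
  by (cases \<pi> rule: sign_cases) simp_all

text \<open>A permutation does not determine the tiles, since several may join the same two nodes; a
  candidate picks one for each black node. \<open>Pi\<^sub>E\<close> fixes the values elsewhere, so
  that each choice is counted once.\<close>

definition candidates :: "((int ^ 'n) set \<Rightarrow> (int ^ 'n) set) \<Rightarrow> ((int ^ 'n) set \<Rightarrow> (int ^ 'n) set) \<Rightarrow>
    ((int ^ 'n) set \<Rightarrow> 'n square set) set"
  where "candidates \<beta> \<pi> = Pi\<^sub>E (black_nodes L V a)
    (\<lambda>b. {e \<in> tiles L V. tile_black a e = b \<and> tile_white a e = \<beta> (\<pi> b)})"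

text \<open>Distributing the product over the sums in the matrix entries turns the determinant into
  a sum over permutations and choices of tiles.\<close>

lemma lookup_det:
  "Poly_Mapping.lookup (det_via (black_nodes L V a) \<beta> (biadjacency L V a wt)) m =
    (\<Sum>\<pi> | \<pi> permutes black_nodes L V a. of_int (sign \<pi>) *
      (\<Sum>\<phi>\<in>candidates \<beta> \<pi>. if (\<Sum>b\<in>black_nodes L V a. monomial (\<phi> b)) = m
        then \<Prod>b\<in>black_nodes L V a. wt (\<phi> b) else 0))"
proof -
  let ?R = "black_nodes L V a"
  note R = finite_black_nodes
  have "(\<Prod>b\<in>?R. biadjacency L V a wt b (\<beta> (\<pi> b))) =
      (\<Sum>\<phi>\<in>candidates \<beta> \<pi>. Poly_Mapping.single (\<Sum>b\<in>?R. monomial (\<phi> b)) (\<Prod>b\<in>?R. wt (\<phi> b)))" for \<pi>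
  proof -
    have "(\<Prod>b\<in>?R. biadjacency L V a wt b (\<beta> (\<pi> b))) =
        (\<Sum>\<phi>\<in>candidates \<beta> \<pi>. \<Prod>b\<in>?R. Poly_Mapping.single (monomial (\<phi> b)) (wt (\<phi> b)))"
      unfolding biadjacency_def tile_weight candidates_def
      by (rule prod_sum_PiE[where f="\<lambda>b e. Poly_Mapping.single (monomial e) (wt e)"])
        (simp_all add: R finite_tiles)
    then show ?thesis by (simp only: prod_single[OF R])
  qed
  then show ?thesis
    unfolding det_via_def lookup_sum lookup_sign_mult by (simp add: lookup_sum lookup_single when_def)
qed

context
  fixes \<beta>
  assumes \<beta>: "bij_betw \<beta> (black_nodes L V a) (white_nodes L V a)"
begin

lemma candidate_tile:
  assumes "\<phi> \<in> candidates \<beta> \<pi>" "b \<in> black_nodes L V a"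
  shows "\<phi> b \<in> tiles L V" "tile_black a (\<phi> b) = b" "tile_white a (\<phi> b) = \<beta> (\<pi> b)"
  using PiE_mem[OF assms(1)[unfolded candidates_def] assms(2)] by auto

lemma candidate_matching:
  assumes \<pi>: "\<pi> permutes black_nodes L V a" and \<phi>: "\<phi> \<in> candidates \<beta> \<pi>"
  shows "perfect_matching L V a (\<phi> ` black_nodes L V a)"
  unfolding perfect_matching_def
proof (intro conjI ballI)
  note c = candidate_tile[OF \<phi>]
  show "\<phi> ` black_nodes L V a \<subseteq> tiles L V" using c(1) by blast
  show "\<exists>!e. e \<in> \<phi> ` black_nodes L V a \<and> tile_black a e = b" if b: "b \<in> black_nodes L V a" for b
    by (rule ex1I[of _ "\<phi> b"]) (use b c(2) in auto)
  fix w assume "w \<in> white_nodes L V a"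
  then obtain b' where b': "b' \<in> black_nodes L V a" "w = \<beta> b'" using \<beta> by (auto simp: bij_betw_def)
  then obtain b where b: "b \<in> black_nodes L V a" "b' = \<pi> b" using permutes_image[OF \<pi>] by blast
  show "\<exists>!e. e \<in> \<phi> ` black_nodes L V a \<and> tile_white a e = w"
  proof (rule ex1I[of _ "\<phi> b"])
    show "\<phi> b \<in> \<phi> ` black_nodes L V a \<and> tile_white a (\<phi> b) = w" using b b' c(3) by simp
    fix e assume e: "e \<in> \<phi> ` black_nodes L V a \<and> tile_white a e = w"
    then obtain r where r: "r \<in> black_nodes L V a" "e = \<phi> r" by blast
    then have "\<beta> (\<pi> r) = \<beta> (\<pi> b)" using e c(3) b b' by simp
    moreover have "\<pi> r \<in> black_nodes L V a" "\<pi> b \<in> black_nodes L V a"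
      using r b permutes_in_image[OF \<pi>] by auto
    ultimately have "\<pi> r = \<pi> b" using \<beta> by (auto simp: bij_betw_def inj_on_def)
    then show "e = \<phi> b" using permutes_inj[OF \<pi>] r by (simp add: inj_eq)
  qed
qed

lemma lookup_candidate:
  assumes "\<phi> \<in> candidates \<beta> \<pi>"
  shows "int (Poly_Mapping.lookup (\<Sum>b\<in>black_nodes L V a. monomial (\<phi> b)) i) =
    matching_hat (\<phi> ` black_nodes L V a) $ i"
proof -
  have inj: "inj_on \<phi> (black_nodes L V a)"
    using candidate_tile(2)[OF assms] by (metis inj_onI)
  have "matching_hat (\<phi> ` black_nodes L V a) $ i = (\<Sum>b\<in>black_nodes L V a. if i \<in> tile_type (\<phi> b) then 1 else 0)"
    by (simp add: matching_hat_eq sum_component stdsum_nth sum.reindex[OF inj])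
  also have "\<dots> = int (Poly_Mapping.lookup (\<Sum>b\<in>black_nodes L V a. monomial (\<phi> b)) i)"
    unfolding lookup_sum of_nat_sum by (rule sum.cong) (simp_all add: lookup_monomial)
  finally show ?thesis by simp
qed

lemma matching_candidate:
  assumes P: "perfect_matching L V a P"
  obtains \<pi> \<phi> where "\<pi> permutes black_nodes L V a" "\<phi> \<in> candidates \<beta> \<pi>" "\<phi> ` black_nodes L V a = P"
proof -
  let ?R = "black_nodes L V a"
  note bb = matching_bij_black[OF P] and bw = matching_bij_white[OF P]
  define \<psi> where "\<psi> = the_inv_into P (tile_black a)"
  have \<psi>: "bij_betw \<psi> ?R P" unfolding \<psi>_def by (rule bij_betw_the_inv_into[OF bb])
  have \<psi>b: "tile_black a (\<psi> b) = b" if "b \<in> ?R" for b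
    unfolding \<psi>_def using f_the_inv_into_f[of "tile_black a" P b] bb that by (auto simp: bij_betw_def)
  \<comment> \<open>The column of \<open>\<sigma> b\<close> under \<open>\<beta>\<close> is the
    white partner of \<open>b\<close> in \<open>P\<close>.\<close>
  define \<sigma> where "\<sigma> = the_inv_into ?R \<beta> \<circ> (tile_white a \<circ> \<psi>)"
  have \<sigma>: "bij_betw \<sigma> ?R ?R"
    unfolding \<sigma>_def by (intro bij_betw_trans[OF bij_betw_trans[OF \<psi> bw] bij_betw_the_inv_into[OF \<beta>]])
  define \<pi> where "\<pi> b = (if b \<in> ?R then \<sigma> b else b)" for b
  have "bij_betw \<pi> ?R ?R" using \<sigma> by (simp add: \<pi>_def cong: bij_betw_cong)
  then have \<pi>: "\<pi> permutes ?R" by (rule bij_imp_permutes) (simp add: \<pi>_def)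
  have \<beta>\<pi>: "\<beta> (\<pi> b) = tile_white a (\<psi> b)" if b: "b \<in> ?R" for b
  proof -
    have "tile_white a (\<psi> b) \<in> \<beta> ` ?R" using \<beta> bw \<psi> b by (auto simp: bij_betw_def)
    then show ?thesis using f_the_inv_into_f[of \<beta> ?R] \<beta> b by (simp add: \<pi>_def \<sigma>_def bij_betw_def)
  qed
  have "restrict \<psi> ?R \<in> candidates \<beta> \<pi>"
    using \<psi> matching_tiles[OF P] \<psi>b \<beta>\<pi> by (auto simp: candidates_def bij_betw_def)
  moreover have "restrict \<psi> ?R ` ?R = P" using \<psi> by (simp add: bij_betw_def image_restrict_eq)
  ultimately show thesis using that \<pi> by blast
qed

text \<open>Terms of general matchings may cancel, so these only bound the support from above. The
  coefficient for a cone is a single product of weights, up to sign.\<close>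

lemma newton_points:
  assumes wt: "\<forall>e\<in>tiles L V. wt e \<noteq> 0"
  defines "S \<equiv> (\<lambda>m. \<chi> i. real (Poly_Mapping.lookup m i)) `
    Poly_Mapping.keys (det_via (black_nodes L V a) \<beta> (biadjacency L V a wt))"
  shows "\<And>x. x \<in> S \<Longrightarrow> \<exists>P. perfect_matching L V a P \<and> x = realvec (matching_hat P)"
    and "\<And>v. off_rays v \<Longrightarrow> realvec (matching_hat (cone_tiles v)) \<in> S"
proof -
  let ?R = "black_nodes L V a" and ?D = "det_via (black_nodes L V a) \<beta> (biadjacency L V a wt)"
  have vec: "(\<chi> i. real (Poly_Mapping.lookup (\<Sum>b\<in>?R. monomial (\<phi> b)) i)) = realvec (matching_hat (\<phi> ` ?R))"
    if "\<phi> \<in> candidates \<beta> \<pi>" for \<phi> \<pi>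
  proof -
    have "real (Poly_Mapping.lookup (\<Sum>b\<in>?R. monomial (\<phi> b)) i) = real_of_int (matching_hat (\<phi> ` ?R) $ i)" for i
      unfolding lookup_candidate[OF that, of i, symmetric] by (rule of_int_of_nat_eq[symmetric])
    then show ?thesis by (simp add: vec_eq_iff)
  qed
  show "\<exists>P. perfect_matching L V a P \<and> x = realvec (matching_hat P)" if x: "x \<in> S" for x
  proof -
    from x[unfolded S_def] obtain m where m: "x = (\<chi> i. real (Poly_Mapping.lookup m i))" "m \<in> Poly_Mapping.keys ?D"
      by (rule imageE)
    have "\<exists>\<pi> \<phi>. \<pi> permutes ?R \<and> \<phi> \<in> candidates \<beta> \<pi> \<and> (\<Sum>b\<in>?R. monomial (\<phi> b)) = m"
    proof (rule ccontr)
      assume no: "\<not> ?thesis"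
      have "Poly_Mapping.lookup ?D m = 0"
        unfolding lookup_det
      proof (intro sum.neutral ballI)
        fix \<pi> assume "\<pi> \<in> {\<pi>. \<pi> permutes ?R}"
        then have "(\<Sum>\<phi>\<in>candidates \<beta> \<pi>. if (\<Sum>b\<in>?R. monomial (\<phi> b)) = m then \<Prod>b\<in>?R. wt (\<phi> b) else 0) = 0"
          using no by (intro sum.neutral ballI) auto
        then show "of_int (sign \<pi>) * (\<Sum>\<phi>\<in>candidates \<beta> \<pi>. if (\<Sum>b\<in>?R. monomial (\<phi> b)) = m then \<Prod>b\<in>?R. wt (\<phi> b) else 0) = 0"
          by simp
      qed
      then show False using m(2) by (simp add: in_keys_iff)
    qed
    then show ?thesis using candidate_matching vec m(1) by metis
  qed
  show "realvec (matching_hat (cone_tiles v)) \<in> S" if v: "off_rays v" for v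
  proof -
    have Q: "perfect_matching L V a (cone_tiles v)" by (rule cone_tiles_perfect[OF v])
    obtain \<pi> \<phi> where \<pi>: "\<pi> permutes ?R" and \<phi>: "\<phi> \<in> candidates \<beta> \<pi>" "\<phi> ` ?R = cone_tiles v"
      using matching_candidate[OF Q] .
    define m where "m = (\<Sum>b\<in>?R. monomial (\<phi> b))"
    note R = finite_black_nodes
    \<comment> \<open>The exponent determines the matching by \<open>cone_matching_unique\<close>,
      the matching determines the tile at each black node, and the tiles determine the permutation;
      one summand is left.\<close>
    have uniq: "\<phi>' = \<phi> \<and> \<pi>' = \<pi>"
      if "\<pi>' permutes ?R" "\<phi>' \<in> candidates \<beta> \<pi>'" "(\<Sum>b\<in>?R. monomial (\<phi>' b)) = m" for \<pi>' \<phi>'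
    proof -
      have P': "perfect_matching L V a (\<phi>' ` ?R)" by (rule candidate_matching[OF that(1,2)])
      have "card (hits (\<phi>' ` ?R) i) = card (hits (cone_tiles v) i)" for i
        using lookup_candidate[OF that(2), of i] lookup_candidate[OF \<phi>(1), of i] that(3) \<phi>(2)
          finite_matching[OF P'] finite_matching[OF Q] by (simp add: m_def matching_hat_nth)
      then have im: "\<phi>' ` ?R = cone_tiles v" using cone_matching_unique[OF P' v] by blast
      have on: "\<phi>' b = \<phi> b" if b: "b \<in> ?R" for b
      proof -
        have "\<phi>' b \<in> cone_tiles v" "\<phi> b \<in> cone_tiles v" using im \<phi>(2) b by auto
        moreover have "tile_black a (\<phi>' b) = tile_black a (\<phi> b)"
          using candidate_tile(2)[OF \<open>\<phi>' \<in> candidates \<beta> \<pi>'\<close> b] candidate_tile(2)[OF \<phi>(1) b] by simp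
        ultimately show ?thesis using matching_bij_black[OF Q] by (auto simp: bij_betw_def inj_on_def)
      qed
      have "\<phi>' = \<phi>"
      proof (rule extensionalityI)
        show "\<phi>' \<in> extensional ?R" "\<phi> \<in> extensional ?R"
          using that(2) \<phi>(1) unfolding candidates_def PiE_iff by blast+
      qed (rule on)
      moreover have "\<pi>' = \<pi>"
      proof
        fix b
        show "\<pi>' b = \<pi> b"
        proof (cases "b \<in> ?R")
          case True
          then have "\<beta> (\<pi>' b) = \<beta> (\<pi> b)"
            using candidate_tile(3)[OF that(2) True] candidate_tile(3)[OF \<phi>(1) True] on by simp
          moreover have "\<pi>' b \<in> ?R" "\<pi> b \<in> ?R"
            using True permutes_in_image[OF that(1)] permutes_in_image[OF \<pi>] by auto
          ultimately show ?thesis using \<beta> by (auto simp: bij_betw_def inj_on_def)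
        next
          case False
          then show ?thesis using permutes_not_in[OF that(1)] permutes_not_in[OF \<pi>] by simp
        qed
      qed
      ultimately show ?thesis by blast
    qed
    have fin: "finite {\<pi>. \<pi> permutes ?R}" using R by (rule finite_permutations)
    have finc: "finite (candidates \<beta> \<pi>')" for \<pi>'
      unfolding candidates_def using R finite_tiles by (intro finite_PiE) auto
    let ?f = "\<lambda>\<phi>'. if (\<Sum>b\<in>?R. monomial (\<phi>' b)) = m then \<Prod>b\<in>?R. wt (\<phi>' b) else 0"
    have "Poly_Mapping.lookup ?D m = (\<Sum>\<pi>'\<in>{\<pi>}. of_int (sign \<pi>') * (\<Sum>\<phi>'\<in>candidates \<beta> \<pi>'. ?f \<phi>'))"
      unfolding lookup_det
    proof (intro sum.mono_neutral_right[OF fin] ballI)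
      fix \<pi>' assume \<pi>': "\<pi>' \<in> {\<pi>. \<pi> permutes ?R} - {\<pi>}"
      then have "(\<Sum>\<phi>'\<in>candidates \<beta> \<pi>'. ?f \<phi>') = 0"
        using uniq by (intro sum.neutral ballI) auto
      then show "of_int (sign \<pi>') * (\<Sum>\<phi>'\<in>candidates \<beta> \<pi>'. ?f \<phi>') = 0" by simp
    qed (use \<pi> in simp)
    also have "(\<Sum>\<phi>'\<in>candidates \<beta> \<pi>. ?f \<phi>') = (\<Sum>\<phi>'\<in>{\<phi>}. ?f \<phi>')"
      using finc \<phi>(1) uniq[OF \<pi>] by (intro sum.mono_neutral_right) auto
    then have "(\<Sum>\<pi>'\<in>{\<pi>}. of_int (sign \<pi>') * (\<Sum>\<phi>'\<in>candidates \<beta> \<pi>'. ?f \<phi>')) = of_int (sign \<pi>) * (\<Prod>b\<in>?R. wt (\<phi> b))"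
      by (simp add: m_def)
    finally have "Poly_Mapping.lookup ?D m = of_int (sign \<pi>) * (\<Prod>b\<in>?R. wt (\<phi> b))" .
    moreover have "(\<Prod>b\<in>?R. wt (\<phi> b)) \<noteq> 0"
      using wt candidate_tile(1)[OF \<phi>(1)] R by simp
    ultimately have "m \<in> Poly_Mapping.keys ?D" by (simp add: in_keys_iff)
    then show ?thesis unfolding S_def using vec[OF \<phi>(1)] \<phi>(2) by (intro image_eqI) (simp_all add: m_def)
  qed
qed

lemma newton_polytope_det:
  assumes wt: "\<forall>e\<in>tiles L V. wt e \<noteq> 0"
  shows "newton_polytope (det_via (black_nodes L V a) \<beta> (biadjacency L V a wt)) = secondary_polygon B"
proof -
  let ?S = "(\<lambda>m. \<chi> i. real (Poly_Mapping.lookup m i)) `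
      Poly_Mapping.keys (det_via (black_nodes L V a) \<beta> (biadjacency L V a wt))"
  note pts = newton_points[OF wt]
  have "?S \<subseteq> secondary_polygon B"
  proof
    fix x assume "x \<in> ?S"
    from pts(1)[OF this] obtain P where "perfect_matching L V a P" "x = realvec (matching_hat P)" by blast
    then show "x \<in> secondary_polygon B" using matching_in_secondary_polygon by simp
  qed
  then have "convex hull ?S \<subseteq> secondary_polygon B"
    by (intro hull_minimal) (simp_all add: secondary_polygon_def)
  moreover have "psi B ` max_cones B \<subseteq> ?S"
  proof (rule image_subsetI)
    fix C assume "C \<in> max_cones B"
    then obtain v where v: "off_rays v" "L_of_cone B C = {{i, j} | i j. between i v j}"
      using max_cone_obtain by blast
    show "psi B C \<in> ?S" unfolding psi_eq[OF v(2)] by (rule pts(2)[OF v(1)])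
  qed
  then have "secondary_polygon B \<subseteq> convex hull ?S"
    unfolding secondary_polygon_def by (rule hull_mono)
  ultimately show ?thesis unfolding newton_polytope_def by (rule antisym)
qed

end

end

theorem theorem9p3:
  fixes L :: "(int ^ 'n::finite) set"
    and B :: "int ^ 'n ^ 2"
    and V :: "(int ^ 'n) set"
    and a :: int
    and wt :: "'n square set \<Rightarrow> complex"
  assumes "lattice_basis B L"
    and "\<forall>i. \<exists>l\<in>L. l $ i \<noteq> 0"
    and "\<forall>l\<in>L. coord_sum l = 0"
    and "perfect_surface L V a"
    and "\<forall>e\<in>tiles L V. wt e \<noteq> 0"
  shows "(\<exists>\<beta>. bij_betw \<beta> (black_nodes L V a) (white_nodes L V a)) \<and>
    (\<forall>C\<in>max_cones B. perfect_matching L V a (cone_matching B L V C)) \<and>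
    (\<forall>\<beta>. bij_betw \<beta> (black_nodes L V a) (white_nodes L V a) \<longrightarrow>
      newton_polytope (det_via (black_nodes L V a) \<beta> (biadjacency L V a wt)) =
        secondary_polygon B \<and>
      {x. x extreme_point_of
          newton_polytope (det_via (black_nodes L V a) \<beta> (biadjacency L V a wt))} =
        {realvec (matching_hat (cone_matching B L V C)) | C. C \<in> max_cones B})"
proof -
  interpret lattice_plane L B by unfold_locales (fact assms)+
  have "is_surface L V" using assms(4) by (simp add: perfect_surface_def)
  then interpret perfect L B V a
    using surface_pseudoplane assms(4) by unfold_locales (auto simp: perfect_surface_def)
  obtain P where P: "perfect_matching L V a P" by (rule matching_exists)
  \<comment> \<open>Any perfect matching pairs the two colours.\<close>
  have "bij_betw (tile_white a \<circ> the_inv_into P (tile_black a))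
      (black_nodes L V a) (white_nodes L V a)"
    by (rule bij_betw_trans[OF bij_betw_the_inv_into[OF matching_bij_black[OF P]] matching_bij_white[OF P]])
  moreover have "{x. x extreme_point_of secondary_polygon B} =
      {realvec (matching_hat (cone_matching B L V C)) | C. C \<in> max_cones B}"
  proof -
    have "{x. x extreme_point_of secondary_polygon B} = psi B ` max_cones B"
      using psi_extreme_point extreme_point_of_convex_hull by (auto simp: secondary_polygon_def)
    then show ?thesis using psi_cone_matching(1) by auto
  qed
  ultimately show ?thesis
    using psi_cone_matching(2) newton_polytope_det[OF _ assms(5)] by auto
qed

end
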